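(* Let $H$ be a split semisimple Hopf algebra over a field $\Bbbk$, let $R(H)$ be its representation algebra, and let $\chi_{\mathrm{ad}}\in H^*$ denote the character of the adjoint representation of $H$. If $R(H)$ is semisimple, then $\chi_{\mathrm{ad}}(g)\neq 0$ for every group-like element $g\in H$.
   Context: All Hopf algebras are finite-dimensional over $\Bbbk$. "Split semisimple" means that $H$ is semisimple and $\operatorname{End}_H(V)=\Bbbk$ for every irreducible $H$-module $V$. The Grothendieck ring $G_0(H)$ is the abelian group generated by the isomorphism classes $[V]$ of finite-dimensional left $H$-modules modulo the relations $[V]=[U]+[W]$ for short exact sequences $0\to U\to V\to W\to 0$, with multiplication $[V]\cdot[W]=[V\otimes_{\Bbbk} W]$ ($H$ acting via comultiplication). The representation algebra of $H$ is $R(H)=G_0(H)\otimes_{\mathbb{Z}}\Bbbk$. For a finite-dimensional left $H$-module $V$, its character $\chi_V\in H^*=\operatorname{Hom}_{\Bbbk}(H,\Bbbk)$ is $\chi_V(h)=\operatorname{Tr}(v\mapsto hv)$; the map $[V]\otimes 1\mapsto\chi_V$ embeds $R(H)$ as a subalgebra of the dual algebra $H^*$. The left adjoint representation $H_{\mathrm{ad}}$ is the vector space $H$ with action $\operatorname{ad}(h)(k)=\sum h_1 k\, \mathcal{S}(h_2)$ for $h,k\in H$, where $\mathcal{S}$ is the antipode and $\Delta h=\sum h_1\otimes h_2$. *)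

theory Defs
  imports
    "Jordan_Normal_Form.Matrix"
    "HOL-Algebra.QuotRing"
    "HOL-Algebra.Generated_Groups"
    "HOL-Algebra.Free_Abelian_Groups"
    "HOL-Algebra.Algebraic_Closure_Type"
begin

section \<open>Semisimple rings, integral monoid rings, tensor products over the integers\<close>

definition left_ideal :: "('a, 'b) ring_scheme \<Rightarrow> 'a set \<Rightarrow> bool" where
  "left_ideal R I \<longleftrightarrow>
     additive_subgroup I R \<and> (\<forall>r\<in>carrier R. \<forall>x\<in>I. r \<otimes>\<^bsub>R\<^esub> x \<in> I)"

text \<open>Every submodule of the left regular module is a direct summand. For a unital algebra over
  a field, left ideals of the underlying ring are automatically subspaces, so this is also
  semisimplicity as an algebra.\<close>

definition semisimple_ring :: "('a, 'b) ring_scheme \<Rightarrow> bool" where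
  "semisimple_ring R \<longleftrightarrow>
     (\<forall>I. left_ideal R I \<longrightarrow>
        (\<exists>J. left_ideal R J \<and> I \<inter> J = {\<zero>\<^bsub>R\<^esub>} \<and> I <+>\<^bsub>R\<^esub> J = carrier R))"

text \<open>The free abelian group on the carrier of a monoid, with the biadditive extension of the
  monoid multiplication.\<close>

definition monoid_ring :: "('a, 'b) monoid_scheme \<Rightarrow> ('a \<Rightarrow>\<^sub>0 int) ring" where
  "monoid_ring M =
     \<lparr>carrier = {x. Poly_Mapping.keys x \<subseteq> carrier M},
      monoid.mult = (\<lambda>x y. frag_extend (\<lambda>a. frag_extend (\<lambda>b. frag_of (a \<otimes>\<^bsub>M\<^esub> b)) y) x),
      one = frag_of \<one>\<^bsub>M\<^esub>,
      ring.zero = 0,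
      add = (+)\<rparr>"

definition int_tensor_relations ::
    "('a, 'c) ring_scheme \<Rightarrow> ('b, 'd) ring_scheme \<Rightarrow> (('a \<times> 'b) \<Rightarrow>\<^sub>0 int) set" where
  "int_tensor_relations A B =
     {frag_of (a \<oplus>\<^bsub>A\<^esub> a', b) - frag_of (a, b) - frag_of (a', b) | a a' b.
        a \<in> carrier A \<and> a' \<in> carrier A \<and> b \<in> carrier B} \<union>
     {frag_of (a, b \<oplus>\<^bsub>B\<^esub> b') - frag_of (a, b) - frag_of (a, b') | a b b'.
        a \<in> carrier A \<and> b \<in> carrier B \<and> b' \<in> carrier B}"

text \<open>The tensor product of two rings over the integers: the free abelian group on pairs modulo
  biadditivity, with \<open>(a \<otimes> b)(a' \<otimes> b') = aa' \<otimes> bb'\<close>.\<close>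

definition int_tensor_ring ::
    "('a, 'c) ring_scheme \<Rightarrow> ('b, 'd) ring_scheme \<Rightarrow> (('a \<times> 'b) \<Rightarrow>\<^sub>0 int) set ring" where
  "int_tensor_ring A B =
     monoid_ring (A \<times>\<times> B) Quot
       generate (free_Abelian_group (carrier A \<times> carrier B)) (int_tensor_relations A B)"


section \<open>Tensor powers of a vector space\<close>

text \<open>A list of \<open>n\<close>-tuples (each tuple itself a list) stands for the sum of the corresponding pure
  tensors in the \<open>n\<close>-th tensor power over the ground field, for \<open>n \<ge> 1\<close>. The tensor power is the
  free abelian group on tuples modulo additivity in each slot and moving scalars between slots;
  \<open>tensor_eq\<close> is equality in this quotient.\<close>

definition tensor_relations :: "('k \<Rightarrow> 'h \<Rightarrow> 'h::ab_group_add) \<Rightarrow> ('h list \<Rightarrow>\<^sub>0 int) set" where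
  "tensor_relations s =
     {frag_of (xs @ (a + b) # ys) - frag_of (xs @ a # ys) - frag_of (xs @ b # ys) | xs a b ys. True} \<union>
     {frag_of (xs @ s c a # ys @ b # zs) - frag_of (xs @ a # ys @ s c b # zs) | xs c a ys b zs. True}"

definition tensor_eq ::
    "('k \<Rightarrow> 'h \<Rightarrow> 'h::ab_group_add) \<Rightarrow> 'h list list \<Rightarrow> 'h list list \<Rightarrow> bool" where
  "tensor_eq s u v \<longleftrightarrow>
     (\<Sum>x\<leftarrow>u. frag_of x) - (\<Sum>x\<leftarrow>v. frag_of x) \<in>
       generate (free_Abelian_group UNIV) (tensor_relations s)"


section \<open>Finite-dimensional Hopf algebras\<close>

text \<open>The comultiplication is given in Sweedler form: \<open>comult h\<close> is a list of pairs
  \<open>(h\<^sub>1, h\<^sub>2)\<close> such that \<open>\<Sum> h\<^sub>1 \<otimes> h\<^sub>2\<close> is the coproduct of \<open>h\<close>. The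
  list is merely a representative: all axioms are imposed in the tensor powers of the algebra, and
  everything defined from \<open>comult\<close> below is bilinear in \<open>(h\<^sub>1, h\<^sub>2)\<close>.\<close>

locale hopf_algebra = vector_space scale
  for scale :: "'k::field \<Rightarrow> 'h::ring_1 \<Rightarrow> 'h" +
  fixes comult :: "'h \<Rightarrow> ('h \<times> 'h) list"
    and counit :: "'h \<Rightarrow> 'k"
    and antipode :: "'h \<Rightarrow> 'h"
  assumes finite_dim: "\<exists>B. finite B \<and> span B = UNIV"
    and scale_mult_left: "scale c x * y = scale c (x * y)"
    and scale_mult_right: "x * scale c y = scale c (x * y)"
    and comult_add: "tensor_eq scale [[a, b]. (a, b) \<leftarrow> comult (x + y)]
          ([[a, b]. (a, b) \<leftarrow> comult x] @ [[a, b]. (a, b) \<leftarrow> comult y])"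
    and comult_scale: "tensor_eq scale [[a, b]. (a, b) \<leftarrow> comult (scale c x)]
          [[scale c a, b]. (a, b) \<leftarrow> comult x]"
    and comult_mult: "tensor_eq scale [[a, b]. (a, b) \<leftarrow> comult (x * y)]
          [[a * c, b * d]. (a, b) \<leftarrow> comult x, (c, d) \<leftarrow> comult y]"
    and comult_one: "tensor_eq scale [[a, b]. (a, b) \<leftarrow> comult 1] [[1, 1]]"
    and coassoc: "tensor_eq scale [[a, b, d]. (c, d) \<leftarrow> comult x, (a, b) \<leftarrow> comult c]
          [[a, c, d]. (a, b) \<leftarrow> comult x, (c, d) \<leftarrow> comult b]"
    and counit_linear: "Vector_Spaces.linear scale (*) counit"
    and counit_mult: "counit (x * y) = counit x * counit y"
    and counit_one: "counit 1 = 1"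
    and counit_left: "(\<Sum>(a, b)\<leftarrow>comult x. scale (counit a) b) = x"
    and counit_right: "(\<Sum>(a, b)\<leftarrow>comult x. scale (counit b) a) = x"
    and antipode_linear: "Vector_Spaces.linear scale scale antipode"
    and antipode_left: "(\<Sum>(a, b)\<leftarrow>comult x. antipode a * b) = scale (counit x) 1"
    and antipode_right: "(\<Sum>(a, b)\<leftarrow>comult x. a * antipode b) = scale (counit x) 1"
begin

definition group_like :: "'h \<Rightarrow> bool" where
  "group_like g \<longleftrightarrow> g \<noteq> 0 \<and> tensor_eq scale [[a, b]. (a, b) \<leftarrow> comult g] [[g, g]]"

definition adjoint_action :: "'h \<Rightarrow> 'h \<Rightarrow> 'h" where
  "adjoint_action h k = (\<Sum>(a, b)\<leftarrow>comult h. a * k * antipode b)"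

definition endo_trace :: "('h \<Rightarrow> 'h) \<Rightarrow> 'k" where
  "endo_trace f =
     (let B = (SOME B. independent B \<and> span B = UNIV) in \<Sum>b\<in>B. representation B (f b) b)"

definition adjoint_character :: "'h \<Rightarrow> 'k" where
  "adjoint_character h = endo_trace (adjoint_action h)"


subsection \<open>Finite-dimensional modules\<close>

text \<open>Up to a choice of basis, a finite-dimensional left module is an action on the column space
  \<open>k\<^sup>n\<close>, that is, an algebra homomorphism into the \<open>n \<times> n\<close> matrices; \<open>n = 0\<close> is allowed.\<close>

definition module_dim :: "('h \<Rightarrow> 'k mat) \<Rightarrow> nat" where
  "module_dim \<rho> = dim_row (\<rho> 1)"

definition is_module :: "('h \<Rightarrow> 'k mat) \<Rightarrow> bool" where
  "is_module \<rho> \<longleftrightarrow>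
     (\<forall>x. \<rho> x \<in> carrier_mat (module_dim \<rho>) (module_dim \<rho>)) \<and>
     (\<forall>x y. \<rho> (x + y) = \<rho> x + \<rho> y) \<and>
     (\<forall>c x. \<rho> (scale c x) = c \<cdot>\<^sub>m \<rho> x) \<and>
     (\<forall>x y. \<rho> (x * y) = \<rho> x * \<rho> y) \<and>
     \<rho> 1 = 1\<^sub>m (module_dim \<rho>)"

definition intertwiners :: "('h \<Rightarrow> 'k mat) \<Rightarrow> ('h \<Rightarrow> 'k mat) \<Rightarrow> 'k mat set" where
  "intertwiners \<rho> \<sigma> =
     {f \<in> carrier_mat (module_dim \<sigma>) (module_dim \<rho>). \<forall>x. f * \<rho> x = \<sigma> x * f}"

definition invariant_subspace :: "('h \<Rightarrow> 'k mat) \<Rightarrow> 'k vec set \<Rightarrow> bool" where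
  "invariant_subspace \<rho> W \<longleftrightarrow>
     W \<subseteq> carrier_vec (module_dim \<rho>) \<and> 0\<^sub>v (module_dim \<rho>) \<in> W \<and>
     (\<forall>v\<in>W. \<forall>w\<in>W. v + w \<in> W) \<and> (\<forall>c. \<forall>v\<in>W. c \<cdot>\<^sub>v v \<in> W) \<and>
     (\<forall>x. \<forall>v\<in>W. \<rho> x *\<^sub>v v \<in> W)"

definition irreducible_module :: "('h \<Rightarrow> 'k mat) \<Rightarrow> bool" where
  "irreducible_module \<rho> \<longleftrightarrow>
     is_module \<rho> \<and> module_dim \<rho> \<noteq> 0 \<and>
     (\<forall>W. invariant_subspace \<rho> W \<longrightarrow> W = {0\<^sub>v (module_dim \<rho>)} \<or> W = carrier_vec (module_dim \<rho>))"

definition split_semisimple :: bool where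
  "split_semisimple \<longleftrightarrow>
     semisimple_ring (ring_of_type_algebra :: 'h ring) \<and>
     (\<forall>\<rho>. irreducible_module \<rho> \<longrightarrow>
        intertwiners \<rho> \<rho> = {c \<cdot>\<^sub>m 1\<^sub>m (module_dim \<rho>) | c. True})"

definition short_exact :: "('h \<Rightarrow> 'k mat) \<Rightarrow> ('h \<Rightarrow> 'k mat) \<Rightarrow> ('h \<Rightarrow> 'k mat) \<Rightarrow> bool" where
  "short_exact \<rho> \<sigma> \<tau> \<longleftrightarrow>
     (\<exists>f \<in> intertwiners \<rho> \<sigma>. \<exists>g \<in> intertwiners \<sigma> \<tau>.
        inj_on ((*\<^sub>v) f) (carrier_vec (module_dim \<rho>)) \<and>
        (*\<^sub>v) f ` carrier_vec (module_dim \<rho>) =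
          {v \<in> carrier_vec (module_dim \<sigma>). g *\<^sub>v v = 0\<^sub>v (module_dim \<tau>)} \<and>
        (*\<^sub>v) g ` carrier_vec (module_dim \<sigma>) = carrier_vec (module_dim \<tau>))"

definition iso_class :: "('h \<Rightarrow> 'k mat) \<Rightarrow> ('h \<Rightarrow> 'k mat) set" where
  "iso_class \<rho> = {\<sigma>. is_module \<sigma> \<and> (\<exists>f \<in> intertwiners \<rho> \<sigma>. invertible_mat f)}"

text \<open>The basis vector \<open>e\<^sub>p \<otimes> e\<^sub>q\<close> of the tensor product has index \<open>p * module_dim \<sigma> + q\<close>, so the
  summands below are entries of the Kronecker products of \<open>\<rho> h\<^sub>1\<close> and \<open>\<sigma> h\<^sub>2\<close>.\<close>

definition tensor_module :: "('h \<Rightarrow> 'k mat) \<Rightarrow> ('h \<Rightarrow> 'k mat) \<Rightarrow> 'h \<Rightarrow> 'k mat" where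
  "tensor_module \<rho> \<sigma> x =
     (let m = module_dim \<sigma> in
      mat (module_dim \<rho> * m) (module_dim \<rho> * m)
        (\<lambda>(i, j). \<Sum>(a, b)\<leftarrow>comult x.
           \<rho> a $$ (i div m, j div m) * \<sigma> b $$ (i mod m, j mod m)))"

definition trivial_module :: "'h \<Rightarrow> 'k mat" where
  "trivial_module x = mat 1 1 (\<lambda>_. counit x)"


subsection \<open>Grothendieck ring and representation algebra\<close>

definition iso_class_monoid :: "('h \<Rightarrow> 'k mat) set monoid" where
  "iso_class_monoid =
     \<lparr>carrier = iso_class ` Collect is_module,
      monoid.mult = (\<lambda>C D. \<Union>\<rho>\<in>C. \<Union>\<sigma>\<in>D. iso_class (tensor_module \<rho> \<sigma>)),
      one = iso_class trivial_module\<rparr>"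

definition grothendieck_relations :: "(('h \<Rightarrow> 'k mat) set \<Rightarrow>\<^sub>0 int) set" where
  "grothendieck_relations =
     {frag_of (iso_class \<sigma>) - frag_of (iso_class \<rho>) - frag_of (iso_class \<tau>) | \<rho> \<sigma> \<tau>.
        is_module \<rho> \<and> is_module \<sigma> \<and> is_module \<tau> \<and> short_exact \<rho> \<sigma> \<tau>}"

definition grothendieck_ring :: "(('h \<Rightarrow> 'k mat) set \<Rightarrow>\<^sub>0 int) set ring" where
  "grothendieck_ring =
     monoid_ring iso_class_monoid Quot
       generate (free_Abelian_group (carrier iso_class_monoid)) grothendieck_relations"

definition representation_algebra ::
    "((('h \<Rightarrow> 'k mat) set \<Rightarrow>\<^sub>0 int) set \<times> 'k \<Rightarrow>\<^sub>0 int) set ring" where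
  "representation_algebra =
     int_tensor_ring grothendieck_ring (ring_of_type_algebra :: 'k ring)"

end

end

theory Submission
  imports Defs
begin

text \<open>Evaluation at a group-like element \<open>g\<close> is an algebra map \<open>R(H) \<rightarrow> k\<close>, \<open>[V] \<mapsto> \<chi>\<^sub>V(g)\<close>. If \<open>R(H)\<close> is
semisimple, its kernel has a complementary left ideal, and this yields an element of \<open>R(H)\<close> on which
\<open>R(H)\<close> acts through the evaluation. Its image \<open>f\<close> in the dual algebra is a trace functional with
\<open>f(g) = 1\<close> and \<open>\<chi> * f = \<chi>(g) f\<close> for every character \<open>\<chi>\<close> (\<open>ex_eigenfunctional\<close>). The same argument,
applied to the algebra map \<open>\<epsilon> : H \<rightarrow> k\<close>, gives an integral \<open>\<Lambda>\<close> with \<open>\<epsilon>(\<Lambda>) = 1\<close>; it is two-sided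
(\<open>ex_normalized_two_sided_integral\<close>).

The adjoint action of \<open>g\<close> is \<open>k \<mapsto> g k S(g)\<close>, so \<open>\<chi>\<^sub>a\<^sub>d(g) = T(g, S(g))\<close>, where \<open>T(a, x)\<close> is the trace of
\<open>k \<mapsto> a k x\<close> on \<open>H\<close>. Since \<open>H\<close> is split semisimple, \<open>a \<mapsto> T(a, x)\<close> is a linear combination of
characters for each fixed \<open>x\<close> (\<open>two_sided_trace_in_character_span\<close>): the right multiplication by \<open>x\<close>
commutes with \<open>H\<close>, and on a minimal left ideal such an endomorphism is a scalar. The eigenfunctional
property may therefore be applied to \<open>T(-, S(g))\<close> and evaluated at \<open>\<Lambda>\<close>:
\<open>\<chi>\<^sub>a\<^sub>d(g) f(\<Lambda>) = \<Sum> T(\<Lambda>\<^sub>1, S(g)) f(\<Lambda>\<^sub>2)\<close>.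

For every trace functional \<open>f\<close> the right-hand side equals \<open>f(g)\<close>, which is \<open>1\<close> here
(\<open>trace_against_integral\<close>). Indeed
\<open>\<Sum> \<Lambda>\<^sub>1 k \<otimes> \<Lambda>\<^sub>2 = \<Sum> \<Lambda>\<^sub>1 \<otimes> \<Lambda>\<^sub>2 S(k)\<close>, so \<open>\<Sum> f(\<Lambda>\<^sub>2) \<Lambda>\<^sub>1 k S(g) = \<Sum> f(\<Lambda>\<^sub>2 S(k)) \<Lambda>\<^sub>1 S(g)\<close>, and the trace of this
finite-rank map of \<open>k\<close> is \<open>\<Sum> f(\<Lambda>\<^sub>2 S(\<Lambda>\<^sub>1 S(g)))\<close>. Replacing \<open>\<Lambda>\<close> by \<open>\<Lambda> g\<close> cancels \<open>S(g)\<close> and leaves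
\<open>\<Sum> f(\<Lambda>\<^sub>2 g S(\<Lambda>\<^sub>1)) = \<Sum> f(g S(\<Lambda>\<^sub>1) \<Lambda>\<^sub>2) = \<epsilon>(\<Lambda>) f(g)\<close>. Hence \<open>\<chi>\<^sub>a\<^sub>d(g)\<close> cannot vanish.

The rest of the work is to turn classes in \<open>R(H)\<close> into functionals on \<open>H\<close>. Both the Grothendieck
ring and its extension of scalars are integral monoid rings modulo the ideal generated by some
relations (\<open>presented_ring\<close>); a function on the monoid that respects the relations descends to the
quotient, and the product of classes becomes the convolution of functionals because the character
of a tensor product is \<open>\<Sum> \<chi>(x\<^sub>1) \<psi>(x\<^sub>2)\<close>. That the relations of the Grothendieck ring generate a
two-sided ideal amounts to exactness of the tensor product; it is proved by recording an exact
sequence together with a linear splitting, which consists of matrix identities that survive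
Kronecker products.\<close>

section \<open>Eigenvectors from semisimplicity\<close>

text \<open>Write \<open>1 = p + q\<close> along a complement \<open>J\<close> of \<open>I\<close>. For \<open>x\<close> in \<open>I\<close>, the element \<open>x q = x - x p\<close> lies in
\<open>I \<inter> J\<close>, so it vanishes.\<close>

lemma (in ring) left_ideal_right_unit:
  assumes ss: "semisimple_ring R" and I: "left_ideal R I"
  obtains p where "p \<in> I" "\<And>x. x \<in> I \<Longrightarrow> x \<otimes> p = x"
proof -
  obtain J where J: "left_ideal R J" "I \<inter> J = {\<zero>}" "I <+>\<^bsub>R\<^esub> J = carrier R"
    using ss I unfolding semisimple_ring_def by blast
  interpret I: additive_subgroup I R using I by (simp add: left_ideal_def)
  interpret J: additive_subgroup J R using J(1) by (simp add: left_ideal_def)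
  obtain p q where pq: "p \<in> I" "q \<in> J" "\<one> = p \<oplus> q"
    using J(3) one_closed unfolding set_add_def' by blast
  have carr: "p \<in> carrier R" "q \<in> carrier R"
    using pq(1,2) I.a_subset J.a_subset by auto
  show thesis
  proof (rule that[OF pq(1)])
    fix x assume x: "x \<in> I"
    then have xc: "x \<in> carrier R" using I.a_subset by auto
    (* The identity 1 = p + q multiplied by x. *)
    have split: "x \<otimes> p \<oplus> x \<otimes> q = x"
      using r_distr[OF carr(1,2) xc] pq(3) r_one[OF xc] by simp
    have xp: "x \<otimes> p \<in> I" using I pq(1) xc by (simp add: left_ideal_def)
    have "x \<otimes> q = \<ominus> (x \<otimes> p) \<oplus> (x \<otimes> p \<oplus> x \<otimes> q)"
      using r_neg1[of "x \<otimes> p" "x \<otimes> q"] xc carr by simp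
    also have "\<dots> \<in> I" unfolding split by (intro I.a_closed I.a_inv_closed xp x)
    finally have "x \<otimes> q \<in> I \<inter> J" using J(1) pq(2) xc by (simp add: left_ideal_def)
    then have "x \<otimes> q = \<zero>" unfolding J(2) by (rule singletonD)
    then show "x \<otimes> p = x" using split xc carr by simp
  qed
qed

text \<open>If \<open>p\<close> is a right unit of the kernel of \<open>\<phi>\<close>, then \<open>1 - p\<close> is annihilated from the left by the
kernel, so \<open>R\<close> acts on it through \<open>\<phi>\<close>. This is used for the counit of \<open>H\<close>, where it produces an
integral, and for the evaluation of \<open>R(H)\<close> at a group-like element.\<close>

lemma (in ring) eigenvector_of_character_if_semisimple:
  assumes S: "ring S" and phi: "\<phi> \<in> ring_hom R S" and ss: "semisimple_ring R"
  obtains j where "j \<in> carrier R" "\<phi> j = \<one>\<^bsub>S\<^esub>"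
    "\<And>x y. x \<in> carrier R \<Longrightarrow> y \<in> carrier R \<Longrightarrow> \<phi> x = \<phi> y \<Longrightarrow> x \<otimes> j = y \<otimes> j"
proof -
  interpret S: ring S by fact
  interpret phi: ring_hom_ring R S \<phi>
    by (rule ring_hom_ringI2) (use S phi ring_axioms in auto)
  define I where "I = a_kernel R S \<phi>"
  have I_eq: "I = {x \<in> carrier R. \<phi> x = \<zero>\<^bsub>S\<^esub>}"
    unfolding I_def a_kernel_def' ..
  have "left_ideal R I"
    unfolding left_ideal_def
  proof (intro conjI ballI)
    show "additive_subgroup I R"
      unfolding I_def by (rule phi.additive_subgroup_a_kernel)
    show "r \<otimes> x \<in> I" if "r \<in> carrier R" "x \<in> I" for r x
      using that by (auto simp: I_eq)
  qed
  then obtain p where p: "p \<in> I" "\<And>x. x \<in> I \<Longrightarrow> x \<otimes> p = x"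
    using left_ideal_right_unit[OF ss] by blast
  have pc: "p \<in> carrier R" "\<phi> p = \<zero>\<^bsub>S\<^esub>" using p(1) by (auto simp: I_eq)
  show thesis
  proof (rule that[of "\<one> \<ominus> p"])
    show "\<one> \<ominus> p \<in> carrier R" using pc(1) by simp
    show "\<phi> (\<one> \<ominus> p) = \<one>\<^bsub>S\<^esub>" using pc by (simp add: a_minus_def)
    fix x y assume xy: "x \<in> carrier R" "y \<in> carrier R" "\<phi> x = \<phi> y"
    have "x \<ominus> y \<in> I"
      using xy(1,2) by (simp add: I_eq a_minus_def xy(3) S.r_neg)
    then have "(x \<ominus> y) \<otimes> (\<one> \<ominus> p) = \<zero>"
      using xy(1,2) pc(1) p(2) by (simp add: a_minus_def r_distr r_minus r_neg)
    moreover have "(x \<ominus> y) \<otimes> (\<one> \<ominus> p) = x \<otimes> (\<one> \<ominus> p) \<ominus> y \<otimes> (\<one> \<ominus> p)"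
      using xy(1,2) pc(1) by (simp add: a_minus_def l_distr l_minus)
    ultimately show "x \<otimes> (\<one> \<ominus> p) = y \<otimes> (\<one> \<ominus> p)"
      using xy(1,2) pc(1) by simp
  qed
qed

lemma ring_ring_of_type_algebra: "ring (ring_of_type_algebra :: 'a::ring_1 ring)"
proof -
  have "\<exists>y. x + y = 0" for x :: 'a
    by (rule exI[of _ "- x"]) simp
  then show ?thesis
    unfolding ring_of_type_algebra_def
    by unfold_locales (auto simp: algebra_simps Units_def)
qed

lemma left_ideal_of_type_algebra:
  "left_ideal (ring_of_type_algebra :: 'a::ring_1 ring) I \<longleftrightarrow>
     0 \<in> I \<and> (\<forall>x\<in>I. \<forall>y\<in>I. x + y \<in> I) \<and> (\<forall>r. \<forall>x\<in>I. r * x \<in> I)"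
    (is "left_ideal ?R I \<longleftrightarrow> ?P")
proof -
  interpret R: ring ?R by (rule ring_ring_of_type_algebra)
  have neg: "\<ominus>\<^bsub>?R\<^esub> a = - a" for a
    by (rule R.minus_equality) (simp_all add: ring_of_type_algebra_def)
  show ?thesis
  proof
    assume I: "left_ideal ?R I"
    then interpret additive_subgroup I ?R by (simp add: left_ideal_def)
    show ?P
      using zero_closed a_closed I by (auto simp: left_ideal_def ring_of_type_algebra_def)
  next
    assume P: ?P
    have "subgroup I (add_monoid ?R)"
    proof (rule R.add.subgroupI)
      show "\<ominus>\<^bsub>?R\<^esub> a \<in> I" if "a \<in> I" for a
      proof -
        have "(- 1) * a \<in> I" using P that by blast
        then show ?thesis by (simp add: neg)
      qed
      show "I \<noteq> {}" using P by blast
    qed (use P in \<open>auto simp: ring_of_type_algebra_def\<close>)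
    then show "left_ideal ?R I"
      using P by (simp add: left_ideal_def additive_subgroup_def ring_of_type_algebra_def)
  qed
qed

lemma right_unit_of_left_ideal:
  fixes I :: "'a::ring_1 set"
  assumes "semisimple_ring (ring_of_type_algebra :: 'a ring)"
    and "0 \<in> I" "\<And>x y. x \<in> I \<Longrightarrow> y \<in> I \<Longrightarrow> x + y \<in> I" "\<And>r x. x \<in> I \<Longrightarrow> r * x \<in> I"
  obtains p where "p \<in> I" "\<And>x. x \<in> I \<Longrightarrow> x * p = x"
proof -
  interpret R: ring "ring_of_type_algebra :: 'a ring" by (rule ring_ring_of_type_algebra)
  have "left_ideal (ring_of_type_algebra :: 'a ring) I"
    unfolding left_ideal_of_type_algebra using assms(2-4) by blast
  from R.left_ideal_right_unit[OF assms(1) this] obtain p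
    where "p \<in> I" "\<And>x. x \<in> I \<Longrightarrow> x \<otimes>\<^bsub>(ring_of_type_algebra :: 'a ring)\<^esub> p = x"
    by blast
  then show thesis using that[of p] by (simp add: ring_of_type_algebra_def)
qed

section \<open>Integral monoid rings modulo relations\<close>

text \<open>The value of a formal integral combination under the additive extension of \<open>F\<close>. The values lie in a
ring only so that integer coefficients can act by multiplication.\<close>

definition frag_eval :: "('a \<Rightarrow> 'b::ring_1) \<Rightarrow> ('a \<Rightarrow>\<^sub>0 int) \<Rightarrow> 'b" where
  "frag_eval F z = (\<Sum>a\<in>Poly_Mapping.keys z. of_int (Poly_Mapping.lookup z a) * F a)"

lemma frag_eval_superset:
  assumes "finite A" "Poly_Mapping.keys z \<subseteq> A"
  shows "frag_eval F z = (\<Sum>a\<in>A. of_int (Poly_Mapping.lookup z a) * F a)"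
  unfolding frag_eval_def
  by (rule sum.mono_neutral_left) (use assms in \<open>auto simp: in_keys_iff\<close>)

lemma frag_eval_zero [simp]: "frag_eval F 0 = 0"
  by (simp add: frag_eval_def)

lemma frag_eval_of [simp]: "frag_eval F (frag_of a) = F a"
  by (simp add: frag_eval_def)

lemma frag_eval_diff: "frag_eval F (x - y) = frag_eval F x - frag_eval F y"
proof -
  let ?A = "Poly_Mapping.keys x \<union> Poly_Mapping.keys y"
  have "frag_eval F z = (\<Sum>a\<in>?A. of_int (Poly_Mapping.lookup z a) * F a)"
    if "z \<in> {x, y, x - y}" for z
    by (rule frag_eval_superset) (use that keys_diff[of x y] in auto)
  then show ?thesis
    by (simp add: lookup_minus sum_subtractf left_diff_distrib)
qed

lemma frag_eval_minus: "frag_eval F (- x) = - frag_eval F x"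
  using frag_eval_diff[of F 0 x] by simp

lemma frag_eval_add: "frag_eval F (x + y) = frag_eval F x + frag_eval F y"
  using frag_eval_diff[of F x "- y"] by (simp add: frag_eval_minus)

lemma frag_eval_extend:
  "frag_eval F (frag_extend G z) = frag_eval (\<lambda>a. frag_eval F (G a)) z"
proof -
  have "Poly_Mapping.keys z \<subseteq> UNIV" by simp
  then show ?thesis
    by (induction z rule: frag_induction)
       (auto simp: frag_eval_diff frag_extend_diff)
qed

lemma frag_eval_cong:
  assumes "\<And>a. a \<in> Poly_Mapping.keys z \<Longrightarrow> F a = G a"
  shows "frag_eval F z = frag_eval G z"
  using assms by (simp add: frag_eval_def)

lemma frag_eval_sum_list_fun: "frag_eval (\<lambda>a. \<Sum>t\<leftarrow>ts. F t a) z = (\<Sum>t\<leftarrow>ts. frag_eval (F t) z)"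
  by (induction ts) (auto simp: frag_eval_def distrib_left sum.distrib)

lemma frag_eval_mult_right: "frag_eval (\<lambda>a. F a * c) z = frag_eval F z * c"
  by (simp add: frag_eval_def sum_distrib_right mult.assoc)

lemma frag_eval_mult_left: "frag_eval (\<lambda>a. c * F a) z = c * frag_eval F z"
proof -
  have "of_int n * (c * x) = c * (of_int n * x)" for n x
    by (metis mult.assoc mult_of_int_commute)
  then show ?thesis by (simp add: frag_eval_def sum_distrib_left)
qed

lemma frag_eval_sum_list: "frag_eval F (\<Sum>x\<leftarrow>xs. z x) = (\<Sum>x\<leftarrow>xs. frag_eval F (z x))"
  by (induction xs) (auto simp: frag_eval_add)

lemma frag_eval_generate:
  assumes "z \<in> generate (free_Abelian_group S) Rel"
    and "Rel \<subseteq> carrier (free_Abelian_group S)"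
    and "\<And>r. r \<in> Rel \<Longrightarrow> frag_eval F r = 0"
  shows "frag_eval F z = 0"
  using assms(1)
proof induction
  case (inv h)
  then show ?case using assms(2,3) by (auto simp: frag_eval_minus)
qed (auto simp: assms(3) frag_eval_add)


context
  fixes M :: "('a, 'm) monoid_scheme"
  assumes M: "Group.monoid M"
begin

lemma carrier_monoid_ring [simp]: "carrier (monoid_ring M) = {x. Poly_Mapping.keys x \<subseteq> carrier M}"
  and zero_monoid_ring [simp]: "\<zero>\<^bsub>monoid_ring M\<^esub> = 0"
  and one_monoid_ring [simp]: "\<one>\<^bsub>monoid_ring M\<^esub> = frag_of \<one>\<^bsub>M\<^esub>"
  and add_monoid_ring [simp]: "x \<oplus>\<^bsub>monoid_ring M\<^esub> y = x + y"
  by (simp_all add: monoid_ring_def)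

lemma mult_monoid_ring:
  "x \<otimes>\<^bsub>monoid_ring M\<^esub> y = frag_extend (\<lambda>a. frag_extend (\<lambda>b. frag_of (a \<otimes>\<^bsub>M\<^esub> b)) y) x"
  by (simp add: monoid_ring_def)

lemma monoid_ring_bilinear:
  "(x + x') \<otimes>\<^bsub>monoid_ring M\<^esub> y = x \<otimes>\<^bsub>monoid_ring M\<^esub> y + x' \<otimes>\<^bsub>monoid_ring M\<^esub> y"
  "(x - x') \<otimes>\<^bsub>monoid_ring M\<^esub> y = x \<otimes>\<^bsub>monoid_ring M\<^esub> y - x' \<otimes>\<^bsub>monoid_ring M\<^esub> y"
  "x \<otimes>\<^bsub>monoid_ring M\<^esub> (y + y') = x \<otimes>\<^bsub>monoid_ring M\<^esub> y + x \<otimes>\<^bsub>monoid_ring M\<^esub> y'"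
  "x \<otimes>\<^bsub>monoid_ring M\<^esub> (y - y') = x \<otimes>\<^bsub>monoid_ring M\<^esub> y - x \<otimes>\<^bsub>monoid_ring M\<^esub> y'"
  "0 \<otimes>\<^bsub>monoid_ring M\<^esub> y = 0" "x \<otimes>\<^bsub>monoid_ring M\<^esub> 0 = 0"
  "frag_of a \<otimes>\<^bsub>monoid_ring M\<^esub> frag_of b = frag_of (a \<otimes>\<^bsub>M\<^esub> b)"
proof -
  have *: "frag_extend (\<lambda>a. f a + g a) x = frag_extend f x + frag_extend g x" for f g :: "'a \<Rightarrow> 'a \<Rightarrow>\<^sub>0 int"
    by (simp add: frag_extend_def frag_cmul_distrib2 sum.distrib)
  have **: "frag_extend (\<lambda>a. f a - g a) x = frag_extend f x - frag_extend g x" for f g :: "'a \<Rightarrow> 'a \<Rightarrow>\<^sub>0 int"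
    using *[of "\<lambda>a. f a - g a" g] by simp
  show "x \<otimes>\<^bsub>monoid_ring M\<^esub> (y + y') = x \<otimes>\<^bsub>monoid_ring M\<^esub> y + x \<otimes>\<^bsub>monoid_ring M\<^esub> y'"
    "x \<otimes>\<^bsub>monoid_ring M\<^esub> (y - y') = x \<otimes>\<^bsub>monoid_ring M\<^esub> y - x \<otimes>\<^bsub>monoid_ring M\<^esub> y'"
    by (simp_all add: mult_monoid_ring frag_extend_add frag_extend_diff * **)
  show "x \<otimes>\<^bsub>monoid_ring M\<^esub> 0 = 0"
    by (simp add: mult_monoid_ring frag_extend_eq_0)
qed (simp_all add: mult_monoid_ring frag_extend_add frag_extend_diff)

lemma keys_mult_monoid_ring:
  assumes "Poly_Mapping.keys x \<subseteq> carrier M" "Poly_Mapping.keys y \<subseteq> carrier M"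
  shows "Poly_Mapping.keys (x \<otimes>\<^bsub>monoid_ring M\<^esub> y) \<subseteq> carrier M"
proof -
  interpret Group.monoid M by (rule M)
  show ?thesis
    unfolding mult_monoid_ring
    using assms by (fastforce simp: keys_frag_of dest!: subsetD[OF keys_frag_extend])
qed

lemma ring_monoid_ring: "ring (monoid_ring M)"
proof -
  interpret Group.monoid M by (rule M)
  have inv: "\<exists>y. Poly_Mapping.keys y \<subseteq> carrier M \<and> y + x = 0" if "Poly_Mapping.keys x \<subseteq> carrier M"
    for x :: "'a \<Rightarrow>\<^sub>0 int"
    using that by (intro exI[of _ "- x"]) simp
  have add: "Poly_Mapping.keys (x + y) \<subseteq> carrier M"
    if "Poly_Mapping.keys x \<subseteq> carrier M" "Poly_Mapping.keys y \<subseteq> carrier M" for x y :: "'a \<Rightarrow>\<^sub>0 int"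
    using that keys_add[of x y] by blast
  have assoc: "x \<otimes>\<^bsub>monoid_ring M\<^esub> y \<otimes>\<^bsub>monoid_ring M\<^esub> z = x \<otimes>\<^bsub>monoid_ring M\<^esub> (y \<otimes>\<^bsub>monoid_ring M\<^esub> z)"
    if xyz: "Poly_Mapping.keys x \<subseteq> carrier M" "Poly_Mapping.keys y \<subseteq> carrier M"
      "Poly_Mapping.keys z \<subseteq> carrier M" for x y z
    using xyz(1)
  proof (induction x rule: frag_induction)
    case (one a)
    show ?case using xyz(2)
    proof (induction y rule: frag_induction)
      case (one b)
      show ?case using xyz(3)
        by (induction z rule: frag_induction) (use one \<open>a \<in> carrier M\<close> in \<open>auto simp: monoid_ring_bilinear m_assoc\<close>)
    qed (auto simp: monoid_ring_bilinear)
  qed (auto simp: monoid_ring_bilinear)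
  have one: "frag_of \<one>\<^bsub>M\<^esub> \<otimes>\<^bsub>monoid_ring M\<^esub> x = x" "x \<otimes>\<^bsub>monoid_ring M\<^esub> frag_of \<one>\<^bsub>M\<^esub> = x"
    if "Poly_Mapping.keys x \<subseteq> carrier M" for x
    using that by (induction x rule: frag_induction) (auto simp: monoid_ring_bilinear)
  show ?thesis
    by (intro ringI abelian_groupI monoidI)
       (use inv add assoc one in \<open>auto simp: monoid_ring_bilinear keys_mult_monoid_ring algebra_simps\<close>)
qed

text \<open>The additive subgroup generated by the relations is an ideal as soon as it absorbs the product of a
relation with a basis element on either side, since everything is an integral combination of basis
elements.\<close>

lemma ideal_generate_monoid_ring:
  assumes Rel: "Rel \<subseteq> carrier (monoid_ring M)"
    and left: "\<And>a r. a \<in> carrier M \<Longrightarrow> r \<in> Rel \<Longrightarrow>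
      frag_of a \<otimes>\<^bsub>monoid_ring M\<^esub> r \<in> generate (free_Abelian_group (carrier M)) Rel"
    and right: "\<And>a r. a \<in> carrier M \<Longrightarrow> r \<in> Rel \<Longrightarrow>
      r \<otimes>\<^bsub>monoid_ring M\<^esub> frag_of a \<in> generate (free_Abelian_group (carrier M)) Rel"
  shows "ideal (generate (free_Abelian_group (carrier M)) Rel) (monoid_ring M)"
proof -
  let ?G = "free_Abelian_group (carrier M)"
  let ?I = "generate ?G Rel"
  interpret G: Group.group ?G by simp
  have Rel': "Rel \<subseteq> carrier ?G" using Rel by auto
  have sub: "subgroup ?I ?G" by (rule G.generate_is_subgroup[OF Rel'])
  have carr: "Poly_Mapping.keys z \<subseteq> carrier M" if "z \<in> ?I" for z
    using subsetD[OF subgroup.subset[OF sub] that] by simp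
  have diff: "x - y \<in> ?I" if "x \<in> ?I" "y \<in> ?I" for x y
    using subgroup.m_closed[OF sub that(1) subgroup.m_inv_closed[OF sub that(2)]] carr[OF that(2)]
    by (simp add: inv_free_Abelian_group)
  have zero: "0 \<in> ?I" using subgroup.one_closed[OF sub] by simp
  have neg: "- x \<in> ?I" if "x \<in> ?I" for x using diff[OF zero that] by simp
  have add: "x + y \<in> ?I" if "x \<in> ?I" "y \<in> ?I" for x y
    using diff[OF that(1) neg[OF that(2)]] by simp
  have addinv: "subgroup ?I (add_monoid (monoid_ring M))"
  proof -
    interpret R: ring "monoid_ring M" by (rule ring_monoid_ring)
    have neg': "\<ominus>\<^bsub>monoid_ring M\<^esub> x = - x" if "Poly_Mapping.keys x \<subseteq> carrier M" for x
      by (rule R.minus_equality) (use that in auto)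
    show ?thesis
      by (rule R.add.subgroupI)
         (use zero carr add neg in \<open>auto simp: a_inv_def[symmetric] neg'\<close>)
  qed
  have right': "z \<otimes>\<^bsub>monoid_ring M\<^esub> frag_of a \<in> ?I" if "z \<in> ?I" "a \<in> carrier M" for z a
    using that(1)
  proof induction
    case (inv h)
    have "- (h \<otimes>\<^bsub>monoid_ring M\<^esub> frag_of a) \<in> ?I" using right[OF that(2) inv] neg by simp
    then show ?case
      using Rel inv monoid_ring_bilinear(2)[of 0 h "frag_of a"]
      by (auto simp: monoid_ring_bilinear)
  qed (use right that(2) zero add in \<open>auto simp: monoid_ring_bilinear\<close>)
  have left': "frag_of a \<otimes>\<^bsub>monoid_ring M\<^esub> z \<in> ?I" if "z \<in> ?I" "a \<in> carrier M" for z a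
    using that(1)
  proof induction
    case (inv h)
    have "- (frag_of a \<otimes>\<^bsub>monoid_ring M\<^esub> h) \<in> ?I" using left[OF that(2) inv] neg by simp
    then show ?case
      using Rel inv monoid_ring_bilinear(4)[of "frag_of a" 0 h]
      by (auto simp: monoid_ring_bilinear)
  qed (use left that(2) zero add in \<open>auto simp: monoid_ring_bilinear\<close>)
  show ?thesis
  proof (rule idealI[OF ring_monoid_ring addinv])
    show "x \<otimes>\<^bsub>monoid_ring M\<^esub> z \<in> ?I" if "z \<in> ?I" "x \<in> carrier (monoid_ring M)" for z x
      using that(2)[simplified]
      by (induction x rule: frag_induction)
         (use that(1) left' zero diff in \<open>auto simp: monoid_ring_bilinear\<close>)
    show "z \<otimes>\<^bsub>monoid_ring M\<^esub> x \<in> ?I" if "z \<in> ?I" "x \<in> carrier (monoid_ring M)" for z x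
      using that(2)[simplified]
      by (induction x rule: frag_induction)
         (use that(1) right' zero diff in \<open>auto simp: monoid_ring_bilinear\<close>)
  qed
qed

end

text \<open>The value on a representative. It is meaningful on cosets of an ideal on which the additive extension
of \<open>F\<close> vanishes.\<close>

definition coset_eval :: "('a \<Rightarrow> 'b::ring_1) \<Rightarrow> ('a \<Rightarrow>\<^sub>0 int) set \<Rightarrow> 'b" where
  "coset_eval F C = frag_eval F (SOME z. z \<in> C)"

text \<open>A ring given by a monoid of generators and additive relations, as are the Grothendieck ring and a
tensor product over the integers.\<close>

locale presented_ring =
  fixes M :: "('a, 'm) monoid_scheme" and Rel :: "('a \<Rightarrow>\<^sub>0 int) set"
  assumes M: "Group.monoid M" and Rel: "Rel \<subseteq> carrier (monoid_ring M)"
    and left: "\<And>a r. a \<in> carrier M \<Longrightarrow> r \<in> Rel \<Longrightarrow>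
      frag_of a \<otimes>\<^bsub>monoid_ring M\<^esub> r \<in> generate (free_Abelian_group (carrier M)) Rel"
    and right: "\<And>a r. a \<in> carrier M \<Longrightarrow> r \<in> Rel \<Longrightarrow>
      r \<otimes>\<^bsub>monoid_ring M\<^esub> frag_of a \<in> generate (free_Abelian_group (carrier M)) Rel"
begin

abbreviation relation_ideal :: "('a \<Rightarrow>\<^sub>0 int) set" where
  "relation_ideal \<equiv> generate (free_Abelian_group (carrier M)) Rel"

abbreviation quotient_ring :: "('a \<Rightarrow>\<^sub>0 int) set ring" where
  "quotient_ring \<equiv> monoid_ring M Quot relation_ideal"

definition cls :: "('a \<Rightarrow>\<^sub>0 int) \<Rightarrow> ('a \<Rightarrow>\<^sub>0 int) set" where
  "cls z = relation_ideal +>\<^bsub>monoid_ring M\<^esub> z"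

sublocale R: ring "monoid_ring M"
  by (rule ring_monoid_ring[OF M])

sublocale I: ideal relation_ideal "monoid_ring M"
  by (rule ideal_generate_monoid_ring[OF M Rel left right])

lemma ring_quotient: "ring quotient_ring"
  by (rule I.quotient_is_ring)

lemma carrier_quotient: "carrier quotient_ring = cls ` {z. Poly_Mapping.keys z \<subseteq> carrier M}"
  by (auto simp: FactRing_def A_RCOSETS_def' cls_def carrier_monoid_ring[OF M])

lemma cls_in_carrier [intro]: "Poly_Mapping.keys z \<subseteq> carrier M \<Longrightarrow> cls z \<in> carrier quotient_ring"
  by (auto simp: carrier_quotient)

lemma cls_mult:
  assumes "Poly_Mapping.keys z \<subseteq> carrier M" "Poly_Mapping.keys w \<subseteq> carrier M"
  shows "cls z \<otimes>\<^bsub>quotient_ring\<^esub> cls w = cls (z \<otimes>\<^bsub>monoid_ring M\<^esub> w)"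
  using assms by (simp add: FactRing_def cls_def I.rcoset_mult_add carrier_monoid_ring[OF M])

lemma cls_add:
  assumes "Poly_Mapping.keys z \<subseteq> carrier M" "Poly_Mapping.keys w \<subseteq> carrier M"
  shows "cls z \<oplus>\<^bsub>quotient_ring\<^esub> cls w = cls (z + w)"
  using assms by (simp add: FactRing_def cls_def I.a_rcos_sum carrier_monoid_ring[OF M] add_monoid_ring[OF M])

lemma cls_one: "\<one>\<^bsub>quotient_ring\<^esub> = cls (frag_of \<one>\<^bsub>M\<^esub>)"
  by (simp add: FactRing_def cls_def one_monoid_ring[OF M])

lemma mem_cls: "w \<in> cls z \<longleftrightarrow> w - z \<in> relation_ideal"
proof -
  have "cls z = (\<lambda>h. h + z) ` relation_ideal"
    by (auto simp: cls_def a_r_coset_def' add_monoid_ring[OF M])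
  moreover have "w = (w - z) + z" by simp
  ultimately show ?thesis by (metis (no_types, lifting) add_diff_cancel_right' image_iff)
qed

lemma coset_eval_cls:
  assumes "\<And>r. r \<in> Rel \<Longrightarrow> frag_eval F r = 0"
  shows "coset_eval F (cls z) = frag_eval F z"
proof -
  have "z \<in> cls z" unfolding mem_cls using I.zero_closed by (simp add: zero_monoid_ring[OF M])
  then have "(SOME w. w \<in> cls z) \<in> cls z" by (rule someI)
  then have "frag_eval F ((SOME w. w \<in> cls z) - z) = 0"
    unfolding mem_cls
    by (rule frag_eval_generate) (use Rel assms in \<open>auto simp: carrier_monoid_ring[OF M]\<close>)
  then show ?thesis by (simp add: coset_eval_def frag_eval_diff)
qed

lemma coset_eval_add:
  assumes F: "\<And>r. r \<in> Rel \<Longrightarrow> frag_eval F r = 0"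
    and "C \<in> carrier quotient_ring" "D \<in> carrier quotient_ring"
  shows "coset_eval F (C \<oplus>\<^bsub>quotient_ring\<^esub> D) = coset_eval F C + coset_eval F D"
  using assms(2,3) by (auto simp: carrier_quotient cls_add coset_eval_cls[OF F] frag_eval_add)

text \<open>If \<open>F\<close> turns the monoid product into a finite sum of products \<open>P t a * Q t b\<close>, its extension to the
quotient does the same by biadditivity. With \<open>P t\<close> and \<open>Q t\<close> running over the evaluations at the
Sweedler components of a Hopf algebra element, this says that characters convolve.\<close>

lemma coset_eval_mult:
  assumes F: "\<And>r. r \<in> Rel \<Longrightarrow> frag_eval F r = 0"
    and P: "\<And>t r. t \<in> set ts \<Longrightarrow> r \<in> Rel \<Longrightarrow> frag_eval (P t) r = 0"
    and Q: "\<And>t r. t \<in> set ts \<Longrightarrow> r \<in> Rel \<Longrightarrow> frag_eval (Q t) r = 0"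
    and mult: "\<And>a b. a \<in> carrier M \<Longrightarrow> b \<in> carrier M \<Longrightarrow> F (a \<otimes>\<^bsub>M\<^esub> b) = (\<Sum>t\<leftarrow>ts. P t a * Q t b)"
    and CD: "C \<in> carrier quotient_ring" "D \<in> carrier quotient_ring"
  shows "coset_eval F (C \<otimes>\<^bsub>quotient_ring\<^esub> D) = (\<Sum>t\<leftarrow>ts. coset_eval (P t) C * coset_eval (Q t) D)"
proof -
  obtain x y where xy: "Poly_Mapping.keys x \<subseteq> carrier M" "Poly_Mapping.keys y \<subseteq> carrier M"
    "C = cls x" "D = cls y" using CD by (auto simp: carrier_quotient)
  have "coset_eval F (C \<otimes>\<^bsub>quotient_ring\<^esub> D) = frag_eval F (x \<otimes>\<^bsub>monoid_ring M\<^esub> y)"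
    using xy by (simp add: cls_mult coset_eval_cls[OF F])
  also have "\<dots> = frag_eval (\<lambda>a. frag_eval (\<lambda>b. F (a \<otimes>\<^bsub>M\<^esub> b)) y) x"
    by (simp add: mult_monoid_ring[OF M] frag_eval_extend)
  also have "\<dots> = frag_eval (\<lambda>a. frag_eval (\<lambda>b. \<Sum>t\<leftarrow>ts. P t a * Q t b) y) x"
    by (intro frag_eval_cong) (use xy mult in auto)
  also have "\<dots> = (\<Sum>t\<leftarrow>ts. frag_eval (P t) x * frag_eval (Q t) y)"
    by (simp add: frag_eval_sum_list_fun frag_eval_mult_left frag_eval_mult_right)
  also have "\<dots> = (\<Sum>t\<leftarrow>ts. coset_eval (P t) C * coset_eval (Q t) D)"
    unfolding xy(3,4)
    by (rule arg_cong[where f = sum_list], rule map_cong) (simp_all add: coset_eval_cls P Q)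
  finally show ?thesis .
qed

end

lemma keys_diff_subset:
  "Poly_Mapping.keys x \<subseteq> S \<Longrightarrow> Poly_Mapping.keys y \<subseteq> S \<Longrightarrow> Poly_Mapping.keys (x - y) \<subseteq> S"
  for x y :: "'a \<Rightarrow>\<^sub>0 int"
  using keys_diff[of x y] by blast

text \<open>Multiplying a biadditivity relation by a pure tensor gives a biadditivity relation, by the
distributive laws in the factors.\<close>

lemma presented_ring_int_tensor:
  assumes A: "ring A" and B: "ring B"
  shows "presented_ring (A \<times>\<times> B) (int_tensor_relations A B)"
proof -
  interpret A: ring A by fact
  interpret B: ring B by fact
  let ?M = "A \<times>\<times> B"
  let ?Rel = "int_tensor_relations A B"
  have M: "Group.monoid ?M" by (rule DirProd_monoid[OF A.is_monoid B.is_monoid])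
  have Rel1: "frag_of (a \<oplus>\<^bsub>A\<^esub> a', b) - frag_of (a, b) - frag_of (a', b) \<in> ?Rel"
    if "a \<in> carrier A" "a' \<in> carrier A" "b \<in> carrier B" for a a' b
    using that unfolding int_tensor_relations_def by blast
  have Rel2: "frag_of (a, b \<oplus>\<^bsub>B\<^esub> b') - frag_of (a, b) - frag_of (a, b') \<in> ?Rel"
    if "a \<in> carrier A" "b \<in> carrier B" "b' \<in> carrier B" for a b b'
    using that unfolding int_tensor_relations_def by blast
  have cases: thesis
    if "r \<in> ?Rel"
      "\<And>a a' b. r = frag_of (a \<oplus>\<^bsub>A\<^esub> a', b) - frag_of (a, b) - frag_of (a', b) \<Longrightarrow>
         a \<in> carrier A \<Longrightarrow> a' \<in> carrier A \<Longrightarrow> b \<in> carrier B \<Longrightarrow> thesis"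
      "\<And>a b b'. r = frag_of (a, b \<oplus>\<^bsub>B\<^esub> b') - frag_of (a, b) - frag_of (a, b') \<Longrightarrow>
         a \<in> carrier A \<Longrightarrow> b \<in> carrier B \<Longrightarrow> b' \<in> carrier B \<Longrightarrow> thesis" for r thesis
    using that unfolding int_tensor_relations_def by blast
  show ?thesis
  proof (rule presented_ring.intro)
    show "Group.monoid ?M" by (rule M)
    show "?Rel \<subseteq> carrier (monoid_ring ?M)"
    proof
      fix r assume "r \<in> ?Rel"
      then show "r \<in> carrier (monoid_ring ?M)"
        by (rule cases) (simp_all add: carrier_monoid_ring[OF M] keys_diff_subset)
    qed
  next
    fix u r assume u: "u \<in> carrier ?M" and r: "r \<in> ?Rel"
    obtain x y where xy: "u = (x, y)" "x \<in> carrier A" "y \<in> carrier B" using u by auto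
    show "frag_of u \<otimes>\<^bsub>monoid_ring ?M\<^esub> r \<in> generate (free_Abelian_group (carrier ?M)) ?Rel"
      by (rule cases[OF r]; rule generate.incl)
         (simp_all add: xy monoid_ring_bilinear[OF M] A.r_distr B.r_distr Rel1 Rel2)
    show "r \<otimes>\<^bsub>monoid_ring ?M\<^esub> frag_of u \<in> generate (free_Abelian_group (carrier ?M)) ?Rel"
      by (rule cases[OF r]; rule generate.incl)
         (simp_all add: xy monoid_ring_bilinear[OF M] A.l_distr B.l_distr Rel1 Rel2)
  qed
qed

section \<open>Traces and Kronecker products of matrices\<close>

text \<open>Row and column indices of a Kronecker product are the numbers \<open>p * n + q\<close>.\<close>

lemma sum_div_mod:
  fixes F :: "nat \<Rightarrow> nat \<Rightarrow> 'a::comm_monoid_add"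
  shows "(\<Sum>i<m * n. F (i div n) (i mod n)) = (\<Sum>p<m. \<Sum>q<n. F p q)"
proof -
  have less: "p * n + q < m * n" if "p < m" "q < n" for p q
  proof -
    have "p * n + q < Suc p * n" using that by simp
    also have "\<dots> \<le> m * n" using that by (intro mult_right_mono) auto
    finally show ?thesis .
  qed
  have pos: "0 < n" if "i < m * n" for i using that by (cases n) auto
  have "(\<Sum>p<m. \<Sum>q<n. F p q) = (\<Sum>(p, q)\<in>{..<m} \<times> {..<n}. F p q)"
    by (simp add: sum.cartesian_product)
  also have "\<dots> = (\<Sum>i<m * n. F (i div n) (i mod n))"
    by (rule sum.reindex_bij_witness[of _ "\<lambda>i. (i div n, i mod n)" "\<lambda>(p, q). p * n + q"])
       (use less pos in \<open>auto simp: less_mult_imp_div_less\<close>)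
  finally show ?thesis by simp
qed

definition mtrace :: "'a::comm_ring_1 mat \<Rightarrow> 'a" where
  "mtrace A = (\<Sum>i<dim_row A. A $$ (i, i))"

lemma mult_mat_entry:
  assumes "A \<in> carrier_mat m n" "B \<in> carrier_mat n p" "i < m" "j < p"
  shows "(A * B) $$ (i, j) = (\<Sum>k<n. A $$ (i, k) * B $$ (k, j))"
  using assms by (simp add: scalar_prod_def atLeast0LessThan)

lemma mtrace_mult_commute:
  assumes "A \<in> carrier_mat m n" "B \<in> carrier_mat n m"
  shows "mtrace (A * B) = mtrace (B * A)"
proof -
  have "mtrace (A * B) = (\<Sum>i<m. \<Sum>k<n. A $$ (i, k) * B $$ (k, i))"
    using assms by (simp add: mtrace_def scalar_prod_def atLeast0LessThan)
  also have "\<dots> = (\<Sum>k<n. \<Sum>i<m. B $$ (k, i) * A $$ (i, k))"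
    by (subst sum.swap) (simp add: mult.commute)
  also have "\<dots> = mtrace (B * A)"
    using assms by (simp add: mtrace_def scalar_prod_def atLeast0LessThan)
  finally show ?thesis .
qed

lemma mtrace_add:
  assumes "A \<in> carrier_mat n n" "B \<in> carrier_mat n n"
  shows "mtrace (A + B) = mtrace A + mtrace B"
  using assms by (simp add: mtrace_def sum.distrib)

lemma mtrace_smult: "A \<in> carrier_mat n n \<Longrightarrow> mtrace (c \<cdot>\<^sub>m A) = c * mtrace A"
  by (simp add: mtrace_def sum_distrib_left)

definition kron :: "'a::comm_ring_1 mat \<Rightarrow> 'a mat \<Rightarrow> 'a mat" where
  "kron A B = mat (dim_row A * dim_row B) (dim_col A * dim_col B)
     (\<lambda>(i, j). A $$ (i div dim_row B, j div dim_col B) * B $$ (i mod dim_row B, j mod dim_col B))"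

lemma div_mod_bounds: "(i::nat) < m * n \<Longrightarrow> i div n < m" "(i::nat) < m * n \<Longrightarrow> i mod n < n"
  by (auto simp: less_mult_imp_div_less intro!: mod_less_divisor intro: Nat.gr0I)

lemma kron_carrier:
  "A \<in> carrier_mat m n \<Longrightarrow> B \<in> carrier_mat p q \<Longrightarrow> kron A B \<in> carrier_mat (m * p) (n * q)"
  by (auto simp: kron_def)

lemma kron_entry:
  assumes "A \<in> carrier_mat m n" "B \<in> carrier_mat p q" "i < m * p" "j < n * q"
  shows "kron A B $$ (i, j) = A $$ (i div p, j div q) * B $$ (i mod p, j mod q)"
  using assms by (auto simp: kron_def)

lemma kron_mult:
  assumes A: "A \<in> carrier_mat m n" and B: "B \<in> carrier_mat n l"
    and C: "C \<in> carrier_mat p q" and D: "D \<in> carrier_mat q r"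
  shows "kron A C * kron B D = kron (A * B) (C * D)"
proof (rule eq_matI)
  have AB: "A * B \<in> carrier_mat m l" and CD: "C * D \<in> carrier_mat p r" using assms by auto
  note K = kron_carrier[OF A C] kron_carrier[OF B D] kron_carrier[OF AB CD]
  show "dim_row (kron A C * kron B D) = dim_row (kron (A * B) (C * D))"
    "dim_col (kron A C * kron B D) = dim_col (kron (A * B) (C * D))"
    using K by auto
  fix i j assume "i < dim_row (kron (A * B) (C * D))" "j < dim_col (kron (A * B) (C * D))"
  then have ij: "i < m * p" "j < l * r" using K(3) by auto
  have "(kron A C * kron B D) $$ (i, j) = (\<Sum>k<n * q. kron A C $$ (i, k) * kron B D $$ (k, j))"
    by (rule mult_mat_entry[OF K(1,2) ij])
  also have "\<dots> = (\<Sum>k<n * q. (A $$ (i div p, k div q) * C $$ (i mod p, k mod q)) *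
      (B $$ (k div q, j div r) * D $$ (k mod q, j mod r)))"
    by (intro sum.cong refl) (simp add: kron_entry[OF A C ij(1)] kron_entry[OF B D _ ij(2)])
  also have "\<dots> = (\<Sum>s<n. \<Sum>t<q. (A $$ (i div p, s) * C $$ (i mod p, t)) *
      (B $$ (s, j div r) * D $$ (t, j mod r)))"
    by (rule sum_div_mod)
  also have "\<dots> = (\<Sum>s<n. A $$ (i div p, s) * B $$ (s, j div r)) *
      (\<Sum>t<q. C $$ (i mod p, t) * D $$ (t, j mod r))"
    by (simp add: sum_product mult_ac)
  also have "\<dots> = (A * B) $$ (i div p, j div r) * (C * D) $$ (i mod p, j mod r)"
    using ij by (simp add: mult_mat_entry[OF A B] mult_mat_entry[OF C D] div_mod_bounds)
  also have "\<dots> = kron (A * B) (C * D) $$ (i, j)"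
    by (rule kron_entry[OF AB CD ij, symmetric])
  finally show "(kron A C * kron B D) $$ (i, j) = kron (A * B) (C * D) $$ (i, j)" .
qed

lemma kron_one: "kron (1\<^sub>m m) (1\<^sub>m n) = (1\<^sub>m (m * n) :: 'a::comm_ring_1 mat)"
proof (rule eq_matI)
  fix i j assume "i < dim_row (1\<^sub>m (m * n))" "j < dim_col (1\<^sub>m (m * n))"
  then have ij: "i < m * n" "j < m * n" by auto
  have "i = j" if "i div n = j div n" "i mod n = j mod n"
    using that by (metis div_mult_mod_eq)
  with ij show "kron (1\<^sub>m m) (1\<^sub>m n) $$ (i, j) = (1\<^sub>m (m * n) :: 'a mat) $$ (i, j)"
    by (auto simp: kron_def div_mod_bounds)
qed (auto simp: kron_def)

lemma kron_zero:
  "B \<in> carrier_mat p q \<Longrightarrow> kron (0\<^sub>m m n) B = 0\<^sub>m (m * p) (n * q)"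
  "B \<in> carrier_mat p q \<Longrightarrow> kron B (0\<^sub>m m n) = 0\<^sub>m (p * m) (q * n)"
  by (auto simp: kron_def div_mod_bounds intro!: eq_matI)

lemma kron_add:
  assumes "A \<in> carrier_mat m n" "B \<in> carrier_mat m n" "C \<in> carrier_mat p q"
  shows "kron (A + B) C = kron A C + kron B C" "kron C (A + B) = kron C A + kron C B"
  using assms by (auto simp: kron_def div_mod_bounds algebra_simps intro!: eq_matI)

lemma mtrace_kron:
  assumes "A \<in> carrier_mat m m" "B \<in> carrier_mat n n"
  shows "mtrace (kron A B) = mtrace A * mtrace B"
proof -
  have "mtrace (kron A B) = (\<Sum>i<m * n. A $$ (i div n, i div n) * B $$ (i mod n, i mod n))"
    using assms by (simp add: mtrace_def kron_def)
  also have "\<dots> = (\<Sum>p<m. \<Sum>q<n. A $$ (p, p) * B $$ (q, q))"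
    by (rule sum_div_mod)
  also have "\<dots> = mtrace A * mtrace B"
    using assms by (simp add: mtrace_def sum_product)
  finally show ?thesis .
qed

text \<open>Both ways of bracketing a triple Kronecker product number the entries alike.\<close>

lemma div_mod_of_product:
  "(i::nat) div (m * l) = i div l div m" "i mod (m * l) div l = i div l mod m" "i mod (m * l) mod l = i mod l"
  by (cases "l = 0"; simp add: div_mult2_eq[of i l m] mult.commute[of m l] mod_mult2_eq)+

lemma minus_add_cancel_mat:
  fixes A :: "'a::ab_group_add mat"
  assumes "A \<in> carrier_mat m n" "B \<in> carrier_mat m n"
  shows "A - B + B = A"
  using assms by (intro eq_matI) auto

text \<open>An inverse in the sense of \<^const>\<open>invertible_mat\<close> is not assumed to have matching dimensions; the two
equations determine them.\<close>

lemma invertible_matD: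
  assumes f: "f \<in> carrier_mat m n" and inv: "invertible_mat f"
  obtains f' where "m = n" "f' \<in> carrier_mat n m" "f * f' = 1\<^sub>m m" "f' * f = 1\<^sub>m n"
proof -
  obtain B where B: "f * B = 1\<^sub>m (dim_row f)" "B * f = 1\<^sub>m (dim_row B)" and sq: "square_mat f"
    using inv by (auto simp: invertible_mat_def inverts_mat_def)
  have "dim_col B = m" using arg_cong[OF B(1), of dim_col] f by simp
  moreover have "dim_row B = n" using arg_cong[OF B(2), of dim_col] f by simp
  moreover have "m = n" using sq f by simp
  ultimately show thesis using that[of B] B f by auto
qed

lemma mult_inverse_pair:
  assumes "f \<in> carrier_mat n n" "g \<in> carrier_mat n n" "f' \<in> carrier_mat n n" "g' \<in> carrier_mat n n"
    and "f * f' = 1\<^sub>m n" "g * g' = 1\<^sub>m n"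
  shows "(g * f) * (f' * g') = (1\<^sub>m n :: 'a::comm_ring_1 mat)"
proof -
  have "(g * f) * (f' * g') = g * (f * f' * g')"
    using assms(1-4) by (simp add: assoc_mult_mat[of _ n n _ n _ n])
  then show ?thesis using assms by simp
qed

lemma zero_mult_mat_vec:
  "v \<in> carrier_vec n \<Longrightarrow> 0\<^sub>m m n *\<^sub>v v = 0\<^sub>v m"
  "A \<in> carrier_mat m n \<Longrightarrow> A *\<^sub>v 0\<^sub>v n = 0\<^sub>v m"
  by (intro eq_vecI; auto simp: scalar_prod_def)+

section \<open>Multilinear maps on tensor powers\<close>

lemma additive_sum_list:
  fixes A :: "'a::ab_group_add \<Rightarrow> 'b::ab_group_add"
  assumes "\<And>u v. A (u + v) = A u + A v"
  shows "A (\<Sum>t\<leftarrow>ts. G t) = (\<Sum>t\<leftarrow>ts. A (G t))"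
proof -
  have "A 0 = 0" using assms[of 0 0] by simp
  then show ?thesis by (induction ts) (simp_all add: assms)
qed

lemma sum_list_concat: "sum_list (concat xss) = (\<Sum>xs\<leftarrow>xss. sum_list xs)"
  by (induction xss) (auto simp: add.assoc)

lemma vector_space_over_itself: "vector_space ((*) :: 'k::field \<Rightarrow> 'k \<Rightarrow> 'k)"
  by unfold_locales (simp_all add: algebra_simps)

lemma sum_list_prod_swap:
  fixes F :: "_ \<Rightarrow> _ \<Rightarrow> 'b::ab_group_add"
  shows "(\<Sum>x\<leftarrow>xs. \<Sum>y\<leftarrow>ys. F x y) = (\<Sum>y\<leftarrow>ys. \<Sum>x\<leftarrow>xs. F x y)"
  by (induction xs) (simp_all add: sum_list_addf)

text \<open>The maps of two arguments that factor through the tensor square. Only scalars that move between the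
slots are mentioned, since the target need not be a vector space.\<close>

definition balanced2 :: "('k \<Rightarrow> 'h \<Rightarrow> 'h::ab_group_add) \<Rightarrow> ('h \<Rightarrow> 'h \<Rightarrow> 'b::ring_1) \<Rightarrow> bool" where
  "balanced2 s F \<longleftrightarrow>
     (\<forall>a a' b. F (a + a') b = F a b + F a' b) \<and> (\<forall>a b b'. F a (b + b') = F a b + F a b') \<and>
     (\<forall>c a b. F (s c a) b = F a (s c b))"

definition balanced3 :: "('k \<Rightarrow> 'h \<Rightarrow> 'h::ab_group_add) \<Rightarrow> ('h \<Rightarrow> 'h \<Rightarrow> 'h \<Rightarrow> 'b::ring_1) \<Rightarrow> bool" where
  "balanced3 s F \<longleftrightarrow> (\<forall>c. balanced2 s (\<lambda>a b. F a b c)) \<and> (\<forall>a. balanced2 s (F a)) \<and>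
     (\<forall>c a b d. F (s c a) b d = F a b (s c d))"

lemma tensor_eq_eval:
  fixes F :: "'h::ab_group_add list \<Rightarrow> 'b::ring_1"
  assumes "tensor_eq s u v" and "\<And>r. r \<in> tensor_relations s \<Longrightarrow> frag_eval F r = 0"
  shows "(\<Sum>x\<leftarrow>u. F x) = (\<Sum>x\<leftarrow>v. F x)"
proof -
  have "frag_eval F ((\<Sum>x\<leftarrow>u. frag_of x) - (\<Sum>x\<leftarrow>v. frag_of x)) = 0"
    by (rule frag_eval_generate[OF assms(1)[unfolded tensor_eq_def]]) (use assms(2) in auto)
  then show ?thesis by (simp add: frag_eval_diff frag_eval_sum_list)
qed

lemma lists_of_total_length_1:
  "length xs + length ys = 1 \<Longrightarrow> xs = [] \<and> (\<exists>y. ys = [y]) \<or> (\<exists>x. xs = [x]) \<and> ys = []"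
  by (cases xs) (auto simp: length_Suc_conv)

lemma lists_of_total_length_2:
  "length xs + length ys = 2 \<Longrightarrow>
    xs = [] \<and> (\<exists>y z. ys = [y, z]) \<or> (\<exists>x y. xs = [x] \<and> ys = [y]) \<or> (\<exists>x y. xs = [x, y]) \<and> ys = []"
  by (cases xs; cases "tl xs") (auto simp: length_Suc_conv numeral_2_eq_2)

lemma three_lists_of_total_length_1:
  "length xs + length ys + length zs = 1 \<Longrightarrow>
    (\<exists>x. xs = [x] \<and> ys = [] \<and> zs = []) \<or> (\<exists>x. xs = [] \<and> ys = [x] \<and> zs = []) \<or>
    (\<exists>x. xs = [] \<and> ys = [] \<and> zs = [x])"
  by (cases xs; cases ys) (auto simp: length_Suc_conv)

text \<open>Since \<^const>\<open>tensor_relations\<close> involves tuples of all lengths, \<open>F\<close> is extended by zero to tuples that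
are not pairs.\<close>

lemma tensor_eq_balanced2:
  assumes "tensor_eq s u v" and F: "balanced2 s F"
    and "\<forall>x\<in>set u \<union> set v. length x = 2"
  shows "(\<Sum>x\<leftarrow>u. F (x ! 0) (x ! 1)) = (\<Sum>x\<leftarrow>v. F (x ! 0) (x ! 1))"
proof -
  let ?F = "\<lambda>x. if length x = 2 then F (x ! 0) (x ! 1) else 0"
  have "(\<Sum>x\<leftarrow>u. ?F x) = (\<Sum>x\<leftarrow>v. ?F x)"
  proof (rule tensor_eq_eval[OF assms(1)])
    fix r assume "r \<in> tensor_relations s"
    then consider
      (add) xs a b ys where "r = frag_of (xs @ (a + b) # ys) - frag_of (xs @ a # ys) - frag_of (xs @ b # ys)"
    | (scale) xs c a ys b zs where "r = frag_of (xs @ s c a # ys @ b # zs) - frag_of (xs @ a # ys @ s c b # zs)"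
      unfolding tensor_relations_def by blast
    then show "frag_eval ?F r = 0"
    proof cases
      case add
      show ?thesis
      proof (cases "length xs + length ys = 1")
        case True
        from lists_of_total_length_1[OF this] F show ?thesis
          by (auto simp: add frag_eval_diff balanced2_def)
      next
        case False
        then show ?thesis by (simp add: add frag_eval_diff)
      qed
    next
      case scale
      show ?thesis
      proof (cases "xs = [] \<and> ys = [] \<and> zs = []")
        case True
        then show ?thesis using F by (simp add: scale frag_eval_diff balanced2_def)
      next
        case False
        then show ?thesis by (auto simp: scale frag_eval_diff)
      qed
    qed
  qed
  moreover have "map ?F w = map (\<lambda>x. F (x ! 0) (x ! 1)) w" if "w \<in> {u, v}" for w
    using assms(3) that by (intro map_cong) auto
  ultimately show ?thesis by auto
qed

lemma tensor_eq_balanced3: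
  assumes "tensor_eq s u v" and F: "balanced3 s F"
    and "\<forall>x\<in>set u \<union> set v. length x = 3"
  shows "(\<Sum>x\<leftarrow>u. F (x ! 0) (x ! 1) (x ! 2)) = (\<Sum>x\<leftarrow>v. F (x ! 0) (x ! 1) (x ! 2))"
proof -
  let ?F = "\<lambda>x. if length x = 3 then F (x ! 0) (x ! 1) (x ! 2) else 0"
  have "(\<Sum>x\<leftarrow>u. ?F x) = (\<Sum>x\<leftarrow>v. ?F x)"
  proof (rule tensor_eq_eval[OF assms(1)])
    fix r assume "r \<in> tensor_relations s"
    then consider
      (add) xs a b ys where "r = frag_of (xs @ (a + b) # ys) - frag_of (xs @ a # ys) - frag_of (xs @ b # ys)"
    | (scale) xs c a ys b zs where "r = frag_of (xs @ s c a # ys @ b # zs) - frag_of (xs @ a # ys @ s c b # zs)"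
      unfolding tensor_relations_def by blast
    then show "frag_eval ?F r = 0"
    proof cases
      case add
      show ?thesis
      proof (cases "length xs + length ys = 2")
        case True
        from lists_of_total_length_2[OF this] F show ?thesis
          by (auto simp: add frag_eval_diff balanced2_def balanced3_def)
      next
        case False
        then show ?thesis by (simp add: add frag_eval_diff)
      qed
    next
      case scale
      show ?thesis
      proof (cases "length xs + length ys + length zs = 1")
        case True
        from three_lists_of_total_length_1[OF this] F show ?thesis
          by (auto simp: scale frag_eval_diff balanced2_def balanced3_def)
      next
        case False
        then show ?thesis by (auto simp: scale frag_eval_diff)
      qed
    qed
  qed
  moreover have "map ?F w = map (\<lambda>x. F (x ! 0) (x ! 1) (x ! 2)) w" if "w \<in> {u, v}" for w
    using assms(3) that by (intro map_cong) auto
  ultimately show ?thesis by auto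
qed

lemma additive_zero_sum:
  fixes A :: "'a::ab_group_add \<Rightarrow> 'b::ab_group_add"
  assumes "\<And>u v. A (u + v) = A u + A v"
  shows "A 0 = 0" "A (sum G T) = (\<Sum>t\<in>T. A (G t))"
proof -
  show "A 0 = 0" using assms[of 0 0] by simp
  then show "A (sum G T) = (\<Sum>t\<in>T. A (G t))"
    by (induction T rule: infinite_finite_induct) (simp_all add: assms)
qed

section \<open>Sweedler calculus in a Hopf algebra\<close>

context hopf_algebra
begin

definition sweedler :: "('h \<Rightarrow> 'h \<Rightarrow> 'b::ab_group_add) \<Rightarrow> 'h \<Rightarrow> 'b" where
  "sweedler F x = (\<Sum>(a, b)\<leftarrow>comult x. F a b)"

abbreviation lin :: "('h \<Rightarrow> 'k) \<Rightarrow> bool" where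
  "lin f \<equiv> Vector_Spaces.linear scale (*) f"

lemma lin_add: "lin f \<Longrightarrow> f (x + y) = f x + f y"
  and lin_scale: "lin f \<Longrightarrow> f (scale c x) = c * f x"
  by (simp_all add: Vector_Spaces.linear.axioms(3) module_hom.add module_hom.scale Vector_Spaces.linear_iff_module_hom)

lemma linI: "(\<And>x y. f (x + y) = f x + f y) \<Longrightarrow> (\<And>c x. f (scale c x) = c * f x) \<Longrightarrow> lin f"
  by (simp add: Vector_Spaces.linear_iff vector_space_axioms vector_space_over_itself)

lemma antipode_add: "antipode (x + y) = antipode x + antipode y"
  and antipode_scale: "antipode (scale c x) = scale c (antipode x)"
  using antipode_linear by (simp_all add: Vector_Spaces.linear_iff)

lemmas counit_add = lin_add[OF counit_linear] and counit_scale = lin_scale[OF counit_linear]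

lemma sweedler_cong: "(\<And>a b. F a b = G a b) \<Longrightarrow> sweedler F x = sweedler G x"
  by (simp add: sweedler_def)

lemma sweedler_additive:
  fixes A :: "'a::ab_group_add \<Rightarrow> 'b::ab_group_add"
  assumes "\<And>u v. A (u + v) = A u + A v"
  shows "A (sweedler G x) = sweedler (\<lambda>a b. A (G a b)) x"
  using additive_sum_list[OF assms, where G = "\<lambda>(a, b). G a b"]
  by (simp add: sweedler_def split_def)

lemma sweedler_add_fun: "sweedler (\<lambda>a b. F a b + G a b) x = sweedler F x + sweedler G x"
  by (simp add: sweedler_def split_def sum_list_addf)

lemma sweedler_swap:
  "sweedler (\<lambda>a b. sweedler (\<lambda>c d. F a b c d) y) x = sweedler (\<lambda>c d. sweedler (\<lambda>a b. F a b c d) x) y"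
  unfolding sweedler_def split_def by (rule sum_list_prod_swap)

lemma sweedler_plus:
  fixes F :: "'h \<Rightarrow> 'h \<Rightarrow> 'b::ring_1"
  assumes "balanced2 scale F"
  shows "sweedler F (x + y) = sweedler F x + sweedler F y"
  using tensor_eq_balanced2[OF comult_add[of x y] assms] by (auto simp: sweedler_def split_def o_def ball_Un)

lemma sweedler_scale:
  fixes F :: "'h \<Rightarrow> 'h \<Rightarrow> 'b::ring_1"
  assumes "balanced2 scale F"
  shows "sweedler F (scale c x) = sweedler (\<lambda>a b. F (scale c a) b) x"
  using tensor_eq_balanced2[OF comult_scale[of c x] assms] by (auto simp: sweedler_def split_def o_def ball_Un)

lemma sweedler_mult:
  fixes F :: "'h \<Rightarrow> 'h \<Rightarrow> 'b::ring_1"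
  assumes "balanced2 scale F"
  shows "sweedler F (x * y) = sweedler (\<lambda>a b. sweedler (\<lambda>c d. F (a * c) (b * d)) y) x"
  using tensor_eq_balanced2[OF comult_mult[of x y] assms]
  by (auto simp: sweedler_def split_def o_def ball_Un sum_list_concat map_concat)

lemma sweedler_one:
  fixes F :: "'h \<Rightarrow> 'h \<Rightarrow> 'b::ring_1"
  assumes "balanced2 scale F"
  shows "sweedler F 1 = F 1 1"
  using tensor_eq_balanced2[OF comult_one assms] by (auto simp: sweedler_def split_def o_def ball_Un)

lemma sweedler_group_like:
  fixes F :: "'h \<Rightarrow> 'h \<Rightarrow> 'b::ring_1"
  assumes "group_like g" "balanced2 scale F"
  shows "sweedler F g = F g g"
  using tensor_eq_balanced2[OF assms(1)[unfolded group_like_def, THEN conjunct2] assms(2)]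
  by (auto simp: sweedler_def split_def o_def ball_Un)

text \<open>Both sides are \<open>\<Sum> F(x\<^sub>1, x\<^sub>2, x\<^sub>3)\<close>.\<close>

lemma sweedler_coassoc:
  fixes F :: "'h \<Rightarrow> 'h \<Rightarrow> 'h \<Rightarrow> 'b::ring_1"
  assumes "balanced3 scale F"
  shows "sweedler (\<lambda>c d. sweedler (\<lambda>a b. F a b d) c) x = sweedler (\<lambda>a b. sweedler (\<lambda>c d. F a c d) b) x"
  using tensor_eq_balanced3[OF coassoc[of x] assms]
  by (auto simp: sweedler_def split_def o_def ball_Un sum_list_concat map_concat numeral_2_eq_2)

lemma sweedler_counit:
  "sweedler (\<lambda>a b. scale (counit a) b) x = x" "sweedler (\<lambda>a b. scale (counit b) a) x = x"
  using counit_left counit_right by (simp_all add: sweedler_def)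

lemma sweedler_antipode:
  "sweedler (\<lambda>a b. antipode a * b) x = scale (counit x) 1"
  "sweedler (\<lambda>a b. a * antipode b) x = scale (counit x) 1"
  using antipode_left antipode_right by (simp_all add: sweedler_def)

lemma counit_group_like:
  assumes "group_like g"
  shows "counit g = 1"
proof -
  have "balanced2 scale (\<lambda>a b. scale (counit a) b)"
    by (simp add: balanced2_def counit_add counit_scale scale_left_distrib scale_right_distrib mult.commute)
  from sweedler_group_like[OF assms this] have "scale (counit g) g = scale 1 g"
    by (simp add: sweedler_counit)
  then show ?thesis
    using assms scale_cancel_right[of "counit g" g 1] by (auto simp: group_like_def)
qed

lemma antipode_group_like:
  assumes "group_like g"
  shows "g * antipode g = 1" "antipode g * g = 1"
proof -
  have "balanced2 scale (\<lambda>a b. a * antipode b)" "balanced2 scale (\<lambda>a b. antipode a * b)"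
    by (simp_all add: balanced2_def antipode_add antipode_scale distrib_left distrib_right
        scale_mult_left scale_mult_right)
  from this[THEN sweedler_group_like[OF assms]]
  show "g * antipode g = 1" "antipode g * g = 1"
    by (simp_all add: sweedler_antipode counit_group_like[OF assms])
qed

lemma adjoint_action_group_like:
  assumes "group_like g"
  shows "adjoint_action g k = g * k * antipode g"
proof -
  have "balanced2 scale (\<lambda>a b. a * k * antipode b)"
    by (simp add: balanced2_def antipode_add antipode_scale distrib_left distrib_right
        scale_mult_left scale_mult_right)
  from sweedler_group_like[OF assms this] show ?thesis
    by (simp add: adjoint_action_def sweedler_def)
qed

section \<open>Traces of endomorphisms and integrals\<close>

lemma finite_independent: "independent B \<Longrightarrow> finite B"
  using finite_dim independent_span_bound[of _ B] by auto

lemma ex_finite_basis: "\<exists>B. independent B \<and> span B = UNIV \<and> finite B"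
  using maximal_independent_subset[of UNIV] finite_independent by (metis UNIV_I subsetI top.extremum_uniqueI)

definition trace_basis :: "'h set" where
  "trace_basis = (SOME B. independent B \<and> span B = UNIV)"

lemma trace_basis: "independent trace_basis" "span trace_basis = UNIV" "finite trace_basis"
proof -
  have "\<exists>B. independent B \<and> span B = UNIV" using ex_finite_basis by blast
  then have "independent trace_basis \<and> span trace_basis = UNIV"
    unfolding trace_basis_def by (rule someI_ex)
  then show "independent trace_basis" "span trace_basis = UNIV" "finite trace_basis"
    using finite_independent by auto
qed

abbreviation coord :: "'h \<Rightarrow> 'h \<Rightarrow> 'k" where
  "coord b v \<equiv> representation trace_basis v b"

lemma lin_coord: "lin (coord b)"
  using linear_representation[OF trace_basis(1,2)] .

lemma sum_coord: "(\<Sum>b\<in>trace_basis. scale (coord b v) b) = v"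
  by (rule sum_representation_eq) (use trace_basis in auto)

lemma endo_trace_coord: "endo_trace f = (\<Sum>b\<in>trace_basis. coord b (f b))"
  by (simp add: endo_trace_def trace_basis_def Let_def)

lemma endo_trace_add: "endo_trace (\<lambda>k. f k + g k) = endo_trace f + endo_trace g"
  by (simp add: endo_trace_coord lin_add[OF lin_coord] sum.distrib)

lemma endo_trace_scale: "endo_trace (\<lambda>k. scale c (f k)) = c * endo_trace f"
  by (simp add: endo_trace_coord lin_scale[OF lin_coord] sum_distrib_left)

text \<open>Together with additivity this gives the trace of \<open>k \<mapsto> \<Sum> \<phi>\<^sub>t(k) w\<^sub>t\<close> as \<open>\<Sum> \<phi>\<^sub>t(w\<^sub>t)\<close>, for any finite family.
The traces below are computed in this way.\<close>

lemma endo_trace_rank_one: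
  assumes "lin \<phi>"
  shows "endo_trace (\<lambda>k. scale (\<phi> k) w) = \<phi> w"
proof -
  have "endo_trace (\<lambda>k. scale (\<phi> k) w) = (\<Sum>b\<in>trace_basis. \<phi> (scale (coord b w) b))"
    by (simp add: endo_trace_coord lin_scale[OF lin_coord] lin_scale[OF assms] mult.commute)
  also have "\<dots> = \<phi> (\<Sum>b\<in>trace_basis. scale (coord b w) b)"
    by (rule additive_zero_sum(2)[symmetric]) (rule lin_add[OF assms])
  finally show ?thesis by (simp add: sum_coord)
qed

lemma endo_trace_zero: "endo_trace (\<lambda>k. 0) = 0"
  using endo_trace_scale[of 0 "\<lambda>k. 0"] by simp

lemma endo_trace_sum: "endo_trace (\<lambda>k. \<Sum>t\<in>T. f t k) = (\<Sum>t\<in>T. endo_trace (f t))"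
  by (induction T rule: infinite_finite_induct) (simp_all add: endo_trace_zero endo_trace_add)

lemma endo_trace_sweedler:
  "endo_trace (\<lambda>k. sweedler (\<lambda>a b. f a b k) x) = sweedler (\<lambda>a b. endo_trace (f a b)) x"
proof -
  have "endo_trace (\<lambda>k. \<Sum>t\<leftarrow>ts. f (fst t) (snd t) k) = (\<Sum>t\<leftarrow>ts. endo_trace (f (fst t) (snd t)))"
    for ts :: "('h \<times> 'h) list"
    by (induction ts) (simp_all add: endo_trace_zero endo_trace_add)
  then show ?thesis
    by (simp add: sweedler_def split_def)
qed

text \<open>Expanding \<open>g k\<close> in the basis exhibits \<open>k \<mapsto> f (g k)\<close> as a sum of rank-one maps.\<close>

lemma endo_trace_commute:
  assumes f: "\<And>x y. f (x + y) = f x + f y" "\<And>c x. f (scale c x) = scale c (f x)"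
    and g: "\<And>x y. g (x + y) = g x + g y" "\<And>c x. g (scale c x) = scale c (g x)"
  shows "endo_trace (\<lambda>k. f (g k)) = endo_trace (\<lambda>k. g (f k))"
proof -
  have lin: "lin (\<lambda>k. coord b (g k))" for b
    by (rule linI) (simp_all add: g lin_add[OF lin_coord] lin_scale[OF lin_coord])
  have "f (g k) = (\<Sum>b\<in>trace_basis. scale (coord b (g k)) (f b))" for k
  proof -
    have "f (g k) = f (\<Sum>b\<in>trace_basis. scale (coord b (g k)) b)" by (simp add: sum_coord)
    also have "\<dots> = (\<Sum>b\<in>trace_basis. scale (coord b (g k)) (f b))"
      by (subst additive_zero_sum(2)[of f]) (simp_all add: f)
    finally show ?thesis .
  qed
  then have "endo_trace (\<lambda>k. f (g k)) = (\<Sum>b\<in>trace_basis. coord b (g (f b)))"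
    by (simp add: endo_trace_sum endo_trace_rank_one[OF lin])
  then show ?thesis by (simp add: endo_trace_coord)
qed

definition two_sided_trace :: "'h \<Rightarrow> 'h \<Rightarrow> 'k" where
  "two_sided_trace a x = endo_trace (\<lambda>k. a * k * x)"

lemma two_sided_trace_add_right: "two_sided_trace a (x + y) = two_sided_trace a x + two_sided_trace a y"
  and two_sided_trace_scale_right: "two_sided_trace a (scale c x) = c * two_sided_trace a x"
  by (simp_all add: two_sided_trace_def distrib_left scale_mult_right endo_trace_add endo_trace_scale)

lemma two_sided_trace_zero: "two_sided_trace a 0 = 0"
  by (simp add: two_sided_trace_def endo_trace_zero)

text \<open>The left multiplication by \<open>a\<close> commutes with right multiplications, so only the latter have to be
rotated under the trace.\<close>

lemma two_sided_trace_commute: "two_sided_trace a (x * y) = two_sided_trace a (y * x)"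
proof -
  have "endo_trace (\<lambda>k. (a * k * x) * y) = endo_trace (\<lambda>k. a * (k * y) * x)"
    by (rule endo_trace_commute[where f = "\<lambda>k. k * y" and g = "\<lambda>k. a * k * x"])
      (simp_all add: distrib_left distrib_right scale_mult_left scale_mult_right)
  then show ?thesis by (simp add: two_sided_trace_def mult.assoc)
qed

lemma adjoint_character_group_like:
  assumes "group_like g"
  shows "adjoint_character g = two_sided_trace g (antipode g)"
proof -
  have "adjoint_action g = (\<lambda>k. g * k * antipode g)"
    by (rule ext) (rule adjoint_action_group_like[OF assms])
  then show ?thesis by (simp add: adjoint_character_def two_sided_trace_def)
qed

definition two_sided_integral :: "'h \<Rightarrow> bool" where
  "two_sided_integral \<Lambda> \<longleftrightarrow>
     (\<forall>h. h * \<Lambda> = scale (counit h) \<Lambda>) \<and> (\<forall>h. \<Lambda> * h = scale (counit h) \<Lambda>)"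

text \<open>Semisimplicity gives a left integral \<open>\<Lambda>\<close> with \<open>\<epsilon>(\<Lambda>) = 1\<close>. For every \<open>h\<close> the difference
\<open>\<Lambda> h - \<epsilon>(h) \<Lambda>\<close> is again a left integral and has counit \<open>0\<close>; such an element \<open>i\<close> satisfies \<open>i\<^sup>2 = 0\<close>,
and the left ideal it spans is square-zero, hence zero in a semisimple ring. So \<open>\<Lambda>\<close> is also a right
integral.\<close>

lemma ex_normalized_two_sided_integral:
  assumes ss: "semisimple_ring (ring_of_type_algebra :: 'h ring)"
  obtains \<Lambda> where "two_sided_integral \<Lambda>" "counit \<Lambda> = 1"
proof -
  interpret R: ring "ring_of_type_algebra :: 'h ring" by (rule ring_ring_of_type_algebra)
  have "counit \<in> ring_hom (ring_of_type_algebra :: 'h ring) (ring_of_type_algebra :: 'k ring)"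
    by (rule ring_hom_memI)
       (simp_all add: ring_of_type_algebra_def counit_mult counit_one counit_add)
  from R.eigenvector_of_character_if_semisimple[OF ring_ring_of_type_algebra this ss]
  obtain \<Lambda> where L: "counit \<Lambda> = 1" "\<And>x y. counit x = counit y \<Longrightarrow> x * \<Lambda> = y * \<Lambda>"
    by (auto simp: ring_of_type_algebra_def)
  have left: "h * \<Lambda> = scale (counit h) \<Lambda>" for h
    using L(2)[of h "scale (counit h) 1"] by (simp add: counit_scale counit_one scale_mult_left)
  (* A left integral with counit 0 vanishes: a right unit of the left ideal k i is a multiple
     of i, and i * i = \<epsilon>(i) i = 0. *)
  have zero: "i = 0" if i: "\<And>h. h * i = scale (counit h) i" "counit i = 0" for i
  proof -
    obtain p where p: "p \<in> range (\<lambda>c. scale c i)"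
      "\<And>x. x \<in> range (\<lambda>c. scale c i) \<Longrightarrow> x * p = x"
    proof (rule right_unit_of_left_ideal[OF ss, where I = "range (\<lambda>c. scale c i)"])
      show "0 \<in> range (\<lambda>c. scale c i)" by (rule range_eqI[of _ _ 0]) simp
      show "x + y \<in> range (\<lambda>c. scale c i)" if "x \<in> range (\<lambda>c. scale c i)" "y \<in> range (\<lambda>c. scale c i)" for x y
        using that by (auto simp flip: scale_left_distrib)
      show "r * x \<in> range (\<lambda>c. scale c i)" if "x \<in> range (\<lambda>c. scale c i)" for r x
        using that by (auto simp: scale_mult_right i)
    qed blast
    obtain c where c: "p = scale c i" using p(1) by blast
    have "i = i * p" by (rule p(2)[symmetric], rule range_eqI[of _ _ 1]) simp
    also have "\<dots> = 0" unfolding c scale_mult_right i(1) i(2) by simp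
    finally show "i = 0" .
  qed
  have right: "\<Lambda> * h = scale (counit h) \<Lambda>" for h
  proof -
    have "\<Lambda> * h - scale (counit h) \<Lambda> = 0"
    proof (rule zero)
      show "counit (\<Lambda> * h - scale (counit h) \<Lambda>) = 0"
        using counit_add[of "\<Lambda> * h - scale (counit h) \<Lambda>" "scale (counit h) \<Lambda>"]
        by (simp add: counit_mult counit_scale L(1))
    qed (simp add: right_diff_distrib mult.assoc[symmetric] left scale_mult_left scale_mult_right
        scale_right_diff_distrib mult.commute)
    then show ?thesis by simp
  qed
  show thesis
    by (rule that[of \<Lambda>]) (simp_all add: two_sided_integral_def left right L(1))
qed

text \<open>In Sweedler notation, \<open>\<Sum> \<Lambda>\<^sub>1 k \<otimes> \<Lambda>\<^sub>2 = \<Sum> \<Lambda>\<^sub>1 k\<^sub>1 \<otimes> \<Lambda>\<^sub>2 k\<^sub>2 S(k\<^sub>3) = \<Sum> \<Lambda>\<^sub>1 \<otimes> \<Lambda>\<^sub>2 S(k)\<close>: the first step inserts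
\<open>k\<^sub>2 S(k\<^sub>3)\<close>, which contracts to a counit, and the second one uses \<open>\<Delta>(\<Lambda> k\<^sub>1) = \<epsilon>(k\<^sub>1) \<Delta>(\<Lambda>)\<close>. The two
bracketings of the middle term are compared by coassociativity.\<close>

lemma integral_shift:
  fixes F :: "'h \<Rightarrow> 'h \<Rightarrow> 'b::ring_1"
  assumes L: "two_sided_integral \<Lambda>" and F: "balanced2 scale F"
  shows "sweedler (\<lambda>x y. F (x * k) y) \<Lambda> = sweedler (\<lambda>x y. F x (y * antipode k)) \<Lambda>"
proof -
  define H where "H = (\<lambda>a b c. sweedler (\<lambda>x y. F (x * a) (y * (b * antipode c))) \<Lambda>)"
  have F': "F (a + a') b = F a b + F a' b" "F a (b + b') = F a b + F a b'"
    "F (scale c a) b = F a (scale c b)" for a a' b b' c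
    using F by (simp_all add: balanced2_def)
  have H: "balanced3 scale H"
    by (simp add: H_def balanced3_def balanced2_def F' distrib_left distrib_right antipode_add
        antipode_scale scale_mult_left scale_mult_right sweedler_add_fun)
  have "sweedler (\<lambda>c d. sweedler (\<lambda>a b. H a b d) c) k = sweedler (\<lambda>c d. sweedler (\<lambda>x y. F x (y * antipode (scale (counit c) d))) \<Lambda>) k"
  proof (rule sweedler_cong)
    fix c d
    have bal: "balanced2 scale (\<lambda>x y. F x (y * antipode d))"
      by (simp add: balanced2_def F' distrib_right scale_mult_left)
    have "sweedler (\<lambda>a b. H a b d) c = sweedler (\<lambda>a b. sweedler (\<lambda>x y. F (x * a) (y * b * antipode d)) \<Lambda>) c"
      by (simp add: H_def mult.assoc)
    also have "\<dots> = sweedler (\<lambda>x y. sweedler (\<lambda>a b. F (x * a) (y * b * antipode d)) c) \<Lambda>"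
      by (rule sweedler_swap)
    also have "\<dots> = sweedler (\<lambda>x y. F x (y * antipode d)) (\<Lambda> * c)"
      by (simp add: sweedler_mult[OF bal])
    also have "\<dots> = sweedler (\<lambda>x y. F (scale (counit c) x) (y * antipode d)) \<Lambda>"
      using L by (simp add: two_sided_integral_def sweedler_scale[OF bal])
    finally show "sweedler (\<lambda>a b. H a b d) c = sweedler (\<lambda>x y. F x (y * antipode (scale (counit c) d))) \<Lambda>"
      by (simp add: F' antipode_scale scale_mult_right)
  qed
  also have "\<dots> = sweedler (\<lambda>x y. F x (y * antipode k)) \<Lambda>"
    by (subst sweedler_additive[symmetric, where A = "\<lambda>u. sweedler (\<lambda>x y. F x (y * antipode u)) \<Lambda>"])
      (simp_all add: antipode_add distrib_left F' sweedler_add_fun sweedler_counit)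
  finally have 1: "sweedler (\<lambda>c d. sweedler (\<lambda>a b. H a b d) c) k = sweedler (\<lambda>x y. F x (y * antipode k)) \<Lambda>" .
  have "sweedler (\<lambda>a b. sweedler (\<lambda>c d. H a c d) b) k = sweedler (\<lambda>a b. sweedler (\<lambda>x y. F (x * scale (counit b) a) y) \<Lambda>) k"
  proof (rule sweedler_cong)
    fix a b
    have "sweedler (\<lambda>c d. H a c d) b = sweedler (\<lambda>x y. F (x * a) (y * sweedler (\<lambda>c d. c * antipode d) b)) \<Lambda>"
      unfolding H_def
      by (rule sweedler_additive[symmetric, where A = "\<lambda>u. sweedler (\<lambda>x y. F (x * a) (y * u)) \<Lambda>"])
        (simp add: distrib_left F' sweedler_add_fun)
    then show "sweedler (\<lambda>c d. H a c d) b = sweedler (\<lambda>x y. F (x * scale (counit b) a) y) \<Lambda>"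
      by (simp add: sweedler_antipode scale_mult_right F')
  qed
  also have "\<dots> = sweedler (\<lambda>x y. F (x * sweedler (\<lambda>a b. scale (counit b) a) k) y) \<Lambda>"
  proof (rule sweedler_additive[symmetric, where A = "\<lambda>u. sweedler (\<lambda>x y. F (x * u) y) \<Lambda>"])
    fix u v
    have "(\<lambda>x y. F (x * (u + v)) y) = (\<lambda>x y. F (x * u) y + F (x * v) y)"
      by (simp add: fun_eq_iff distrib_left F')
    then show "sweedler (\<lambda>x y. F (x * (u + v)) y) \<Lambda> =
        sweedler (\<lambda>x y. F (x * u) y) \<Lambda> + sweedler (\<lambda>x y. F (x * v) y) \<Lambda>"
      by (simp only: sweedler_add_fun)
  qed
  also have "\<dots> = sweedler (\<lambda>x y. F (x * k) y) \<Lambda>"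
    by (simp only: sweedler_counit)
  finally show ?thesis
    using 1 sweedler_coassoc[OF H, of k] by simp
qed

text \<open>When \<open>H\<close> is split, with irreducible characters \<open>\<chi>\<^sub>i\<close>, then \<open>T(a, x) = \<Sum> \<chi>\<^sub>i(a) \<chi>\<^sub>i(x)\<close>. For
\<open>f = \<chi>\<^sub>j\<close> the equation then follows from the
orthogonality relations, by which \<open>(\<chi>\<^sub>i * \<chi>\<^sub>j)(\<Lambda>)\<close> is \<open>1\<close> if the modules are dual to each other and \<open>0\<close>
otherwise. The computation here replaces the orthogonality relations by the trace of a finite-rank
map and the cyclic invariance of \<open>f\<close>.\<close>

lemma trace_against_integral:
  assumes L: "two_sided_integral \<Lambda>" "counit \<Lambda> = 1" and f: "lin f" "\<And>x y. f (x * y) = f (y * x)"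
    and g: "group_like g"
  shows "sweedler (\<lambda>a b. two_sided_trace a (antipode g) * f b) \<Lambda> = f g"
proof -
  let ?b = "antipode g"
  note lins = lin_add[OF f(1)] lin_scale[OF f(1)]
  have bal1: "balanced2 scale (\<lambda>x y. scale (f y) (x * ?b))"
    by (simp add: balanced2_def lins distrib_right scale_left_distrib scale_right_distrib
        scale_mult_left mult.commute)
  have bal2: "balanced2 scale (\<lambda>x y. f (y * antipode (x * ?b)))"
    by (simp add: balanced2_def lins distrib_right distrib_left antipode_add antipode_scale
        scale_mult_left scale_mult_right)
  have rank_one: "endo_trace (\<lambda>k. scale (f (y * antipode k)) w) = f (y * antipode w)" for y w
    by (rule endo_trace_rank_one[where \<phi> = "\<lambda>k. f (y * antipode k)"])
       (simp add: linI antipode_add antipode_scale distrib_left scale_mult_right lins)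
  have "sweedler (\<lambda>a b. two_sided_trace a ?b * f b) \<Lambda> =
      endo_trace (\<lambda>k. sweedler (\<lambda>x y. scale (f y) (x * k * ?b)) \<Lambda>)"
    by (simp add: two_sided_trace_def endo_trace_sweedler endo_trace_scale mult.commute)
  (* After the shift the summands are of rank one as maps of k. *)
  also have "\<dots> = endo_trace (\<lambda>k. sweedler (\<lambda>x y. scale (f (y * antipode k)) (x * ?b)) \<Lambda>)"
    by (simp add: integral_shift[OF L(1) bal1])
  also have "\<dots> = sweedler (\<lambda>x y. f (y * antipode (x * ?b))) \<Lambda>"
    by (simp add: endo_trace_sweedler rank_one)
  (* \<Lambda> g = \<Lambda>, because g has counit 1. *)
  also have "\<dots> = sweedler (\<lambda>x y. f (y * antipode (x * ?b))) (\<Lambda> * g)"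
    using L(1) by (simp add: two_sided_integral_def counit_group_like[OF g])
  also have "\<dots> = sweedler (\<lambda>x y. f (y * g * antipode (x * g * ?b))) \<Lambda>"
  proof -
    have "sweedler (\<lambda>c d. f (y * d * antipode (x * c * ?b))) g = f (y * g * antipode (x * g * ?b))" for x y
      by (rule sweedler_group_like[OF g])
         (simp add: balanced2_def lins distrib_right distrib_left antipode_add antipode_scale
           scale_mult_left scale_mult_right)
    then show ?thesis by (simp add: sweedler_mult[OF bal2])
  qed
  also have "\<dots> = sweedler (\<lambda>x y. f (g * (antipode x * y))) \<Lambda>"
  proof (rule sweedler_cong)
    fix x y
    have "x * g * ?b = x" by (simp add: mult.assoc antipode_group_like[OF g])
    then show "f (y * g * antipode (x * g * ?b)) = f (g * (antipode x * y))"
      using f(2)[of y "g * antipode x"] by (simp add: mult.assoc)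
  qed
  also have "\<dots> = f (g * sweedler (\<lambda>x y. antipode x * y) \<Lambda>)"
    by (rule sweedler_additive[symmetric, where A = "\<lambda>u. f (g * u)"]) (simp add: distrib_left lins)
  also have "\<dots> = f g" by (simp add: sweedler_antipode L(2))
  finally show ?thesis .
qed

section \<open>Tensor products of modules\<close>

lemma sweedler_mult_left: "c * sweedler F x = sweedler (\<lambda>a b. c * F a b) x" for c :: "'b::ring_1"
  by (rule sweedler_additive) (simp add: distrib_left)

lemma sweedler_mult_right: "sweedler F x * c = sweedler (\<lambda>a b. F a b * c) x" for c :: "'b::ring_1"
  by (rule sweedler_additive[where A = "\<lambda>u. u * c"]) (simp add: distrib_right)

lemma sweedler_zero: "sweedler (\<lambda>a b. 0) x = (0 :: 'b::ring_1)"
  by (simp add: sweedler_def split_def)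

lemma sweedler_sum:
  fixes F :: "_ \<Rightarrow> 'h \<Rightarrow> 'h \<Rightarrow> 'b::ring_1"
  shows "(\<Sum>k\<in>K. sweedler (F k) x) = sweedler (\<lambda>a b. \<Sum>k\<in>K. F k a b) x"
  by (induction K rule: infinite_finite_induct) (simp_all add: sweedler_add_fun sweedler_zero)

lemma moduleD:
  assumes "is_module \<rho>"
  shows "\<rho> x \<in> carrier_mat (module_dim \<rho>) (module_dim \<rho>)" "\<rho> (x + y) = \<rho> x + \<rho> y"
    "\<rho> (scale c x) = c \<cdot>\<^sub>m \<rho> x" "\<rho> (x * y) = \<rho> x * \<rho> y" "\<rho> 1 = 1\<^sub>m (module_dim \<rho>)"
  using assms by (simp_all add: is_module_def)

lemma module_entry:
  assumes "is_module \<rho>" "i < module_dim \<rho>" "j < module_dim \<rho>"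
  shows "\<rho> (x + y) $$ (i, j) = \<rho> x $$ (i, j) + \<rho> y $$ (i, j)"
    "\<rho> (scale c x) $$ (i, j) = c * \<rho> x $$ (i, j)"
  using assms(2,3) moduleD(1)[OF assms(1), of x] moduleD(1)[OF assms(1), of y]
  by (simp_all add: moduleD(2,3)[OF assms(1)])

lemma intertwinersD:
  assumes "f \<in> intertwiners \<rho> \<sigma>"
  shows "f \<in> carrier_mat (module_dim \<sigma>) (module_dim \<rho>)" "f * \<rho> x = \<sigma> x * f"
  using assms by (simp_all add: intertwiners_def)

lemma module_dim_tensor: "module_dim (tensor_module \<rho> \<sigma>) = module_dim \<rho> * module_dim \<sigma>"
  by (simp add: tensor_module_def module_dim_def Let_def)

lemma tensor_carrier:
  "tensor_module \<rho> \<sigma> x \<in> carrier_mat (module_dim \<rho> * module_dim \<sigma>) (module_dim \<rho> * module_dim \<sigma>)"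
  by (simp add: tensor_module_def Let_def)

context
  fixes \<rho> \<sigma> :: "'h \<Rightarrow> 'k mat"
  assumes \<rho>: "is_module \<rho>" and \<sigma>: "is_module \<sigma>"
begin

lemma kron_module_carrier:
  "kron (\<rho> a) (\<sigma> b) \<in> carrier_mat (module_dim \<rho> * module_dim \<sigma>) (module_dim \<rho> * module_dim \<sigma>)"
  by (rule kron_carrier[OF moduleD(1)[OF \<rho>] moduleD(1)[OF \<sigma>]])

lemma tensor_entry:
  assumes "i < module_dim \<rho> * module_dim \<sigma>" "j < module_dim \<rho> * module_dim \<sigma>"
  shows "tensor_module \<rho> \<sigma> x $$ (i, j) = sweedler (\<lambda>a b. kron (\<rho> a) (\<sigma> b) $$ (i, j)) x"
  using assms
  by (simp add: tensor_module_def sweedler_def Let_def kron_entry[OF moduleD(1)[OF \<rho>] moduleD(1)[OF \<sigma>]])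

lemma balanced2_kron:
  assumes "i < module_dim \<rho> * module_dim \<sigma>" "j < module_dim \<rho> * module_dim \<sigma>"
  shows "balanced2 scale (\<lambda>a b. kron (\<rho> a) (\<sigma> b) $$ (i, j))"
  using assms
  by (simp add: balanced2_def kron_entry[OF moduleD(1)[OF \<rho>] moduleD(1)[OF \<sigma>]]
      module_entry[OF \<rho>] module_entry[OF \<sigma>] div_mod_bounds algebra_simps)

text \<open>The tensor product module is a Sweedler sum of Kronecker products. Entry by entry, such a sum may be
moved past a matrix factor, which reduces identities for tensor product modules to identities for
Kronecker products.\<close>

lemma mult_tensor_entry:
  assumes A: "A \<in> carrier_mat p (module_dim \<rho> * module_dim \<sigma>)"
    and "i < p" "j < module_dim \<rho> * module_dim \<sigma>"
  shows "(A * tensor_module \<rho> \<sigma> x) $$ (i, j) = sweedler (\<lambda>a b. (A * kron (\<rho> a) (\<sigma> b)) $$ (i, j)) x"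
  using assms
  by (simp add: mult_mat_entry[OF A tensor_carrier] mult_mat_entry[OF A kron_module_carrier]
      tensor_entry sweedler_mult_left sweedler_sum)

lemma tensor_mult_entry:
  assumes A: "A \<in> carrier_mat (module_dim \<rho> * module_dim \<sigma>) p"
    and "i < module_dim \<rho> * module_dim \<sigma>" "j < p"
  shows "(tensor_module \<rho> \<sigma> x * A) $$ (i, j) = sweedler (\<lambda>a b. (kron (\<rho> a) (\<sigma> b) * A) $$ (i, j)) x"
  using assms
  by (simp add: mult_mat_entry[OF tensor_carrier A] mult_mat_entry[OF kron_module_carrier A]
      tensor_entry sweedler_mult_right sweedler_sum)

lemma is_module_tensor: "is_module (tensor_module \<rho> \<sigma>)"
  unfolding is_module_def module_dim_tensor
proof (intro conjI allI)
  let ?n = "module_dim \<rho> * module_dim \<sigma>"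
  note T = tensor_carrier[of \<rho> \<sigma>]
  show "tensor_module \<rho> \<sigma> x \<in> carrier_mat ?n ?n" for x by (rule T)
  show "tensor_module \<rho> \<sigma> (x + y) = tensor_module \<rho> \<sigma> x + tensor_module \<rho> \<sigma> y" for x y
    by (rule eq_matI) (use T[of x] T[of y] T[of "x + y"] in
      \<open>simp_all add: tensor_entry sweedler_plus[OF balanced2_kron]\<close>)
  show "tensor_module \<rho> \<sigma> (scale c x) = c \<cdot>\<^sub>m tensor_module \<rho> \<sigma> x" for c x
  proof (rule eq_matI)
    fix i j assume "i < dim_row (c \<cdot>\<^sub>m tensor_module \<rho> \<sigma> x)" "j < dim_col (c \<cdot>\<^sub>m tensor_module \<rho> \<sigma> x)"
    then have ij: "i < ?n" "j < ?n" using T[of x] by auto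
    have "kron (\<rho> (scale c a)) (\<sigma> b) $$ (i, j) = c * kron (\<rho> a) (\<sigma> b) $$ (i, j)" for a b
      using ij
      by (simp add: kron_entry[OF moduleD(1)[OF \<rho>] moduleD(1)[OF \<sigma>]] module_entry[OF \<rho>] div_mod_bounds)
    then show "tensor_module \<rho> \<sigma> (scale c x) $$ (i, j) = (c \<cdot>\<^sub>m tensor_module \<rho> \<sigma> x) $$ (i, j)"
      using ij T[of x] by (simp add: tensor_entry sweedler_scale[OF balanced2_kron] sweedler_mult_left)
  qed (use T[of x] T[of "scale c x"] in auto)
  show "tensor_module \<rho> \<sigma> (x * y) = tensor_module \<rho> \<sigma> x * tensor_module \<rho> \<sigma> y" for x y
  proof (rule eq_matI)
    fix i j assume "i < dim_row (tensor_module \<rho> \<sigma> x * tensor_module \<rho> \<sigma> y)"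
      "j < dim_col (tensor_module \<rho> \<sigma> x * tensor_module \<rho> \<sigma> y)"
    then have ij: "i < ?n" "j < ?n" using T[of x] T[of y] by auto
    show "tensor_module \<rho> \<sigma> (x * y) $$ (i, j) = (tensor_module \<rho> \<sigma> x * tensor_module \<rho> \<sigma> y) $$ (i, j)"
      using ij
      by (simp add: tensor_mult_entry[OF T] mult_tensor_entry[OF kron_module_carrier] tensor_entry
          sweedler_mult[OF balanced2_kron] moduleD(4)[OF \<rho>] moduleD(4)[OF \<sigma>]
          kron_mult[OF moduleD(1)[OF \<rho>] moduleD(1)[OF \<rho>] moduleD(1)[OF \<sigma>] moduleD(1)[OF \<sigma>]])
  qed (use T[of x] T[of y] T[of "x * y"] in auto)
  show "tensor_module \<rho> \<sigma> 1 = 1\<^sub>m ?n"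
    by (rule eq_matI) (use T[of 1] in
      \<open>simp_all add: tensor_entry sweedler_one[OF balanced2_kron] moduleD(5)[OF \<rho>] moduleD(5)[OF \<sigma>] kron_one\<close>)
qed

lemma mtrace_tensor: "mtrace (tensor_module \<rho> \<sigma> x) = sweedler (\<lambda>a b. mtrace (\<rho> a) * mtrace (\<sigma> b)) x"
proof -
  have "mtrace (tensor_module \<rho> \<sigma> x) =
      (\<Sum>i<module_dim \<rho> * module_dim \<sigma>. sweedler (\<lambda>a b. kron (\<rho> a) (\<sigma> b) $$ (i, i)) x)"
    using tensor_carrier[of \<rho> \<sigma> x] by (simp add: mtrace_def tensor_entry)
  also have "\<dots> = sweedler (\<lambda>a b. mtrace (kron (\<rho> a) (\<sigma> b))) x"
    by (simp add: sweedler_sum mtrace_def carrier_matD(1)[OF kron_module_carrier])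
  finally show ?thesis
    by (simp add: mtrace_kron[OF moduleD(1)[OF \<rho>] moduleD(1)[OF \<sigma>]])
qed

end

lemma kron_intertwiner:
  assumes M: "is_module \<rho>" "is_module \<rho>'" "is_module \<sigma>" "is_module \<sigma>'"
    and f: "f \<in> intertwiners \<rho> \<rho>'" and h: "h \<in> intertwiners \<sigma> \<sigma>'"
  shows "kron f h \<in> intertwiners (tensor_module \<rho> \<sigma>) (tensor_module \<rho>' \<sigma>')"
  unfolding intertwiners_def module_dim_tensor
proof (intro CollectI conjI allI)
  show K: "kron f h \<in> carrier_mat (module_dim \<rho>' * module_dim \<sigma>') (module_dim \<rho> * module_dim \<sigma>)"
    by (rule kron_carrier[OF intertwinersD(1)[OF f] intertwinersD(1)[OF h]])
  fix x
  show "kron f h * tensor_module \<rho> \<sigma> x = tensor_module \<rho>' \<sigma>' x * kron f h"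
  proof (rule eq_matI)
    fix i j assume "i < dim_row (tensor_module \<rho>' \<sigma>' x * kron f h)"
      "j < dim_col (tensor_module \<rho>' \<sigma>' x * kron f h)"
    then have ij: "i < module_dim \<rho>' * module_dim \<sigma>'" "j < module_dim \<rho> * module_dim \<sigma>"
      using K tensor_carrier[of \<rho>' \<sigma>' x] by auto
    have "kron f h * kron (\<rho> a) (\<sigma> b) = kron (\<rho>' a) (\<sigma>' b) * kron f h" for a b
      using kron_mult[OF intertwinersD(1)[OF f] moduleD(1)[OF M(1), of a]
          intertwinersD(1)[OF h] moduleD(1)[OF M(3), of b]]
        kron_mult[OF moduleD(1)[OF M(2), of a] intertwinersD(1)[OF f]
          moduleD(1)[OF M(4), of b] intertwinersD(1)[OF h]]
      by (simp add: intertwinersD(2)[OF f] intertwinersD(2)[OF h])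
    then show "(kron f h * tensor_module \<rho> \<sigma> x) $$ (i, j) = (tensor_module \<rho>' \<sigma>' x * kron f h) $$ (i, j)"
      by (simp add: mult_tensor_entry[OF M(1,3) K ij] tensor_mult_entry[OF M(2,4) K ij])
  qed (use K tensor_carrier[of \<rho>' \<sigma>' x] tensor_carrier[of \<rho> \<sigma> x] in auto)
qed

lemma one_intertwiner: "is_module \<rho> \<Longrightarrow> 1\<^sub>m (module_dim \<rho>) \<in> intertwiners \<rho> \<rho>"
  using left_mult_one_mat[OF moduleD(1)] right_mult_one_mat[OF moduleD(1)] by (simp add: intertwiners_def)

text \<open>On column spaces the associativity isomorphism is the identity, so the modules are equal and not just
isomorphic.\<close>

lemma tensor_assoc:
  assumes "is_module \<rho>" "is_module \<sigma>" "is_module \<tau>"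
  shows "tensor_module (tensor_module \<rho> \<sigma>) \<tau> = tensor_module \<rho> (tensor_module \<sigma> \<tau>)"
proof (rule ext, rule eq_matI)
  fix x i j
  let ?r = "module_dim \<rho>" and ?s = "module_dim \<sigma>" and ?t = "module_dim \<tau>"
  note M = assms is_module_tensor[OF assms(1,2)] is_module_tensor[OF assms(2,3)]
  assume "i < dim_row (tensor_module \<rho> (tensor_module \<sigma> \<tau>) x)" "j < dim_col (tensor_module \<rho> (tensor_module \<sigma> \<tau>) x)"
  then have ij: "i < ?r * (?s * ?t)" "j < ?r * (?s * ?t)"
    using tensor_carrier[of \<rho> "tensor_module \<sigma> \<tau>" x] by (auto simp: module_dim_tensor)
  then have ij': "i < ?r * ?s * ?t" "j < ?r * ?s * ?t" by (simp_all add: mult.assoc)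
  (* The (i, j) entry of the triple Kronecker product, in the index conventions of the left-hand
     side. *)
  define F where "F = (\<lambda>a b c. \<rho> a $$ (i div ?t div ?s, j div ?t div ?s) *
     \<sigma> b $$ (i div ?t mod ?s, j div ?t mod ?s) * \<tau> c $$ (i mod ?t, j mod ?t))"
  have bounds: "i div ?t < ?r * ?s" "j div ?t < ?r * ?s" "i mod ?t < ?t" "j mod ?t < ?t"
    using ij' by (simp_all add: div_mod_bounds)
  note bounds' = bounds bounds(1,2)[THEN div_mod_bounds(1)] bounds(1,2)[THEN div_mod_bounds(2)]
  have F: "balanced3 scale F"
    using bounds'
    by (simp add: balanced3_def balanced2_def F_def module_entry[OF M(1)] module_entry[OF M(2)]
        module_entry[OF M(3)] algebra_simps)
  have "tensor_module (tensor_module \<rho> \<sigma>) \<tau> x $$ (i, j) =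
      sweedler (\<lambda>c d. sweedler (\<lambda>a b. F a b d) c) x"
    using ij' bounds
    by (simp add: tensor_entry[OF M(4,3)] module_dim_tensor F_def sweedler_mult_right
        kron_entry[OF tensor_carrier moduleD(1)[OF M(3)]] tensor_entry[OF M(1,2)]
        kron_entry[OF moduleD(1)[OF M(1)] moduleD(1)[OF M(2)]])
  also have "\<dots> = sweedler (\<lambda>a b. sweedler (\<lambda>c d. F a c d) b) x"
    by (rule sweedler_coassoc[OF F])
  also have "\<dots> = tensor_module \<rho> (tensor_module \<sigma> \<tau>) x $$ (i, j)"
    using ij div_mod_bounds(2)[OF ij(1)] div_mod_bounds(2)[OF ij(2)]
    by (simp add: tensor_entry[OF M(1,5)] module_dim_tensor F_def sweedler_mult_left mult.assoc
        kron_entry[OF moduleD(1)[OF M(1)] tensor_carrier] tensor_entry[OF M(2,3)]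
        kron_entry[OF moduleD(1)[OF M(2)] moduleD(1)[OF M(3)]] div_mod_of_product)
  finally show "tensor_module (tensor_module \<rho> \<sigma>) \<tau> x $$ (i, j) = tensor_module \<rho> (tensor_module \<sigma> \<tau>) x $$ (i, j)" .
qed (simp_all add: tensor_module_def Let_def module_dim_def mult.assoc)

lemma module_dim_trivial: "module_dim trivial_module = 1"
  by (simp add: module_dim_def trivial_module_def)

lemma is_module_trivial: "is_module trivial_module"
  unfolding is_module_def module_dim_trivial
  by (auto simp: trivial_module_def counit_add counit_scale counit_mult counit_one scalar_prod_def intro!: eq_matI)

lemma mtrace_trivial: "mtrace (trivial_module x) = counit x"
  by (simp add: mtrace_def trivial_module_def)

lemma tensor_unit:
  assumes "is_module \<rho>"
  shows "tensor_module trivial_module \<rho> = \<rho>" "tensor_module \<rho> trivial_module = \<rho>"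
proof -
  have entry: "\<rho> (sweedler (\<lambda>a b. scale (G a b) (F a b)) x) $$ (i, j) = sweedler (\<lambda>a b. G a b * \<rho> (F a b) $$ (i, j)) x"
    if "i < module_dim \<rho>" "j < module_dim \<rho>" for F :: "'h \<Rightarrow> 'h \<Rightarrow> 'h" and G x i j
    using that
    by (subst sweedler_additive[where A = "\<lambda>u. \<rho> u $$ (i, j)"]) (simp_all add: module_entry[OF assms])
  have trivial_entry: "trivial_module a $$ (0, 0) = counit a" for a
    by (simp add: trivial_module_def)
  have kron_trivial: "kron (trivial_module a) (\<rho> b) $$ (i, j) = counit a * \<rho> b $$ (i, j)"
      "kron (\<rho> b) (trivial_module a) $$ (i, j) = counit a * \<rho> b $$ (i, j)"
    if "i < module_dim \<rho>" "j < module_dim \<rho>" for a b i j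
    using that kron_entry[OF moduleD(1)[OF is_module_trivial, of a] moduleD(1)[OF assms, of b], of i j]
      kron_entry[OF moduleD(1)[OF assms, of b] moduleD(1)[OF is_module_trivial, of a], of i j]
    by (simp_all add: module_dim_trivial trivial_entry)
  show "tensor_module trivial_module \<rho> = \<rho>"
  proof (rule ext, rule eq_matI)
    fix x i j assume "i < dim_row (\<rho> x)" "j < dim_col (\<rho> x)"
    then have ij: "i < module_dim \<rho>" "j < module_dim \<rho>" using moduleD(1)[OF assms, of x] by auto
    then show "tensor_module trivial_module \<rho> x $$ (i, j) = \<rho> x $$ (i, j)"
      using entry[OF ij, of "\<lambda>a b. counit a" "\<lambda>a b. b" x]
      by (simp add: sweedler_counit tensor_entry[OF is_module_trivial assms] module_dim_trivial kron_trivial)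
  qed (simp_all add: tensor_module_def Let_def module_dim_trivial carrier_matD[OF moduleD(1)[OF assms]])
  show "tensor_module \<rho> trivial_module = \<rho>"
  proof (rule ext, rule eq_matI)
    fix x i j assume "i < dim_row (\<rho> x)" "j < dim_col (\<rho> x)"
    then have ij: "i < module_dim \<rho>" "j < module_dim \<rho>" using moduleD(1)[OF assms, of x] by auto
    then show "tensor_module \<rho> trivial_module x $$ (i, j) = \<rho> x $$ (i, j)"
      using entry[OF ij, of "\<lambda>a b. counit b" "\<lambda>a b. a" x]
      by (simp add: sweedler_counit tensor_entry[OF assms is_module_trivial] module_dim_trivial kron_trivial)
  qed (simp_all add: tensor_module_def Let_def module_dim_trivial carrier_matD[OF moduleD(1)[OF assms]])
qed

section \<open>Isomorphism classes and exact sequences\<close>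

text \<open>Isomorphism with both inverses required to be intertwiners and of the right size, which composes and
tensors more readily than \<^const>\<open>invertible_mat\<close>.\<close>

definition module_iso :: "('h \<Rightarrow> 'k mat) \<Rightarrow> ('h \<Rightarrow> 'k mat) \<Rightarrow> bool" where
  "module_iso \<rho> \<sigma> \<longleftrightarrow> is_module \<rho> \<and> is_module \<sigma> \<and> module_dim \<rho> = module_dim \<sigma> \<and>
     (\<exists>f\<in>intertwiners \<rho> \<sigma>. \<exists>f'\<in>intertwiners \<sigma> \<rho>.
        f * f' = 1\<^sub>m (module_dim \<sigma>) \<and> f' * f = 1\<^sub>m (module_dim \<rho>))"

lemma module_iso_iff:
  assumes \<rho>: "is_module \<rho>" and \<sigma>: "is_module \<sigma>"
  shows "(\<exists>f\<in>intertwiners \<rho> \<sigma>. invertible_mat f) \<longleftrightarrow> module_iso \<rho> \<sigma>"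
proof
  assume "\<exists>f\<in>intertwiners \<rho> \<sigma>. invertible_mat f"
  then obtain f where f: "f \<in> intertwiners \<rho> \<sigma>" "invertible_mat f" by blast
  note fc = intertwinersD(1)[OF f(1)]
  obtain f' where f': "module_dim \<sigma> = module_dim \<rho>" "f' \<in> carrier_mat (module_dim \<rho>) (module_dim \<sigma>)"
    "f * f' = 1\<^sub>m (module_dim \<sigma>)" "f' * f = 1\<^sub>m (module_dim \<rho>)"
    by (rule invertible_matD[OF fc f(2)])
  have "f' * \<sigma> x = \<rho> x * f'" for x
  proof -
    note rc = moduleD(1)[OF \<rho>, of x] and sc = moduleD(1)[OF \<sigma>, of x]
    have "f' * \<sigma> x = f' * (\<sigma> x * (f * f'))"
      unfolding f'(3) right_mult_one_mat[OF sc] ..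
    also have "\<dots> = f' * (\<sigma> x * f * f')"
      by (subst assoc_mult_mat[OF sc fc f'(2)]) simp
    also have "\<dots> = f' * (f * (\<rho> x * f'))"
      unfolding intertwinersD(2)[OF f(1), symmetric] assoc_mult_mat[OF fc rc f'(2)] ..
    also have "\<dots> = f' * f * (\<rho> x * f')"
      by (rule assoc_mult_mat[OF f'(2) fc mult_carrier_mat[OF rc f'(2)], symmetric])
    also have "\<dots> = \<rho> x * f'"
      unfolding f'(4) by (rule left_mult_one_mat[OF mult_carrier_mat[OF rc f'(2)]])
    finally show ?thesis .
  qed
  then have "f' \<in> intertwiners \<sigma> \<rho>" using f'(2) by (simp add: intertwiners_def)
  then show "module_iso \<rho> \<sigma>"
    unfolding module_iso_def using f f' assms by auto
next
  assume "module_iso \<rho> \<sigma>"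
  then obtain f f' where f: "f \<in> intertwiners \<rho> \<sigma>" "f' \<in> intertwiners \<sigma> \<rho>"
    "f * f' = 1\<^sub>m (module_dim \<sigma>)" "f' * f = 1\<^sub>m (module_dim \<rho>)" "module_dim \<rho> = module_dim \<sigma>"
    by (auto simp: module_iso_def)
  have "invertible_mat f"
    unfolding invertible_mat_def inverts_mat_def
    using f intertwinersD(1)[OF f(1)] intertwinersD(1)[OF f(2)] by auto
  then show "\<exists>f\<in>intertwiners \<rho> \<sigma>. invertible_mat f" using f(1) by blast
qed

lemma module_iso_refl: "is_module \<rho> \<Longrightarrow> module_iso \<rho> \<rho>"
  unfolding module_iso_def using one_intertwiner[of \<rho>]
  by (metis left_mult_one_mat one_carrier_mat)

lemma module_iso_sym: "module_iso \<rho> \<sigma> \<Longrightarrow> module_iso \<sigma> \<rho>"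
  unfolding module_iso_def by metis

lemma module_isoD:
  assumes "module_iso \<rho> \<sigma>"
  shows "is_module \<rho>" "is_module \<sigma>" "module_dim \<rho> = module_dim \<sigma>"
  using assms unfolding module_iso_def by blast+

lemma intertwiners_comp:
  assumes M: "is_module \<rho>" "is_module \<sigma>" "is_module \<tau>"
    and f: "f \<in> intertwiners \<rho> \<sigma>" and g: "g \<in> intertwiners \<sigma> \<tau>"
  shows "g * f \<in> intertwiners \<rho> \<tau>"
  unfolding intertwiners_def
proof (intro CollectI conjI allI)
  note fc = intertwinersD(1)[OF f] and gc = intertwinersD(1)[OF g]
  show "g * f \<in> carrier_mat (module_dim \<tau>) (module_dim \<rho>)" using fc gc by auto
  fix x
  note c = moduleD(1)[OF M(1), of x] moduleD(1)[OF M(2), of x] moduleD(1)[OF M(3), of x]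
  show "g * f * \<rho> x = \<tau> x * (g * f)"
    unfolding assoc_mult_mat[OF gc fc c(1)] intertwinersD(2)[OF f] assoc_mult_mat[OF gc c(2) fc, symmetric]
      intertwinersD(2)[OF g] assoc_mult_mat[OF c(3) gc fc] ..
qed

lemma module_iso_trans:
  assumes "module_iso \<rho> \<sigma>" "module_iso \<sigma> \<tau>"
  shows "module_iso \<rho> \<tau>"
proof -
  obtain f f' where f: "f \<in> intertwiners \<rho> \<sigma>" "f' \<in> intertwiners \<sigma> \<rho>"
    "f * f' = 1\<^sub>m (module_dim \<sigma>)" "f' * f = 1\<^sub>m (module_dim \<rho>)"
    using assms(1) by (auto simp: module_iso_def)
  obtain g g' where g: "g \<in> intertwiners \<sigma> \<tau>" "g' \<in> intertwiners \<tau> \<sigma>"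
    "g * g' = 1\<^sub>m (module_dim \<tau>)" "g' * g = 1\<^sub>m (module_dim \<sigma>)"
    using assms(2) by (auto simp: module_iso_def)
  have M: "is_module \<rho>" "is_module \<sigma>" "is_module \<tau>" "module_dim \<rho> = module_dim \<sigma>" "module_dim \<sigma> = module_dim \<tau>"
    using assms by (auto simp: module_iso_def)
  have c: "f \<in> carrier_mat (module_dim \<tau>) (module_dim \<tau>)" "f' \<in> carrier_mat (module_dim \<tau>) (module_dim \<tau>)"
    "g \<in> carrier_mat (module_dim \<tau>) (module_dim \<tau>)" "g' \<in> carrier_mat (module_dim \<tau>) (module_dim \<tau>)"
    using intertwinersD(1)[OF f(1)] intertwinersD(1)[OF f(2)] intertwinersD(1)[OF g(1)] intertwinersD(1)[OF g(2)] M(4,5)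
    by auto
  have "(g * f) * (f' * g') = 1\<^sub>m (module_dim \<tau>)" "(f' * g') * (g * f) = 1\<^sub>m (module_dim \<tau>)"
    using mult_inverse_pair[OF c(1,3,2,4)] mult_inverse_pair[OF c(4,2,3,1)] f(3,4) g(3,4) M(4,5) by auto
  moreover have "g * f \<in> intertwiners \<rho> \<tau>" "f' * g' \<in> intertwiners \<tau> \<rho>"
    using intertwiners_comp M f g by auto
  ultimately show ?thesis unfolding module_iso_def using M by auto
qed

lemma module_iso_tensor:
  assumes "module_iso \<rho> \<rho>'" "module_iso \<sigma> \<sigma>'"
  shows "module_iso (tensor_module \<rho> \<sigma>) (tensor_module \<rho>' \<sigma>')"
proof -
  obtain f f' where f: "f \<in> intertwiners \<rho> \<rho>'" "f' \<in> intertwiners \<rho>' \<rho>"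
    "f * f' = 1\<^sub>m (module_dim \<rho>')" "f' * f = 1\<^sub>m (module_dim \<rho>)"
    using assms(1) by (auto simp: module_iso_def)
  obtain g g' where g: "g \<in> intertwiners \<sigma> \<sigma>'" "g' \<in> intertwiners \<sigma>' \<sigma>"
    "g * g' = 1\<^sub>m (module_dim \<sigma>')" "g' * g = 1\<^sub>m (module_dim \<sigma>)"
    using assms(2) by (auto simp: module_iso_def)
  have M: "is_module \<rho>" "is_module \<rho>'" "is_module \<sigma>" "is_module \<sigma>'"
    "module_dim \<rho> = module_dim \<rho>'" "module_dim \<sigma> = module_dim \<sigma>'"
    using assms by (auto simp: module_iso_def)
  note c = intertwinersD(1)[OF f(1)] intertwinersD(1)[OF f(2)] intertwinersD(1)[OF g(1)] intertwinersD(1)[OF g(2)]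
  have "kron f g * kron f' g' = 1\<^sub>m (module_dim (tensor_module \<rho>' \<sigma>'))"
    "kron f' g' * kron f g = 1\<^sub>m (module_dim (tensor_module \<rho> \<sigma>))"
    using kron_mult[OF c(1,2,3,4)] kron_mult[OF c(2,1,4,3)] f g by (simp_all add: kron_one module_dim_tensor)
  then show ?thesis
    unfolding module_iso_def
    using kron_intertwiner[OF M(1,2,3,4) f(1) g(1)] kron_intertwiner[OF M(2,1,4,3) f(2) g(2)]
      is_module_tensor M module_dim_tensor by auto
qed

lemma mtrace_module_iso:
  assumes "module_iso \<rho> \<sigma>"
  shows "mtrace (\<rho> x) = mtrace (\<sigma> x)"
proof -
  obtain f f' where f: "f \<in> intertwiners \<rho> \<sigma>" "f' \<in> intertwiners \<sigma> \<rho>"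
    "f * f' = 1\<^sub>m (module_dim \<sigma>)" "f' * f = 1\<^sub>m (module_dim \<rho>)"
    using assms by (auto simp: module_iso_def)
  have M: "is_module \<rho>" "is_module \<sigma>" using assms by (auto simp: module_iso_def)
  note c = intertwinersD(1)[OF f(1)] intertwinersD(1)[OF f(2)] and r = moduleD(1)[OF M(1), of x]
    and s = moduleD(1)[OF M(2), of x]
  have "mtrace (\<rho> x) = mtrace (f' * (f * \<rho> x))"
    unfolding assoc_mult_mat[OF c(2,1) r, symmetric] f(4) left_mult_one_mat[OF r] ..
  also have "\<dots> = mtrace (f' * (\<sigma> x * f))"
    unfolding intertwinersD(2)[OF f(1)] ..
  also have "\<dots> = mtrace (\<sigma> x * f * f')"
    by (rule mtrace_mult_commute[OF c(2) mult_carrier_mat[OF s c(1)]])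
  also have "\<dots> = mtrace (\<sigma> x)"
    unfolding assoc_mult_mat[OF s c(1,2)] f(3) right_mult_one_mat[OF s] ..
  finally show ?thesis .
qed

lemma iso_class_eq: "is_module \<rho> \<Longrightarrow> iso_class \<rho> = {\<sigma>. module_iso \<rho> \<sigma>}"
proof -
  assume \<rho>: "is_module \<rho>"
  have "is_module \<sigma> \<and> (\<exists>f\<in>intertwiners \<rho> \<sigma>. invertible_mat f) \<longleftrightarrow> module_iso \<rho> \<sigma>" for \<sigma>
    by (cases "is_module \<sigma>") (simp_all add: module_iso_iff[OF \<rho>] module_iso_def)
  then show ?thesis by (simp add: iso_class_def)
qed

lemma iso_class_eqI:
  assumes "module_iso \<rho> \<sigma>"
  shows "iso_class \<rho> = iso_class \<sigma>"
proof -
  have "module_iso \<rho> \<tau> \<longleftrightarrow> module_iso \<sigma> \<tau>" for \<tau>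
    using module_iso_trans[OF assms, of \<tau>] module_iso_trans[OF module_iso_sym[OF assms], of \<tau>] by blast
  then show ?thesis
    by (simp add: iso_class_eq[OF module_isoD(1)[OF assms]] iso_class_eq[OF module_isoD(2)[OF assms]])
qed

text \<open>The product of classes is defined as a union over all representatives; isomorphic factors have
isomorphic tensor products, so the union consists of equal sets.\<close>

lemma iso_class_mult:
  assumes "is_module \<rho>" "is_module \<sigma>"
  shows "iso_class \<rho> \<otimes>\<^bsub>iso_class_monoid\<^esub> iso_class \<sigma> = iso_class (tensor_module \<rho> \<sigma>)"
proof -
  have const: "iso_class (tensor_module \<rho>' \<sigma>') = iso_class (tensor_module \<rho> \<sigma>)"
    if "\<rho>' \<in> iso_class \<rho>" "\<sigma>' \<in> iso_class \<sigma>" for \<rho>' \<sigma>'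
    using that assms by (intro iso_class_eqI module_iso_tensor) (auto simp: iso_class_eq module_iso_sym)
  have "\<rho> \<in> iso_class \<rho>" "\<sigma> \<in> iso_class \<sigma>"
    using assms by (simp_all add: iso_class_eq module_iso_refl)
  then have ne: "iso_class \<rho> \<noteq> {}" "iso_class \<sigma> \<noteq> {}" by blast+
  have "iso_class \<rho> \<otimes>\<^bsub>iso_class_monoid\<^esub> iso_class \<sigma> =
      (\<Union>\<rho>'\<in>iso_class \<rho>. \<Union>\<sigma>'\<in>iso_class \<sigma>. iso_class (tensor_module \<rho>' \<sigma>'))"
    by (simp add: iso_class_monoid_def)
  also have "\<dots> = (\<Union>\<rho>'\<in>iso_class \<rho>. \<Union>\<sigma>'\<in>iso_class \<sigma>. iso_class (tensor_module \<rho> \<sigma>))"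
    by (intro SUP_cong refl const)
  finally show ?thesis using ne by simp
qed

lemma carrier_iso_class_monoid: "carrier iso_class_monoid = iso_class ` Collect is_module"
  and one_iso_class_monoid: "\<one>\<^bsub>iso_class_monoid\<^esub> = iso_class trivial_module"
  by (simp_all add: iso_class_monoid_def)

lemma monoid_iso_class_monoid: "Group.monoid iso_class_monoid"
proof (rule monoidI)
  show "C \<otimes>\<^bsub>iso_class_monoid\<^esub> D \<in> carrier iso_class_monoid"
    if "C \<in> carrier iso_class_monoid" "D \<in> carrier iso_class_monoid" for C D
    using that is_module_tensor by (auto simp: carrier_iso_class_monoid iso_class_mult)
  show "\<one>\<^bsub>iso_class_monoid\<^esub> \<in> carrier iso_class_monoid"
    using is_module_trivial by (auto simp: carrier_iso_class_monoid one_iso_class_monoid)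
  show "C \<otimes>\<^bsub>iso_class_monoid\<^esub> D \<otimes>\<^bsub>iso_class_monoid\<^esub> E = C \<otimes>\<^bsub>iso_class_monoid\<^esub> (D \<otimes>\<^bsub>iso_class_monoid\<^esub> E)"
    if "C \<in> carrier iso_class_monoid" "D \<in> carrier iso_class_monoid" "E \<in> carrier iso_class_monoid" for C D E
    using that by (auto simp: carrier_iso_class_monoid iso_class_mult is_module_tensor tensor_assoc)
  show "\<one>\<^bsub>iso_class_monoid\<^esub> \<otimes>\<^bsub>iso_class_monoid\<^esub> C = C" "C \<otimes>\<^bsub>iso_class_monoid\<^esub> \<one>\<^bsub>iso_class_monoid\<^esub> = C"
    if "C \<in> carrier iso_class_monoid" for C
    using that by (auto simp: carrier_iso_class_monoid one_iso_class_monoid iso_class_mult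
        is_module_trivial tensor_unit)
qed

text \<open>Exactness witnessed by a linear retraction \<open>r\<close> of \<open>f\<close> and a linear section \<open>s\<close> of \<open>g\<close>. They are in
general not module maps. The four identities are equivalent to exactness over a field, and they are preserved
by Kronecker products with an identity matrix.\<close>

definition split_exact :: "('h \<Rightarrow> 'k mat) \<Rightarrow> ('h \<Rightarrow> 'k mat) \<Rightarrow> ('h \<Rightarrow> 'k mat) \<Rightarrow> bool" where
  "split_exact \<rho> \<sigma> \<tau> \<longleftrightarrow> (\<exists>f\<in>intertwiners \<rho> \<sigma>. \<exists>g\<in>intertwiners \<sigma> \<tau>.
     \<exists>r\<in>carrier_mat (module_dim \<rho>) (module_dim \<sigma>). \<exists>s\<in>carrier_mat (module_dim \<sigma>) (module_dim \<tau>).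
       r * f = 1\<^sub>m (module_dim \<rho>) \<and> g * s = 1\<^sub>m (module_dim \<tau>) \<and>
       f * r + s * g = 1\<^sub>m (module_dim \<sigma>) \<and> g * f = 0\<^sub>m (module_dim \<tau>) (module_dim \<rho>))"

lemma split_exact_imp_short_exact:
  assumes "split_exact \<rho> \<sigma> \<tau>"
  shows "short_exact \<rho> \<sigma> \<tau>"
proof -
  obtain f g r s where f: "f \<in> intertwiners \<rho> \<sigma>" and g: "g \<in> intertwiners \<sigma> \<tau>"
    and r: "r \<in> carrier_mat (module_dim \<rho>) (module_dim \<sigma>)" and s: "s \<in> carrier_mat (module_dim \<sigma>) (module_dim \<tau>)"
    and eqs: "r * f = 1\<^sub>m (module_dim \<rho>)" "g * s = 1\<^sub>m (module_dim \<tau>)"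
       "f * r + s * g = 1\<^sub>m (module_dim \<sigma>)" "g * f = 0\<^sub>m (module_dim \<tau>) (module_dim \<rho>)"
    using assms unfolding split_exact_def by blast
  note fc = intertwinersD(1)[OF f] and gc = intertwinersD(1)[OF g]
  have rf: "r *\<^sub>v (f *\<^sub>v v) = v" if "v \<in> carrier_vec (module_dim \<rho>)" for v
    using assoc_mult_mat_vec[OF r fc that] that by (simp add: eqs)
  have gs: "g *\<^sub>v (s *\<^sub>v v) = v" if "v \<in> carrier_vec (module_dim \<tau>)" for v
    using assoc_mult_mat_vec[OF gc s that] that by (simp add: eqs)
  have gf: "g *\<^sub>v (f *\<^sub>v v) = 0\<^sub>v (module_dim \<tau>)" if "v \<in> carrier_vec (module_dim \<rho>)" for v
    using assoc_mult_mat_vec[OF gc fc that] that by (simp add: eqs zero_mult_mat_vec)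
  have fr: "f *\<^sub>v (r *\<^sub>v v) = v" if "v \<in> carrier_vec (module_dim \<sigma>)" "g *\<^sub>v v = 0\<^sub>v (module_dim \<tau>)" for v
  proof -
    note v = that(1)
    have "v = (f * r + s * g) *\<^sub>v v" using v by (simp add: eqs)
    also have "\<dots> = (f * r) *\<^sub>v v + (s * g) *\<^sub>v v"
      by (rule add_mult_distrib_mat_vec) (use fc r s gc v in auto)
    also have "\<dots> = f *\<^sub>v (r *\<^sub>v v) + s *\<^sub>v (g *\<^sub>v v)"
      using assoc_mult_mat_vec[OF fc r v] assoc_mult_mat_vec[OF s gc v] by simp
    also have "\<dots> = f *\<^sub>v (r *\<^sub>v v)"
      unfolding that(2) zero_mult_mat_vec(2)[OF s]
      by (rule right_zero_vec[OF mult_mat_vec_carrier[OF fc mult_mat_vec_carrier[OF r v]]])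
    finally show ?thesis by simp
  qed
  have inj: "inj_on ((*\<^sub>v) f) (carrier_vec (module_dim \<rho>))"
    by (rule inj_on_inverseI) (rule rf)
  have "(*\<^sub>v) f ` carrier_vec (module_dim \<rho>) = {v \<in> carrier_vec (module_dim \<sigma>). g *\<^sub>v v = 0\<^sub>v (module_dim \<tau>)}"
  proof (intro equalityI subsetI)
    fix v assume "v \<in> {v \<in> carrier_vec (module_dim \<sigma>). g *\<^sub>v v = 0\<^sub>v (module_dim \<tau>)}"
    then have "v = f *\<^sub>v (r *\<^sub>v v)" "r *\<^sub>v v \<in> carrier_vec (module_dim \<rho>)" using fr r by auto
    then show "v \<in> (*\<^sub>v) f ` carrier_vec (module_dim \<rho>)" by blast
  qed (use gf fc in auto)
  moreover have "(*\<^sub>v) g ` carrier_vec (module_dim \<sigma>) = carrier_vec (module_dim \<tau>)"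
  proof (intro equalityI subsetI)
    fix v :: "'k vec" assume v: "v \<in> carrier_vec (module_dim \<tau>)"
    then have "v = g *\<^sub>v (s *\<^sub>v v)" "s *\<^sub>v v \<in> carrier_vec (module_dim \<sigma>)" using gs s by auto
    then show "v \<in> (*\<^sub>v) g ` carrier_vec (module_dim \<sigma>)" by blast
  qed (use gc in auto)
  ultimately show ?thesis
    unfolding short_exact_def using f g inj by blast
qed

text \<open>The section \<open>s\<close> picks preimages of the unit vectors under \<open>g\<close>. The map \<open>1 - s g\<close> then takes values in the
kernel of \<open>g\<close>, that is, in the image of \<open>f\<close>, and \<open>r\<close> lifts it through \<open>f\<close>.\<close>

lemma short_exact_imp_split_exact:
  assumes "short_exact \<rho> \<sigma> \<tau>"
  shows "split_exact \<rho> \<sigma> \<tau>"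
proof -
  let ?p = "module_dim \<rho>" and ?q = "module_dim \<sigma>" and ?t = "module_dim \<tau>"
  obtain f g where f: "f \<in> intertwiners \<rho> \<sigma>" and g: "g \<in> intertwiners \<sigma> \<tau>"
    and inj: "inj_on ((*\<^sub>v) f) (carrier_vec ?p)"
    and ker: "(*\<^sub>v) f ` carrier_vec ?p = {v \<in> carrier_vec ?q. g *\<^sub>v v = 0\<^sub>v ?t}"
    and surj: "(*\<^sub>v) g ` carrier_vec ?q = carrier_vec ?t"
    using assms unfolding short_exact_def by blast
  note fc = intertwinersD(1)[OF f] and gc = intertwinersD(1)[OF g]
  have "\<exists>v\<in>carrier_vec ?q. g *\<^sub>v v = unit_vec ?t j" if "j < ?t" for j
  proof -
    have "unit_vec ?t j \<in> (*\<^sub>v) g ` carrier_vec ?q" unfolding surj by simp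
    then show ?thesis by (metis imageE)
  qed
  then obtain sv where sv: "\<And>j. j < ?t \<Longrightarrow> sv j \<in> carrier_vec ?q" "\<And>j. j < ?t \<Longrightarrow> g *\<^sub>v sv j = unit_vec ?t j"
    by metis
  define s where "s = mat ?q ?t (\<lambda>(i, j). sv j $ i)"
  have s: "s \<in> carrier_mat ?q ?t" by (simp add: s_def)
  have col_s: "col s j = sv j" if "j < ?t" for j
    using that sv(1)[OF that] by (intro eq_vecI) (auto simp: s_def)
  have gs: "g * s = 1\<^sub>m ?t"
  proof (rule mat_col_eqI)
    fix j assume "j < dim_col (1\<^sub>m ?t)"
    then show "col (g * s) j = col (1\<^sub>m ?t) j"
      by (simp add: col_mult2[OF gc s] col_s sv)
  qed (use gc s in auto)
  (* The projection onto the kernel of g along the image of s. *)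
  define e where "e = 1\<^sub>m ?q - s * g"
  have sg: "s * g \<in> carrier_mat ?q ?q" using s gc by auto
  have e: "e \<in> carrier_mat ?q ?q" unfolding e_def by (rule minus_carrier_mat[OF sg])
  have ge: "g * e = 0\<^sub>m ?t ?q"
  proof -
    have "g * e = g * 1\<^sub>m ?q - g * (s * g)"
      unfolding e_def by (rule mult_minus_distrib_mat[OF gc one_carrier_mat sg])
    also have "g * (s * g) = g"
      unfolding assoc_mult_mat[OF gc s gc, symmetric] gs by (rule left_mult_one_mat[OF gc])
    finally show ?thesis using right_mult_one_mat[OF gc] minus_r_inv_mat[OF gc] by simp
  qed
  have "\<exists>v\<in>carrier_vec ?p. f *\<^sub>v v = col e j" if "j < ?q" for j
  proof -
    have "g *\<^sub>v col e j = col (g * e) j" using that by (simp add: col_mult2[OF gc e])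
    also have "\<dots> = 0\<^sub>v ?t" using that unfolding ge by (intro eq_vecI) auto
    finally have "col e j \<in> (*\<^sub>v) f ` carrier_vec ?p"
      unfolding ker using col_carrier_vec[OF that e] by simp
    then show ?thesis by (metis imageE)
  qed
  then obtain rv where rv: "\<And>j. j < ?q \<Longrightarrow> rv j \<in> carrier_vec ?p" "\<And>j. j < ?q \<Longrightarrow> f *\<^sub>v rv j = col e j"
    by metis
  define r where "r = mat ?p ?q (\<lambda>(i, j). rv j $ i)"
  have r: "r \<in> carrier_mat ?p ?q" by (simp add: r_def)
  have col_r: "col r j = rv j" if "j < ?q" for j
    using that rv(1)[OF that] by (intro eq_vecI) (auto simp: r_def)
  have fr: "f * r = e"
  proof (rule mat_col_eqI)
    fix j assume "j < dim_col e"
    then have "j < ?q" using e by simp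
    then show "col (f * r) j = col e j"
      by (simp add: col_mult2[OF fc r] col_r rv)
  qed (use fc r e in auto)
  have gf: "g * f = 0\<^sub>m ?t ?p"
  proof (rule mat_col_eqI)
    fix j assume "j < dim_col (0\<^sub>m ?t ?p)"
    then have j: "j < ?p" by simp
    have "unit_vec ?p j \<in> carrier_vec ?p" by simp
    then have "f *\<^sub>v unit_vec ?p j \<in> {v \<in> carrier_vec ?q. g *\<^sub>v v = 0\<^sub>v ?t}"
      using ker by blast
    moreover have "f *\<^sub>v unit_vec ?p j = col f j" using col_mult2[OF fc one_carrier_mat j] right_mult_one_mat[OF fc] j by simp
    ultimately show "col (g * f) j = col (0\<^sub>m ?t ?p) j"
      using j by (auto simp: col_mult2[OF gc fc])
  qed (use gc fc in auto)
  have rf: "r * f = 1\<^sub>m ?p"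
  proof (rule mat_col_eqI)
    fix j assume "j < dim_col (1\<^sub>m ?p)"
    then have j: "j < ?p" by simp
    have rfc: "r * f \<in> carrier_mat ?p ?p" using r fc by auto
    have "f * (r * f) = e * f"
      unfolding fr[symmetric] by (rule assoc_mult_mat[OF fc r fc, symmetric])
    also have "\<dots> = 1\<^sub>m ?q * f - s * g * f"
      unfolding e_def by (rule minus_mult_distrib_mat[OF one_carrier_mat sg fc])
    also have "\<dots> = f"
      unfolding assoc_mult_mat[OF s gc fc] gf using s fc by auto
    finally have "f * (r * f) = f * 1\<^sub>m ?p" using fc by simp
    then have "f *\<^sub>v col (r * f) j = f *\<^sub>v col (1\<^sub>m ?p) j"
      unfolding col_mult2[OF fc rfc j, symmetric] col_mult2[OF fc one_carrier_mat j, symmetric] by (rule arg_cong)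
    then show "col (r * f) j = col (1\<^sub>m ?p) j"
      by (rule inj_onD[OF inj _ col_carrier_vec[OF j rfc] col_carrier_vec[OF j one_carrier_mat]])
  qed (use r fc in auto)
  have "f * r + s * g = 1\<^sub>m ?q"
    unfolding fr e_def by (rule minus_add_cancel_mat[OF one_carrier_mat sg])
  then show ?thesis
    unfolding split_exact_def
    by (intro bexI[OF _ f] bexI[OF _ g] bexI[OF _ r] bexI[OF _ s] conjI rf gs gf)
qed

text \<open>Insert \<open>1 = f r + s g\<close> next to \<open>\<sigma>(x)\<close>, move \<open>f\<close> and \<open>g\<close> through the action and rotate them under the
trace.\<close>

lemma mtrace_split_exact:
  assumes M: "is_module \<rho>" "is_module \<sigma>" "is_module \<tau>" and ex: "split_exact \<rho> \<sigma> \<tau>"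
  shows "mtrace (\<sigma> x) = mtrace (\<rho> x) + mtrace (\<tau> x)"
proof -
  obtain f g r s where f: "f \<in> intertwiners \<rho> \<sigma>" and g: "g \<in> intertwiners \<sigma> \<tau>"
    and r: "r \<in> carrier_mat (module_dim \<rho>) (module_dim \<sigma>)" and s: "s \<in> carrier_mat (module_dim \<sigma>) (module_dim \<tau>)"
    and eqs: "r * f = 1\<^sub>m (module_dim \<rho>)" "g * s = 1\<^sub>m (module_dim \<tau>)"
       "f * r + s * g = 1\<^sub>m (module_dim \<sigma>)"
    using ex unfolding split_exact_def by blast
  note fc = intertwinersD(1)[OF f] and gc = intertwinersD(1)[OF g]
    and \<rho>c = moduleD(1)[OF M(1), of x] and \<sigma>c = moduleD(1)[OF M(2), of x] and \<tau>c = moduleD(1)[OF M(3), of x]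
  have "\<sigma> x = \<sigma> x * (f * r) + \<sigma> x * (s * g)"
    unfolding mult_add_distrib_mat[OF \<sigma>c mult_carrier_mat[OF fc r] mult_carrier_mat[OF s gc], symmetric] eqs(3)
    using \<sigma>c by simp
  then have "mtrace (\<sigma> x) = mtrace (\<sigma> x * (f * r)) + mtrace (\<sigma> x * (s * g))"
    using mtrace_add[of "\<sigma> x * (f * r)" "module_dim \<sigma>" "\<sigma> x * (s * g)"] \<sigma>c fc gc r s by simp
  also have "\<sigma> x * (f * r) = f * (\<rho> x * r)"
    unfolding assoc_mult_mat[OF \<sigma>c fc r, symmetric] intertwinersD(2)[OF f, symmetric] assoc_mult_mat[OF fc \<rho>c r] ..
  also have "mtrace (f * (\<rho> x * r)) = mtrace (\<rho> x * (r * f))"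
    unfolding mtrace_mult_commute[OF fc mult_carrier_mat[OF \<rho>c r]] assoc_mult_mat[OF \<rho>c r fc] ..
  also have "\<rho> x * (r * f) = \<rho> x" unfolding eqs(1) by (rule right_mult_one_mat[OF \<rho>c])
  also have "mtrace (\<sigma> x * (s * g)) = mtrace (g * (\<sigma> x * s))"
    unfolding assoc_mult_mat[OF \<sigma>c s gc, symmetric]
    by (rule mtrace_mult_commute[OF mult_carrier_mat[OF \<sigma>c s] gc])
  also have "g * (\<sigma> x * s) = \<tau> x * (g * s)"
    unfolding assoc_mult_mat[OF gc \<sigma>c s, symmetric] intertwinersD(2)[OF g] assoc_mult_mat[OF \<tau>c gc s] ..
  also have "\<tau> x * (g * s) = \<tau> x" unfolding eqs(2) by (rule right_mult_one_mat[OF \<tau>c])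
  finally show ?thesis .
qed

lemma split_exact_tensor:
  assumes M: "is_module \<rho>" "is_module \<sigma>" "is_module \<tau>" "is_module \<upsilon>" and ex: "split_exact \<rho> \<sigma> \<tau>"
  shows "split_exact (tensor_module \<upsilon> \<rho>) (tensor_module \<upsilon> \<sigma>) (tensor_module \<upsilon> \<tau>)"
    "split_exact (tensor_module \<rho> \<upsilon>) (tensor_module \<sigma> \<upsilon>) (tensor_module \<tau> \<upsilon>)"
proof -
  let ?n = "module_dim \<upsilon>"
  let ?I = "1\<^sub>m ?n :: 'k mat"
  obtain f g r s where f: "f \<in> intertwiners \<rho> \<sigma>" and g: "g \<in> intertwiners \<sigma> \<tau>"
    and r: "r \<in> carrier_mat (module_dim \<rho>) (module_dim \<sigma>)" and s: "s \<in> carrier_mat (module_dim \<sigma>) (module_dim \<tau>)"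
    and eqs: "r * f = 1\<^sub>m (module_dim \<rho>)" "g * s = 1\<^sub>m (module_dim \<tau>)"
       "f * r + s * g = 1\<^sub>m (module_dim \<sigma>)" "g * f = 0\<^sub>m (module_dim \<tau>) (module_dim \<rho>)"
    using ex unfolding split_exact_def by blast
  note fc = intertwinersD(1)[OF f] and gc = intertwinersD(1)[OF g]
  have I: "?I \<in> carrier_mat ?n ?n" "?I * ?I = ?I" by simp_all
  note frc = mult_carrier_mat[OF fc r] and sgc = mult_carrier_mat[OF s gc]
  note one = one_intertwiner[OF M(4)]
  show "split_exact (tensor_module \<upsilon> \<rho>) (tensor_module \<upsilon> \<sigma>) (tensor_module \<upsilon> \<tau>)"
    unfolding split_exact_def module_dim_tensor
  proof (intro bexI conjI)
    show "kron ?I r * kron ?I f = 1\<^sub>m (?n * module_dim \<rho>)"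
      by (simp only: kron_mult[OF I(1) I(1) r fc] eqs I(2) kron_one)
    show "kron ?I g * kron ?I s = 1\<^sub>m (?n * module_dim \<tau>)"
      by (simp only: kron_mult[OF I(1) I(1) gc s] eqs I(2) kron_one)
    show "kron ?I f * kron ?I r + kron ?I s * kron ?I g = 1\<^sub>m (?n * module_dim \<sigma>)"
      by (simp only: kron_mult[OF I(1) I(1) fc r] kron_mult[OF I(1) I(1) s gc] I(2)
          kron_add(2)[OF frc sgc I(1), symmetric] eqs kron_one)
    show "kron ?I g * kron ?I f = 0\<^sub>m (?n * module_dim \<tau>) (?n * module_dim \<rho>)"
      by (simp only: kron_mult[OF I(1) I(1) gc fc] eqs I(2) kron_zero(2)[OF I(1)])
    show "kron ?I r \<in> carrier_mat (?n * module_dim \<rho>) (?n * module_dim \<sigma>)"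
      "kron ?I s \<in> carrier_mat (?n * module_dim \<sigma>) (?n * module_dim \<tau>)"
      by (rule kron_carrier[OF I(1) r] kron_carrier[OF I(1) s])+
    show "kron ?I f \<in> intertwiners (tensor_module \<upsilon> \<rho>) (tensor_module \<upsilon> \<sigma>)"
      by (rule kron_intertwiner[OF M(4,4,1,2) one f])
    show "kron ?I g \<in> intertwiners (tensor_module \<upsilon> \<sigma>) (tensor_module \<upsilon> \<tau>)"
      by (rule kron_intertwiner[OF M(4,4,2,3) one g])
  qed
  show "split_exact (tensor_module \<rho> \<upsilon>) (tensor_module \<sigma> \<upsilon>) (tensor_module \<tau> \<upsilon>)"
    unfolding split_exact_def module_dim_tensor
  proof (intro bexI conjI)
    show "kron r ?I * kron f ?I = 1\<^sub>m (module_dim \<rho> * ?n)"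
      by (simp only: kron_mult[OF r fc I(1) I(1)] eqs I(2) kron_one)
    show "kron g ?I * kron s ?I = 1\<^sub>m (module_dim \<tau> * ?n)"
      by (simp only: kron_mult[OF gc s I(1) I(1)] eqs I(2) kron_one)
    show "kron f ?I * kron r ?I + kron s ?I * kron g ?I = 1\<^sub>m (module_dim \<sigma> * ?n)"
      by (simp only: kron_mult[OF fc r I(1) I(1)] kron_mult[OF s gc I(1) I(1)] I(2)
          kron_add(1)[OF frc sgc I(1), symmetric] eqs kron_one)
    show "kron g ?I * kron f ?I = 0\<^sub>m (module_dim \<tau> * ?n) (module_dim \<rho> * ?n)"
      by (simp only: kron_mult[OF gc fc I(1) I(1)] eqs I(2) kron_zero(1)[OF I(1)])
    show "kron r ?I \<in> carrier_mat (module_dim \<rho> * ?n) (module_dim \<sigma> * ?n)"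
      "kron s ?I \<in> carrier_mat (module_dim \<sigma> * ?n) (module_dim \<tau> * ?n)"
      by (rule kron_carrier[OF r I(1)] kron_carrier[OF s I(1)])+
    show "kron f ?I \<in> intertwiners (tensor_module \<rho> \<upsilon>) (tensor_module \<sigma> \<upsilon>)"
      by (rule kron_intertwiner[OF M(1,2,4,4) f one])
    show "kron g ?I \<in> intertwiners (tensor_module \<sigma> \<upsilon>) (tensor_module \<tau> \<upsilon>)"
      by (rule kron_intertwiner[OF M(2,3,4,4) g one])
  qed
qed

section \<open>Characters on the representation algebra\<close>

text \<open>Tensoring with a module preserves exact sequences, so the product of a relation with a class is again
a relation.\<close>

lemma presented_ring_grothendieck: "presented_ring iso_class_monoid grothendieck_relations"
proof -
  let ?M = iso_class_monoid
  note M = monoid_iso_class_monoid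
  have RelI: "frag_of (iso_class \<sigma>) - frag_of (iso_class \<rho>) - frag_of (iso_class \<tau>) \<in> grothendieck_relations"
    if "is_module \<rho>" "is_module \<sigma>" "is_module \<tau>" "split_exact \<rho> \<sigma> \<tau>" for \<rho> \<sigma> \<tau>
    using that split_exact_imp_short_exact unfolding grothendieck_relations_def by blast
  have cases: thesis
    if "r \<in> grothendieck_relations"
      "\<And>\<rho> \<sigma> \<tau>. r = frag_of (iso_class \<sigma>) - frag_of (iso_class \<rho>) - frag_of (iso_class \<tau>) \<Longrightarrow>
        is_module \<rho> \<Longrightarrow> is_module \<sigma> \<Longrightarrow> is_module \<tau> \<Longrightarrow> split_exact \<rho> \<sigma> \<tau> \<Longrightarrow> thesis" for r thesis
    using that short_exact_imp_split_exact unfolding grothendieck_relations_def by blast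
  show ?thesis
  proof (rule presented_ring.intro)
    show "Group.monoid ?M" by (rule M)
    show "grothendieck_relations \<subseteq> carrier (monoid_ring ?M)"
    proof
      fix r assume "r \<in> grothendieck_relations"
      then show "r \<in> carrier (monoid_ring ?M)"
        by (rule cases) (simp add: carrier_monoid_ring[OF M] keys_diff_subset carrier_iso_class_monoid)
    qed
  next
    fix C r assume C: "C \<in> carrier ?M" and r: "r \<in> grothendieck_relations"
    obtain \<upsilon> where u: "C = iso_class \<upsilon>" "is_module \<upsilon>" using C by (auto simp: carrier_iso_class_monoid)
    show "frag_of C \<otimes>\<^bsub>monoid_ring ?M\<^esub> r \<in> generate (free_Abelian_group (carrier ?M)) grothendieck_relations"
      by (rule cases[OF r], rule generate.incl)
         (simp add: u monoid_ring_bilinear[OF M] iso_class_mult RelI is_module_tensor split_exact_tensor)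
    show "r \<otimes>\<^bsub>monoid_ring ?M\<^esub> frag_of C \<in> generate (free_Abelian_group (carrier ?M)) grothendieck_relations"
      by (rule cases[OF r], rule generate.incl)
         (simp add: u monoid_ring_bilinear[OF M] iso_class_mult RelI is_module_tensor split_exact_tensor)
  qed
qed

sublocale G: presented_ring iso_class_monoid grothendieck_relations
  by (rule presented_ring_grothendieck)

lemma ring_grothendieck: "ring grothendieck_ring"
  unfolding grothendieck_ring_def by (rule G.ring_quotient)

sublocale T: presented_ring "grothendieck_ring \<times>\<times> (ring_of_type_algebra :: 'k ring)"
    "int_tensor_relations grothendieck_ring (ring_of_type_algebra :: 'k ring)"
  by (rule presented_ring_int_tensor[OF ring_grothendieck ring_ring_of_type_algebra])

lemma representation_algebra_eq: "representation_algebra = T.quotient_ring"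
  by (simp add: representation_algebra_def int_tensor_ring_def)

definition is_trace_functional :: "('h \<Rightarrow> 'k) \<Rightarrow> bool" where
  "is_trace_functional f \<longleftrightarrow> lin f \<and> (\<forall>x y. f (x * y) = f (y * x))"

lemma is_trace_functional_mtrace:
  assumes "is_module \<rho>"
  shows "is_trace_functional (\<lambda>x. mtrace (\<rho> x))"
  unfolding is_trace_functional_def
proof (intro conjI allI linI)
  note M = moduleD(1)[OF assms]
  show "mtrace (\<rho> (x + y)) = mtrace (\<rho> x) + mtrace (\<rho> y)" for x y
    unfolding moduleD(2)[OF assms] by (rule mtrace_add[OF M M])
  show "mtrace (\<rho> (scale c x)) = c * mtrace (\<rho> x)" for c x
    unfolding moduleD(3)[OF assms] by (rule mtrace_smult[OF M])
  show "mtrace (\<rho> (x * y)) = mtrace (\<rho> (y * x))" for x y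
    unfolding moduleD(4)[OF assms] by (rule mtrace_mult_commute[OF M M])
qed

lemma is_trace_functional_smult: "is_trace_functional f \<Longrightarrow> is_trace_functional (\<lambda>x. c * f x)"
  unfolding is_trace_functional_def by (auto simp: lin_add lin_scale algebra_simps intro!: linI)

lemma is_trace_functional_frag_eval:
  assumes "\<And>a. a \<in> Poly_Mapping.keys z \<Longrightarrow> is_trace_functional (F a)"
  shows "is_trace_functional (\<lambda>x. frag_eval (\<lambda>a. F a x) z)"
  unfolding is_trace_functional_def
proof (intro conjI allI linI)
  have F: "F a (x + y) = F a x + F a y" "F a (scale c x) = c * F a x" "F a (x * y) = F a (y * x)"
    if "a \<in> Poly_Mapping.keys z" for a x y c
    using assms[OF that] by (simp_all add: is_trace_functional_def lin_add lin_scale)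
  show "frag_eval (\<lambda>a. F a (x + y)) z = frag_eval (\<lambda>a. F a x) z + frag_eval (\<lambda>a. F a y) z" for x y
    by (simp add: frag_eval_def F distrib_left sum.distrib)
  show "frag_eval (\<lambda>a. F a (scale c x)) z = c * frag_eval (\<lambda>a. F a x) z" for c x
    by (simp add: frag_eval_def F sum_distrib_left mult.left_commute)
  show "frag_eval (\<lambda>a. F a (x * y)) z = frag_eval (\<lambda>a. F a (y * x)) z" for x y
    by (rule frag_eval_cong) (rule F)
qed

definition class_character :: "'h \<Rightarrow> ('h \<Rightarrow> 'k mat) set \<Rightarrow> 'k" where
  "class_character x C = mtrace ((SOME \<rho>. \<rho> \<in> C) x)"

lemma class_character_iso_class:
  assumes "is_module \<rho>"
  shows "class_character x (iso_class \<rho>) = mtrace (\<rho> x)"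
proof -
  have "\<rho> \<in> iso_class \<rho>" using assms by (simp add: iso_class_eq module_iso_refl)
  then have "(SOME \<sigma>. \<sigma> \<in> iso_class \<rho>) \<in> iso_class \<rho>"
    by (rule someI[of "\<lambda>\<sigma>. \<sigma> \<in> iso_class \<rho>"])
  then have "module_iso \<rho> (SOME \<sigma>. \<sigma> \<in> iso_class \<rho>)" using assms by (simp add: iso_class_eq)
  then show ?thesis by (simp add: class_character_def mtrace_module_iso)
qed

lemma class_character_relations:
  assumes "r \<in> grothendieck_relations"
  shows "frag_eval (class_character x) r = 0"
proof -
  obtain \<rho> \<sigma> \<tau> where r: "r = frag_of (iso_class \<sigma>) - frag_of (iso_class \<rho>) - frag_of (iso_class \<tau>)"
    and M: "is_module \<rho>" "is_module \<sigma>" "is_module \<tau>" and ex: "short_exact \<rho> \<sigma> \<tau>"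
    using assms unfolding grothendieck_relations_def by blast
  show ?thesis
    using mtrace_split_exact[OF M short_exact_imp_split_exact[OF ex], of x] M
    by (simp add: r frag_eval_diff class_character_iso_class)
qed

definition grothendieck_character :: "'h \<Rightarrow> (('h \<Rightarrow> 'k mat) set \<Rightarrow>\<^sub>0 int) set \<Rightarrow> 'k" where
  "grothendieck_character x = coset_eval (class_character x)"

lemma grothendieck_character_cls: "grothendieck_character x (G.cls z) = frag_eval (class_character x) z"
  unfolding grothendieck_character_def by (rule G.coset_eval_cls) (rule class_character_relations)

lemma grothendieck_character_add:
  assumes "C \<in> carrier grothendieck_ring" "D \<in> carrier grothendieck_ring"
  shows "grothendieck_character x (C \<oplus>\<^bsub>grothendieck_ring\<^esub> D) = grothendieck_character x C + grothendieck_character x D"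
  using assms unfolding grothendieck_character_def grothendieck_ring_def
  by (rule G.coset_eval_add[rotated]) (rule class_character_relations)

lemma grothendieck_character_mult:
  assumes "C \<in> carrier grothendieck_ring" "D \<in> carrier grothendieck_ring"
  shows "grothendieck_character x (C \<otimes>\<^bsub>grothendieck_ring\<^esub> D) =
    sweedler (\<lambda>a b. grothendieck_character a C * grothendieck_character b D) x"
proof -
  have "coset_eval (class_character x) (C \<otimes>\<^bsub>grothendieck_ring\<^esub> D) =
    (\<Sum>t\<leftarrow>comult x. coset_eval (class_character (fst t)) C * coset_eval (class_character (snd t)) D)"
    unfolding grothendieck_ring_def
  proof (rule G.coset_eval_mult)
    fix c d assume "c \<in> carrier iso_class_monoid" "d \<in> carrier iso_class_monoid"
    then obtain \<rho> \<sigma> where "c = iso_class \<rho>" "is_module \<rho>" "d = iso_class \<sigma>" "is_module \<sigma>"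
      by (auto simp: carrier_iso_class_monoid)
    then show "class_character x (c \<otimes>\<^bsub>iso_class_monoid\<^esub> d) =
        (\<Sum>t\<leftarrow>comult x. class_character (fst t) c * class_character (snd t) d)"
      by (simp add: iso_class_mult class_character_iso_class is_module_tensor mtrace_tensor
          sweedler_def split_def)
  qed (use assms class_character_relations in \<open>simp_all add: grothendieck_ring_def\<close>)
  then show ?thesis
    by (simp add: grothendieck_character_def sweedler_def split_def)
qed

lemma grothendieck_character_trace:
  assumes "C \<in> carrier grothendieck_ring"
  shows "is_trace_functional (\<lambda>x. grothendieck_character x C)"
proof -
  obtain z where z: "Poly_Mapping.keys z \<subseteq> carrier iso_class_monoid" "C = G.cls z"
    using assms by (auto simp: grothendieck_ring_def G.carrier_quotient)
  have "is_trace_functional (\<lambda>x. class_character x c)" if c: "c \<in> Poly_Mapping.keys z" for c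
  proof -
    obtain \<rho> where "c = iso_class \<rho>" "is_module \<rho>"
      using c z(1) by (auto simp: carrier_iso_class_monoid)
    then show ?thesis by (simp add: class_character_iso_class is_trace_functional_mtrace)
  qed
  then show ?thesis
    unfolding z(2) grothendieck_character_cls by (rule is_trace_functional_frag_eval)
qed

lemma grothendieck_character_one: "grothendieck_character x \<one>\<^bsub>grothendieck_ring\<^esub> = counit x"
  by (simp add: grothendieck_ring_def G.cls_one grothendieck_character_cls one_iso_class_monoid
      class_character_iso_class is_module_trivial mtrace_trivial)

text \<open>The functional attached to a pure tensor, \<open>[V] \<otimes> c \<mapsto> c \<chi>\<^sub>V\<close>.\<close>

definition pure_character :: "'h \<Rightarrow> (('h \<Rightarrow> 'k mat) set \<Rightarrow>\<^sub>0 int) set \<times> 'k \<Rightarrow> 'k" where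
  "pure_character x p = snd p * grothendieck_character x (fst p)"

lemma pure_character_relations:
  assumes "r \<in> int_tensor_relations grothendieck_ring (ring_of_type_algebra :: 'k ring)"
  shows "frag_eval (pure_character x) r = 0"
proof -
  consider (left) C D c where "r = frag_of (C \<oplus>\<^bsub>grothendieck_ring\<^esub> D, c) - frag_of (C, c) - frag_of (D, c)"
      "C \<in> carrier grothendieck_ring" "D \<in> carrier grothendieck_ring"
    | (right) C c d where "r = frag_of (C, c + d) - frag_of (C, c) - frag_of (C, d)"
    using assms unfolding int_tensor_relations_def ring_of_type_algebra_def by auto
  then show ?thesis
  proof cases
    case left
    then show ?thesis
      unfolding left(1) by (simp add: frag_eval_diff pure_character_def grothendieck_character_add distrib_left)
  next
    case right
    show ?thesis
      unfolding right by (simp add: frag_eval_diff pure_character_def distrib_right)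
  qed
qed

text \<open>The map from \<open>R(H)\<close> to the dual algebra of \<open>H\<close>.\<close>

definition character_of :: "((('h \<Rightarrow> 'k mat) set \<Rightarrow>\<^sub>0 int) set \<times> 'k \<Rightarrow>\<^sub>0 int) set \<Rightarrow> 'h \<Rightarrow> 'k" where
  "character_of C x = coset_eval (pure_character x) C"

lemma character_of_cls: "character_of (T.cls z) x = frag_eval (pure_character x) z"
  unfolding character_of_def by (rule T.coset_eval_cls) (rule pure_character_relations)

lemma character_of_add:
  assumes "C \<in> carrier representation_algebra" "D \<in> carrier representation_algebra"
  shows "character_of (C \<oplus>\<^bsub>representation_algebra\<^esub> D) x = character_of C x + character_of D x"
  using assms unfolding character_of_def representation_algebra_eq
  by (rule T.coset_eval_add[rotated]) (rule pure_character_relations)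

lemma character_of_mult:
  assumes "C \<in> carrier representation_algebra" "D \<in> carrier representation_algebra"
  shows "character_of (C \<otimes>\<^bsub>representation_algebra\<^esub> D) x =
    sweedler (\<lambda>a b. character_of C a * character_of D b) x"
proof -
  have "coset_eval (pure_character x) (C \<otimes>\<^bsub>representation_algebra\<^esub> D) =
    (\<Sum>t\<leftarrow>comult x. coset_eval (pure_character (fst t)) C * coset_eval (pure_character (snd t)) D)"
    unfolding representation_algebra_eq
  proof (rule T.coset_eval_mult)
    fix p q
    assume pq: "p \<in> carrier (grothendieck_ring \<times>\<times> (ring_of_type_algebra :: 'k ring))"
      "q \<in> carrier (grothendieck_ring \<times>\<times> (ring_of_type_algebra :: 'k ring))"
    obtain C' c D' d where CD: "p = (C', c)" "q = (D', d)"
      "C' \<in> carrier grothendieck_ring" "D' \<in> carrier grothendieck_ring" using pq by auto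
    have "pure_character x (p \<otimes>\<^bsub>grothendieck_ring \<times>\<times> (ring_of_type_algebra :: 'k ring)\<^esub> q) =
        (c * d) * sweedler (\<lambda>a b. grothendieck_character a C' * grothendieck_character b D') x"
      using CD by (simp add: pure_character_def grothendieck_character_mult ring_of_type_algebra_def)
    also have "\<dots> = sweedler (\<lambda>a b. pure_character a p * pure_character b q) x"
      by (simp add: sweedler_mult_left CD(1,2) pure_character_def mult_ac)
    finally show "pure_character x (p \<otimes>\<^bsub>grothendieck_ring \<times>\<times> (ring_of_type_algebra :: 'k ring)\<^esub> q) =
        (\<Sum>t\<leftarrow>comult x. pure_character (fst t) p * pure_character (snd t) q)"
      by (simp add: sweedler_def split_def)
  qed (use assms pure_character_relations in \<open>simp_all add: representation_algebra_eq\<close>)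
  then show ?thesis
    by (simp add: character_of_def sweedler_def split_def)
qed

lemma is_trace_functional_character_of:
  assumes "C \<in> carrier representation_algebra"
  shows "is_trace_functional (character_of C)"
proof -
  obtain z where z: "Poly_Mapping.keys z \<subseteq> carrier (grothendieck_ring \<times>\<times> (ring_of_type_algebra :: 'k ring))"
    "C = T.cls z"
    using assms unfolding representation_algebra_eq T.carrier_quotient by blast
  have "is_trace_functional (\<lambda>x. pure_character x p)" if p: "p \<in> Poly_Mapping.keys z" for p
  proof -
    have "fst p \<in> carrier grothendieck_ring" using subsetD[OF z(1) p] by auto
    from is_trace_functional_smult[OF grothendieck_character_trace[OF this]] show ?thesis
      unfolding pure_character_def .
  qed
  then have "is_trace_functional (\<lambda>x. frag_eval (\<lambda>p. pure_character x p) z)"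
    by (rule is_trace_functional_frag_eval)
  moreover have "character_of C = (\<lambda>x. frag_eval (\<lambda>p. pure_character x p) z)"
    unfolding z(2) by (rule ext) (rule character_of_cls)
  ultimately show ?thesis by simp
qed

definition scaled_class :: "'k \<Rightarrow> ('h \<Rightarrow> 'k mat) \<Rightarrow> ((('h \<Rightarrow> 'k mat) set \<Rightarrow>\<^sub>0 int) set \<times> 'k \<Rightarrow>\<^sub>0 int) set" where
  "scaled_class c \<rho> = T.cls (frag_of (G.cls (frag_of (iso_class \<rho>)), c))"

lemma scaled_class_in_carrier:
  assumes "is_module \<rho>"
  shows "scaled_class c \<rho> \<in> carrier representation_algebra"
proof -
  have "G.cls (frag_of (iso_class \<rho>)) \<in> carrier grothendieck_ring"
    unfolding grothendieck_ring_def by (rule G.cls_in_carrier) (use assms in \<open>simp add: carrier_iso_class_monoid\<close>)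
  then show ?thesis
    unfolding scaled_class_def representation_algebra_eq
    by (intro T.cls_in_carrier) (simp add: ring_of_type_algebra_def)
qed

lemma character_of_scaled_class:
  assumes "is_module \<rho>"
  shows "character_of (scaled_class c \<rho>) x = c * mtrace (\<rho> x)"
  using assms
  by (simp add: scaled_class_def character_of_cls pure_character_def grothendieck_character_cls class_character_iso_class)

text \<open>The classes \<open>[V] \<otimes> 1\<close> and \<open>[k] \<otimes> \<chi>\<^sub>V(g)\<close>, with \<open>k\<close> the trivial module, have the same value at \<open>g\<close>, so they
act alike on the eigenvector. In the dual algebra the second class is a multiple of the counit,
which is the unit for convolution.\<close>

theorem ex_eigenfunctional:
  assumes ss: "semisimple_ring representation_algebra" and g: "group_like g"
  obtains f where "is_trace_functional f" "f g = 1"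
    "\<And>\<rho> x. is_module \<rho> \<Longrightarrow> sweedler (\<lambda>a b. mtrace (\<rho> a) * f b) x = mtrace (\<rho> g) * f x"
proof -
  interpret R: ring representation_algebra
    unfolding representation_algebra_eq by (rule T.ring_quotient)
  note tf = is_trace_functional_character_of[unfolded is_trace_functional_def]
  have mult: "character_of (C \<otimes>\<^bsub>representation_algebra\<^esub> D) g = character_of C g * character_of D g"
    if "C \<in> carrier representation_algebra" "D \<in> carrier representation_algebra" for C D
  proof -
    have "balanced2 scale (\<lambda>a b. character_of C a * character_of D b)"
      using that[THEN tf]
      by (simp add: balanced2_def lin_add lin_scale algebra_simps)
    from sweedler_group_like[OF g this] show ?thesis by (simp add: character_of_mult[OF that])
  qed
  have one: "character_of \<one>\<^bsub>representation_algebra\<^esub> g = 1"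
    unfolding representation_algebra_eq T.cls_one character_of_cls frag_eval_of pure_character_def
    by (simp add: grothendieck_character_one counit_group_like[OF g] ring_of_type_algebra_def)
  have "(\<lambda>C. character_of C g) \<in> ring_hom representation_algebra (ring_of_type_algebra :: 'k ring)"
    by (rule ring_hom_memI) (simp_all add: mult one character_of_add ring_of_type_algebra_def)
  from R.eigenvector_of_character_if_semisimple[OF ring_ring_of_type_algebra this ss]
  obtain j where j: "j \<in> carrier representation_algebra" "character_of j g = 1"
    "\<And>x y. x \<in> carrier representation_algebra \<Longrightarrow> y \<in> carrier representation_algebra \<Longrightarrow>
       character_of x g = character_of y g \<Longrightarrow>
       x \<otimes>\<^bsub>representation_algebra\<^esub> j = y \<otimes>\<^bsub>representation_algebra\<^esub> j"
    by (auto simp: ring_of_type_algebra_def)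
  show thesis
  proof (rule that[of "character_of j"])
    show "is_trace_functional (character_of j)" by (rule is_trace_functional_character_of[OF j(1)])
    show "character_of j g = 1" by (rule j(2))
    fix \<rho> x assume \<rho>: "is_module \<rho>"
    have "scaled_class 1 \<rho> \<otimes>\<^bsub>representation_algebra\<^esub> j =
        scaled_class (mtrace (\<rho> g)) trivial_module \<otimes>\<^bsub>representation_algebra\<^esub> j"
      by (rule j(3)) (simp_all add: scaled_class_in_carrier character_of_scaled_class \<rho> is_module_trivial
          mtrace_trivial counit_group_like[OF g])
    from arg_cong[OF this, of "\<lambda>C. character_of C x"]
    have "sweedler (\<lambda>a b. mtrace (\<rho> a) * character_of j b) x =
        sweedler (\<lambda>a b. mtrace (\<rho> g) * counit a * character_of j b) x"
      by (simp add: character_of_mult scaled_class_in_carrier character_of_scaled_class \<rho> is_module_trivial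
          mtrace_trivial j(1))
    also have "\<dots> = mtrace (\<rho> g) * sweedler (\<lambda>a b. character_of j (scale (counit a) b)) x"
      using tf[OF j(1)] by (simp add: sweedler_mult_left lin_scale mult.assoc)
    also have "sweedler (\<lambda>a b. character_of j (scale (counit a) b)) x = character_of j x"
      using sweedler_additive[where A = "character_of j" and G = "\<lambda>a b. scale (counit a) b" and x = x]
        tf[OF j(1)] by (simp add: lin_add sweedler_counit)
    finally show "sweedler (\<lambda>a b. mtrace (\<rho> a) * character_of j b) x = mtrace (\<rho> g) * character_of j x" .
  qed
qed

section \<open>Left ideals and the span of the characters\<close>

context
  fixes W V :: "'h set" and n :: nat and w :: "nat \<Rightarrow> 'h"
  assumes W: "independent W" "span W = V" and w: "bij_betw w {..<n} W"
begin

definition basis_coord :: "nat \<Rightarrow> 'h \<Rightarrow> 'k" where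
  "basis_coord i v = representation W v (w i)"

definition basis_comb :: "'k vec \<Rightarrow> 'h" where
  "basis_comb v = (\<Sum>i<n. scale (v $ i) (w i))"

definition basis_mat :: "('h \<Rightarrow> 'h) \<Rightarrow> 'k mat" where
  "basis_mat f = mat n n (\<lambda>(i, j). basis_coord i (f (w j)))"

lemma basis_mem: "i < n \<Longrightarrow> w i \<in> W" "i < n \<Longrightarrow> w i \<in> V"
proof -
  assume "i < n"
  then show "w i \<in> W" using bij_betwE[OF w] by auto
  then show "w i \<in> V" using span_base W(2) by blast
qed

lemma basis_coord_add: "u \<in> V \<Longrightarrow> v \<in> V \<Longrightarrow> basis_coord i (u + v) = basis_coord i u + basis_coord i v"
  using representation_add[OF W(1), of v u] by (simp add: basis_coord_def W(2))

lemma basis_coord_scale: "v \<in> V \<Longrightarrow> basis_coord i (scale c v) = c * basis_coord i v"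
  using representation_scale[OF W(1), of v c] by (simp add: basis_coord_def W(2))

lemma basis_coord_sum:
  assumes "\<And>t. t \<in> T \<Longrightarrow> G t \<in> V"
  shows "basis_coord i (\<Sum>t\<in>T. G t) = (\<Sum>t\<in>T. basis_coord i (G t))"
  using representation_sum[OF W(1), of T G] assms by (simp add: basis_coord_def W(2))

lemma basis_coord_basis: "i < n \<Longrightarrow> j < n \<Longrightarrow> basis_coord i (w j) = (if i = j then 1 else 0)"
  using representation_basis[OF W(1) basis_mem(1)[of j]] bij_betw_imp_inj_on[OF w]
  by (auto simp: basis_coord_def inj_on_eq_iff)

lemma basis_expansion:
  assumes "v \<in> V"
  shows "(\<Sum>i<n. scale (basis_coord i v) (w i)) = v"
proof -
  have "finite W" using bij_betw_finite[OF w] by simp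
  have "(\<Sum>i<n. scale (basis_coord i v) (w i)) = (\<Sum>b\<in>W. scale (representation W v b) b)"
    unfolding basis_coord_def by (rule sum.reindex_bij_betw[OF w])
  also have "\<dots> = v"
    by (rule sum_representation_eq) (use assms W \<open>finite W\<close> in auto)
  finally show ?thesis .
qed

lemma subspace_V: "0 \<in> V" "u \<in> V \<Longrightarrow> v \<in> V \<Longrightarrow> u + v \<in> V" "v \<in> V \<Longrightarrow> scale c v \<in> V"
  "(\<And>t. t \<in> T \<Longrightarrow> G t \<in> V) \<Longrightarrow> (\<Sum>t\<in>T. G t) \<in> V"
  unfolding W(2)[symmetric] by (auto intro: span_zero span_add span_scale span_sum)

lemma basis_comb_mem: "basis_comb v \<in> V"
  unfolding basis_comb_def by (intro subspace_V basis_mem) simp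

lemma basis_coord_comb: "i < n \<Longrightarrow> basis_coord i (basis_comb v) = v $ i"
  unfolding basis_comb_def
  by (subst basis_coord_sum) (simp_all add: subspace_V basis_mem basis_coord_scale basis_coord_basis if_distrib
      cong: if_cong)

lemma basis_comb_coord: "v \<in> V \<Longrightarrow> basis_comb (vec n (\<lambda>i. basis_coord i v)) = v"
  by (simp add: basis_comb_def basis_expansion)

definition endo_on :: "('h \<Rightarrow> 'h) \<Rightarrow> bool" where
  "endo_on f \<longleftrightarrow> (\<forall>u v. f (u + v) = f u + f v) \<and> (\<forall>c v. f (scale c v) = scale c (f v)) \<and> (\<forall>v\<in>V. f v \<in> V)"

lemma endo_on_sum:
  assumes "endo_on f"
  shows "f (\<Sum>t\<in>T. scale (c t) (G t)) = (\<Sum>t\<in>T. scale (c t) (f (G t)))"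
  using assms by (subst additive_zero_sum(2)[of f]) (simp_all add: endo_on_def)

lemma basis_mat_carrier: "basis_mat f \<in> carrier_mat n n"
  by (simp add: basis_mat_def)

lemma basis_mat_mult:
  assumes f: "endo_on f" and g: "endo_on g"
  shows "basis_mat f * basis_mat g = basis_mat (\<lambda>v. f (g v))"
proof (rule eq_matI)
  fix i j assume "i < dim_row (basis_mat (\<lambda>v. f (g v)))" "j < dim_col (basis_mat (\<lambda>v. f (g v)))"
  then have ij: "i < n" "j < n" by (simp_all add: basis_mat_def)
  have fV: "f v \<in> V" and gV: "g v \<in> V" if "v \<in> V" for v
    using f g that by (simp_all add: endo_on_def)
  have "f (g (w j)) = f (\<Sum>k<n. scale (basis_coord k (g (w j))) (w k))"
    using basis_expansion[OF gV[OF basis_mem(2)[OF ij(2)]]] by simp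
  also have "\<dots> = (\<Sum>k<n. scale (basis_coord k (g (w j))) (f (w k)))"
    by (rule endo_on_sum[OF f])
  also have "basis_coord i \<dots> = (\<Sum>k<n. basis_coord k (g (w j)) * basis_coord i (f (w k)))"
    by (subst basis_coord_sum) (simp_all add: subspace_V basis_mem fV basis_coord_scale)
  finally have "basis_mat (\<lambda>v. f (g v)) $$ (i, j) = (\<Sum>k<n. basis_coord i (f (w k)) * basis_coord k (g (w j)))"
    using ij by (simp add: basis_mat_def mult.commute)
  then show "(basis_mat f * basis_mat g) $$ (i, j) = basis_mat (\<lambda>v. f (g v)) $$ (i, j)"
    using ij by (simp add: mult_mat_entry[OF basis_mat_carrier basis_mat_carrier]) (simp add: basis_mat_def)
qed (simp_all add: basis_mat_def)

lemma basis_comb_mult_vec: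
  assumes f: "endo_on f" and v: "v \<in> carrier_vec n"
  shows "basis_comb (basis_mat f *\<^sub>v v) = f (basis_comb v)"
proof -
  have fV: "f v \<in> V" if "v \<in> V" for v
    using f that by (simp add: endo_on_def)
  have comb: "f (basis_comb v) = (\<Sum>k<n. scale (v $ k) (f (w k)))"
    unfolding basis_comb_def by (rule endo_on_sum[OF f])
  have "basis_coord i (f (basis_comb v)) = (\<Sum>k<n. v $ k * basis_coord i (f (w k)))" for i
    unfolding comb by (subst basis_coord_sum) (simp_all add: subspace_V basis_mem fV basis_coord_scale)
  then have "basis_coord i (f (basis_comb v)) = (basis_mat f *\<^sub>v v) $ i" if "i < n" for i
    using v that by (simp add: basis_mat_def scalar_prod_def mult.commute atLeast0LessThan)
  then have "basis_mat f *\<^sub>v v = vec n (\<lambda>i. basis_coord i (f (basis_comb v)))"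
    by (intro eq_vecI) (simp_all add: basis_mat_def)
  then show ?thesis
    using basis_comb_coord[OF fV[OF basis_comb_mem[of v]]] by simp
qed

context
  fixes e :: 'h
  assumes V_eq: "V = {v. v * e = v}" and idem: "e * e = e"
begin

lemma ideal: "v \<in> V \<Longrightarrow> a * v \<in> V" and e: "e \<in> V" "v \<in> V \<Longrightarrow> v * e = v"
  by (simp_all add: V_eq idem mult.assoc)

definition left_ideal_module :: "'h \<Rightarrow> 'k mat" where
  "left_ideal_module a = basis_mat (\<lambda>v. a * v)"

lemma endo_on_left_mult: "endo_on (\<lambda>v. a * v)"
  by (simp add: endo_on_def distrib_left scale_mult_right ideal)

lemma module_dim_left_ideal: "module_dim left_ideal_module = n"
  by (simp add: module_dim_def left_ideal_module_def basis_mat_def)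

lemma is_module_left_ideal: "is_module left_ideal_module"
  unfolding is_module_def module_dim_left_ideal left_ideal_module_def
proof (intro conjI allI)
  show "basis_mat (\<lambda>v. (x + y) * v) = basis_mat (\<lambda>v. x * v) + basis_mat (\<lambda>v. y * v)" for x y
    by (rule eq_matI) (simp_all add: basis_mat_def distrib_right basis_coord_add ideal basis_mem)
  show "basis_mat (\<lambda>v. scale c x * v) = c \<cdot>\<^sub>m basis_mat (\<lambda>v. x * v)" for c x
    by (rule eq_matI) (simp_all add: basis_mat_def scale_mult_left basis_coord_scale ideal basis_mem)
  show "basis_mat (\<lambda>v. x * y * v) = basis_mat (\<lambda>v. x * v) * basis_mat (\<lambda>v. y * v)" for x y
    by (simp add: basis_mat_mult[OF endo_on_left_mult endo_on_left_mult] mult.assoc)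
  show "basis_mat (\<lambda>v. 1 * v) = 1\<^sub>m n"
    by (rule eq_matI) (simp_all add: basis_mat_def basis_coord_basis)
qed (rule basis_mat_carrier)

text \<open>The map \<open>k \<mapsto> a k e\<close> takes values in \<open>H e\<close> and restricts there to the action of \<open>a\<close>. Its trace on \<open>H\<close> is
therefore the trace of this restriction.\<close>

lemma mtrace_left_ideal_module: "mtrace (left_ideal_module a) = two_sided_trace a e"
proof -
  have mem: "a * k * e \<in> V" for k by (rule ideal[OF e(1)])
  have "endo_trace (\<lambda>k. a * k * e) = endo_trace (\<lambda>k. \<Sum>i<n. scale (basis_coord i (a * k * e)) (w i))"
    by (simp add: basis_expansion[OF mem])
  also have "\<dots> = (\<Sum>i<n. basis_coord i (a * w i * e))"
    unfolding endo_trace_sum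
    by (intro sum.cong refl endo_trace_rank_one linI)
       (simp_all add: distrib_left distrib_right scale_mult_left scale_mult_right basis_coord_add
         basis_coord_scale mem)
  also have "\<dots> = mtrace (left_ideal_module a)"
    by (simp add: mtrace_def left_ideal_module_def basis_mat_def mult.assoc e(2) basis_mem)
  finally show ?thesis by (simp add: two_sided_trace_def)
qed

text \<open>The basis turns invariant subspaces of the column space into left ideals contained in \<open>V\<close>.\<close>

lemma irreducible_left_ideal_module:
  assumes "V \<noteq> {0}"
    and minimal: "\<And>K. \<lbrakk>0 \<in> K; \<And>x y. x \<in> K \<Longrightarrow> y \<in> K \<Longrightarrow> x + y \<in> K; \<And>r x. x \<in> K \<Longrightarrow> r * x \<in> K; K \<subseteq> V\<rbrakk>
      \<Longrightarrow> K = {0} \<or> K = V"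
  shows "irreducible_module left_ideal_module"
  unfolding irreducible_module_def module_dim_left_ideal
proof (intro conjI allI impI)
  show "is_module left_ideal_module" by (rule is_module_left_ideal)
  show "n \<noteq> 0"
  proof
    assume "n = 0"
    then have "v = 0" if "v \<in> V" for v using basis_expansion[OF that] by simp
    then show False using assms(1) subspace_V(1) by blast
  qed
  fix U assume U: "invariant_subspace left_ideal_module U"
  note U' = U[unfolded invariant_subspace_def module_dim_left_ideal]
  have Uc: "v \<in> carrier_vec n" if "v \<in> U" for v using U' that by (auto dest: subsetD)
  have U0: "0\<^sub>v n \<in> U" using U' by simp
  have Uadd: "u + v \<in> U" if "u \<in> U" "v \<in> U" for u v using U' that by simp
  have Uact: "left_ideal_module r *\<^sub>v u \<in> U" if "u \<in> U" for r u using U' that by simp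
  have inj: "u = v" if "basis_comb u = basis_comb v" "u \<in> carrier_vec n" "v \<in> carrier_vec n" for u v
    using that basis_coord_comb[of _ u] basis_coord_comb[of _ v] by (intro eq_vecI) auto
  have zero: "basis_comb (0\<^sub>v n) = 0" by (simp add: basis_comb_def)
  have "basis_comb ` U = {0} \<or> basis_comb ` U = V"
  proof (rule minimal)
    show "0 \<in> basis_comb ` U"
      using imageI[OF U0, of basis_comb] unfolding zero .
    show "basis_comb ` U \<subseteq> V" using basis_comb_mem by blast
    fix x assume "x \<in> basis_comb ` U"
    then obtain u where u: "u \<in> U" "x = basis_comb u" by blast
    have "r * x = basis_comb (left_ideal_module r *\<^sub>v u)" for r
      unfolding left_ideal_module_def u(2) basis_comb_mult_vec[OF endo_on_left_mult Uc[OF u(1)]] ..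
    then show "r * x \<in> basis_comb ` U" for r by (rule image_eqI) (rule Uact[OF u(1)])
    fix y assume "y \<in> basis_comb ` U"
    then obtain v where v: "v \<in> U" "y = basis_comb v" by blast
    have "x + y = basis_comb (u + v)"
      using Uc[OF u(1)] Uc[OF v(1)]
      by (simp add: basis_comb_def u(2) v(2) scale_left_distrib sum.distrib)
    then show "x + y \<in> basis_comb ` U" by (rule image_eqI) (rule Uadd[OF u(1) v(1)])
  qed
  then show "U = {0\<^sub>v n} \<or> U = carrier_vec n"
  proof
    assume K: "basis_comb ` U = {0}"
    have "v = 0\<^sub>v n" if "v \<in> U" for v
    proof (rule inj)
      have "basis_comb v \<in> basis_comb ` U" using that by (rule imageI)
      then show "basis_comb v = basis_comb (0\<^sub>v n)" unfolding K zero by (rule singletonD)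
    qed (use Uc that in auto)
    then show ?thesis using U0 by blast
  next
    assume K: "basis_comb ` U = V"
    have "v \<in> U" if v: "v \<in> carrier_vec n" for v
    proof -
      have "basis_comb v \<in> basis_comb ` U" unfolding K by (rule basis_comb_mem)
      then obtain u where "u \<in> U" "basis_comb v = basis_comb u" by (rule imageE)
      then have "v = u" by (intro inj v Uc)
      then show ?thesis using \<open>u \<in> U\<close> by simp
    qed
    then show ?thesis using Uc by blast
  qed
qed

lemma right_mult_scalar_on_left_ideal:
  assumes scalars: "intertwiners left_ideal_module left_ideal_module = {c \<cdot>\<^sub>m 1\<^sub>m (module_dim left_ideal_module) | c. True}"
    and x: "x \<in> V"
  obtains c where "\<And>v. v \<in> V \<Longrightarrow> v * x = scale c v"
proof -
  have endo: "endo_on (\<lambda>v. v * x)"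
    by (simp add: endo_on_def distrib_right scale_mult_left ideal x)
  have "basis_mat (\<lambda>v. v * x) \<in> intertwiners left_ideal_module left_ideal_module"
    unfolding intertwiners_def module_dim_left_ideal
    by (auto simp: basis_mat_carrier left_ideal_module_def basis_mat_mult endo endo_on_left_mult mult.assoc)
  then obtain c where c: "basis_mat (\<lambda>v. v * x) = c \<cdot>\<^sub>m 1\<^sub>m n"
    unfolding scalars module_dim_left_ideal by blast
  show thesis
  proof (rule that)
    fix v assume v: "v \<in> V"
    let ?u = "vec n (\<lambda>i. basis_coord i v)"
    have "v * x = basis_comb (basis_mat (\<lambda>v. v * x) *\<^sub>v ?u)"
      using basis_comb_mult_vec[OF endo, of ?u] by (simp add: basis_comb_coord[OF v])
    also have "basis_mat (\<lambda>v. v * x) *\<^sub>v ?u = c \<cdot>\<^sub>v ?u"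
      unfolding c by (rule eq_vecI) auto
    also have "basis_comb (c \<cdot>\<^sub>v ?u) = scale c (basis_comb ?u)"
      by (simp add: basis_comb_def scale_sum_right)
    finally show "v * x = scale c v" by (simp add: basis_comb_coord[OF v])
  qed
qed

end

end

inductive_set character_span :: "('h \<Rightarrow> 'k) set" where
  zero: "(\<lambda>a. 0) \<in> character_span"
| add: "\<phi> \<in> character_span \<Longrightarrow> \<psi> \<in> character_span \<Longrightarrow> (\<lambda>a. \<phi> a + \<psi> a) \<in> character_span"
| character: "is_module \<rho> \<Longrightarrow> (\<lambda>a. c * mtrace (\<rho> a)) \<in> character_span"

lemma subspace_range_right_mult: "subspace (range (\<lambda>h. h * y))"
proof (rule subspaceI)
  show "0 \<in> range (\<lambda>h. h * y)" by (rule range_eqI[of _ _ 0]) simp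
  fix u assume "u \<in> range (\<lambda>h. h * y)"
  then obtain a where a: "u = a * y" by (rule rangeE)
  show "scale c u \<in> range (\<lambda>h. h * y)" for c
    by (rule range_eqI[of _ _ "scale c a"]) (simp add: a scale_mult_left)
  fix v assume "v \<in> range (\<lambda>h. h * y)"
  then obtain b where b: "v = b * y" by (rule rangeE)
  show "u + v \<in> range (\<lambda>h. h * y)"
    by (rule range_eqI[of _ _ "a + b"]) (simp add: a b distrib_right)
qed

text \<open>Right multiplication by \<open>x\<close> is an endomorphism of the irreducible module \<open>H e\<close>, so it is a scalar \<open>c\<close> by
splitness. Hence \<open>x = e x = c e\<close>, and \<open>a \<mapsto> T(a, e)\<close> is the character of \<open>H e\<close>.\<close>

lemma two_sided_trace_minimal_left_ideal:
  assumes split: "split_semisimple" and e: "e * e = e" "e \<noteq> 0" and x: "e * x * e = x"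
    and minimal: "\<And>K. \<lbrakk>0 \<in> K; \<And>x y. x \<in> K \<Longrightarrow> y \<in> K \<Longrightarrow> x + y \<in> K; \<And>r x. x \<in> K \<Longrightarrow> r * x \<in> K;
      K \<subseteq> range (\<lambda>h. h * e)\<rbrakk> \<Longrightarrow> K = {0} \<or> K = range (\<lambda>h. h * e)"
  shows "(\<lambda>a. two_sided_trace a x) \<in> character_span"
proof -
  let ?V = "range (\<lambda>h. h * e)"
  have V: "v \<in> ?V \<longleftrightarrow> v * e = v" for v
    using e(1) by (auto simp: mult.assoc intro: range_eqI[of _ _ v])
  have sub: "subspace ?V" by (rule subspace_range_right_mult)
  obtain W where W: "W \<subseteq> ?V" "independent W" "?V \<subseteq> span W"
    using maximal_independent_subset[of ?V] by blast
  have span: "span W = ?V" using W(1,3) span_minimal[OF W(1) sub] by blast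
  obtain w where "bij_betw w {0..<card W} W"
    using ex_bij_betw_nat_finite[OF finite_independent[OF W(2)]] by blast
  then have w: "bij_betw w {..<card W} W" by (simp add: atLeast0LessThan)
  note B = W(2) span w
  have V_eq: "?V = {v. v * e = v}" using V by blast
  note C = B V_eq e(1)
  have eV: "e \<in> ?V" unfolding V by (rule e(1))
  let ?\<rho> = "left_ideal_module W (card W) w"
  have mod: "is_module ?\<rho>" by (rule is_module_left_ideal[OF C])
  have "?V \<noteq> {0}" using eV e(2) by blast
  then have "irreducible_module ?\<rho>"
    by (rule irreducible_left_ideal_module[OF C]) (rule minimal)
  then have scalars: "intertwiners ?\<rho> ?\<rho> = {c \<cdot>\<^sub>m 1\<^sub>m (module_dim ?\<rho>) | c. True}"
    using split unfolding split_semisimple_def by blast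
  have "e * x * e * e = e * x * e" "e * (e * x * e) = e * x * e"
    using e(1) by (simp_all add: mult.assoc mult.assoc[symmetric, of e e])
  then have ex: "x * e = x" "e * x = x" unfolding x by simp_all
  have "x \<in> ?V" unfolding V by (rule ex(1))
  then obtain c where "\<And>v. v \<in> ?V \<Longrightarrow> v * x = scale c v"
    using right_mult_scalar_on_left_ideal[OF C scalars] by blast
  from this[OF eV] have "x = scale c e"
    unfolding ex(2) .
  then have "two_sided_trace a x = c * mtrace (?\<rho> a)" for a
    by (simp add: two_sided_trace_scale_right mtrace_left_ideal_module[OF C])
  then show ?thesis using character_span.character[OF mod, of c] by simp
qed

text \<open>Induction on the dimension of \<open>H e\<close>. If \<open>H e\<close> is not minimal, semisimplicity splits off a proper nonzero
left ideal \<open>K\<close>, and \<open>e\<close> becomes a sum of orthogonal idempotents \<open>e\<^sub>1 + e\<^sub>2\<close> with \<open>H e\<^sub>1 = K\<close>. By the trace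
property \<open>T(a, x e\<^sub>i) = T(a, e\<^sub>i x e\<^sub>i)\<close>, so the off-diagonal blocks of \<open>x\<close> do not contribute and the
induction hypothesis applies to the diagonal ones.\<close>

lemma two_sided_trace_in_character_span_corner:
  assumes split: "split_semisimple"
  shows "e * e = e \<Longrightarrow> e * x * e = x \<Longrightarrow> (\<lambda>a. two_sided_trace a x) \<in> character_span"
proof (induction "dim (range (\<lambda>h. h * e))" arbitrary: e x rule: less_induct)
  case less
  interpret fd: finite_dimensional_vector_space scale trace_basis
    by unfold_locales (use trace_basis in auto)
  have ss: "semisimple_ring (ring_of_type_algebra :: 'h ring)"
    using split by (simp add: split_semisimple_def)
  have span_range: "span (range (\<lambda>h. h * y)) = range (\<lambda>h. h * y)" for y
    using subspace_range_right_mult by (simp add: span_eq_iff)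
  have smaller: "dim (range (\<lambda>h. h * y)) < dim (range (\<lambda>h. h * e))"
    if "range (\<lambda>h. h * y) \<subset> range (\<lambda>h. h * e)" for y
    by (rule fd.dim_psubset) (use that in \<open>simp add: span_range\<close>)
  let ?V = "range (\<lambda>h. h * e)"
  have V: "v * e = v" if "v \<in> ?V" for v using that less.prems(1) by (auto simp: mult.assoc)
  show ?case
  proof (cases "e = 0")
    case True
    have "e * x * e = 0" unfolding True by simp
    then have "x = 0" unfolding less.prems(2) .
    show ?thesis unfolding \<open>x = 0\<close> two_sided_trace_zero by (rule character_span.zero)
  next
    case e0: False
    define L where "L = (\<lambda>K. 0 \<in> K \<and> (\<forall>x\<in>K. \<forall>y\<in>K. x + y \<in> K) \<and> (\<forall>r. \<forall>x\<in>K. r * x \<in> K) \<and> K \<subseteq> ?V)"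
    show ?thesis
    proof (cases "\<forall>K. L K \<longrightarrow> K = {0} \<or> K = ?V")
      case True
      show ?thesis
      proof (rule two_sided_trace_minimal_left_ideal[OF split less.prems(1) e0 less.prems(2)])
        fix K :: "'h set"
        assume K: "0 \<in> K" "\<And>x y. x \<in> K \<Longrightarrow> y \<in> K \<Longrightarrow> x + y \<in> K" "\<And>r x. x \<in> K \<Longrightarrow> r * x \<in> K" "K \<subseteq> ?V"
        have "L K" unfolding L_def by (intro conjI ballI allI K)
        with True show "K = {0} \<or> K = ?V" by (elim allE impE)
      qed
    next
      case False
      then obtain K where LK: "L K" and nontrivial: "K \<noteq> {0}" "K \<noteq> ?V" by auto
      have K: "0 \<in> K" "\<And>x y. x \<in> K \<Longrightarrow> y \<in> K \<Longrightarrow> x + y \<in> K" "\<And>r x. x \<in> K \<Longrightarrow> r * x \<in> K" "K \<subseteq> ?V"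
        using LK unfolding L_def by simp_all
      obtain p where p: "p \<in> K" "\<And>y. y \<in> K \<Longrightarrow> y * p = y"
      proof (rule right_unit_of_left_ideal[OF ss K(1)])
        show "x + y \<in> K" if "x \<in> K" "y \<in> K" for x y using that by (rule K(2))
        show "r * x \<in> K" if "x \<in> K" for r x using that by (rule K(3))
      qed (rule that)
      have pe: "p * e = p" by (rule V[OF subsetD[OF K(4) p(1)]])
      have pp: "p * p = p" by (rule p(2)[OF p(1)])
      (* Right multiplication by e p projects H onto K, as does right multiplication by p; moreover
         e p is fixed by e on both sides, so e is the orthogonal sum of e p and e - e p. *)
      define e1 where "e1 = e * p"
      define e2 where "e2 = e - e1"
      have "e1 * e1 = e * (p * e * p)" by (simp only: e1_def mult.assoc)
      then have e1e: "e1 * e = e1" "e * e1 = e1" "e1 * e1 = e1"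
        by (simp_all only: e1_def mult.assoc pe pp) (simp only: mult.assoc[symmetric] less.prems(1))
      have e2: "e2 * e2 = e2" using e1e less.prems(1) by (simp add: e2_def left_diff_distrib right_diff_distrib)
      have range1: "range (\<lambda>h. h * e1) \<subseteq> K"
        using K(3)[OF p(1)] by (auto simp: e1_def mult.assoc[symmetric])
      have small1: "range (\<lambda>h. h * e1) \<subset> ?V" using range1 K(4) nontrivial(2) by blast
      have range2: "range (\<lambda>h. h * e2) \<subseteq> ?V"
      proof
        fix v assume "v \<in> range (\<lambda>h. h * e2)"
        then obtain h where "v = h * e2" by blast
        then have "v = (h - h * e1) * e"
          by (simp add: e2_def right_diff_distrib left_diff_distrib mult.assoc e1e)
        then show "v \<in> ?V" by blast
      qed
      have small2: "range (\<lambda>h. h * e2) \<subset> ?V"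
      proof -
        obtain k where k: "k \<in> K" "k \<noteq> 0" using K(1) nontrivial(1) by blast
        have "k \<notin> range (\<lambda>h. h * e2)"
        proof
          assume "k \<in> range (\<lambda>h. h * e2)"
          then obtain h where h: "k = h * e2" by blast
          have "e2 * p = 0" by (simp add: e2_def e1_def left_diff_distrib mult.assoc pp)
          then have "k * p = 0" by (simp add: h mult.assoc)
          then show False using p(2)[OF k(1)] k(2) by simp
        qed
        then show ?thesis using range2 k(1) K(4) by blast
      qed
      have corner: "(\<lambda>a. two_sided_trace a (y * x * y)) \<in> character_span"
        if "y * y = y" "range (\<lambda>h. h * y) \<subset> ?V" for y
      proof (rule less.hyps[OF smaller[OF that(2)] that(1)])
        have "y * (y * x * y) * y = (y * y) * x * (y * y)" by (simp only: mult.assoc)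
        then show "y * (y * x * y) * y = y * x * y" unfolding that(1) .
      qed
      have cyc: "two_sided_trace a (x * y) = two_sided_trace a (y * x * y)" if "y * y = y" for a y
        using two_sided_trace_commute[of a "x * y" y] that by (simp add: mult.assoc)
      have "e * x * e * e = e * x * e" by (simp only: mult.assoc less.prems(1))
      then have "x * e = x" unfolding less.prems(2) .
      then have "x = x * e1 + x * e2" by (simp add: e2_def right_diff_distrib)
      then have "two_sided_trace a x = two_sided_trace a (e1 * x * e1) + two_sided_trace a (e2 * x * e2)" for a
        unfolding cyc[OF e1e(3), symmetric] cyc[OF e2, symmetric]
        by (metis two_sided_trace_add_right)
      then show ?thesis
        using character_span.add[OF corner[OF e1e(3) small1] corner[OF e2 small2]] by simp
    qed
  qed
qed

lemma two_sided_trace_in_character_span: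
  "split_semisimple \<Longrightarrow> (\<lambda>a. two_sided_trace a x) \<in> character_span"
  using two_sided_trace_in_character_span_corner[of 1 x] by simp

theorem adjoint_character_nonzero:
  assumes split: "split_semisimple" and ss: "semisimple_ring representation_algebra" and g: "group_like g"
  shows "adjoint_character g \<noteq> 0"
proof -
  obtain \<Lambda> where \<Lambda>: "two_sided_integral \<Lambda>" "counit \<Lambda> = 1"
    using ex_normalized_two_sided_integral split unfolding split_semisimple_def by blast
  obtain f where f: "is_trace_functional f" "f g = 1"
    "\<And>\<rho> x. is_module \<rho> \<Longrightarrow> sweedler (\<lambda>a b. mtrace (\<rho> a) * f b) x = mtrace (\<rho> g) * f x"
    using ex_eigenfunctional[OF ss g] by blast
  have eigen: "sweedler (\<lambda>a b. \<phi> a * f b) x = \<phi> g * f x" if "\<phi> \<in> character_span" for \<phi> x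
    using that
  proof induction
    case zero
    then show ?case by (simp add: sweedler_zero)
  next
    case (add \<phi> \<psi>)
    then show ?case by (simp add: distrib_right sweedler_add_fun)
  next
    case (character \<rho> c)
    then show ?case using f(3)[of \<rho> x] by (simp add: mult.assoc sweedler_mult_left[symmetric])
  qed
  have "adjoint_character g * f \<Lambda> = sweedler (\<lambda>a b. two_sided_trace a (antipode g) * f b) \<Lambda>"
    unfolding adjoint_character_group_like[OF g]
    by (rule eigen[OF two_sided_trace_in_character_span[OF split], symmetric])
  also have "\<dots> = f g"
    by (rule trace_against_integral[OF \<Lambda> _ _ g]) (use f(1) in \<open>auto simp: is_trace_functional_def\<close>)
  finally show ?thesis using f(2) by auto
qed

end

theorem proposition23:
  fixes scale :: "'k::field \<Rightarrow> 'h::ring_1 \<Rightarrow> 'h"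
    and comult :: "'h \<Rightarrow> ('h \<times> 'h) list"
    and counit :: "'h \<Rightarrow> 'k"
    and antipode :: "'h \<Rightarrow> 'h"
    and g :: 'h
  assumes "hopf_algebra scale comult counit antipode"
    and "hopf_algebra.split_semisimple scale"
    and "semisimple_ring (hopf_algebra.representation_algebra scale comult counit)"
    and "hopf_algebra.group_like scale comult g"
  shows "hopf_algebra.adjoint_character scale comult antipode g \<noteq> 0"
  using hopf_algebra.adjoint_character_nonzero[OF assms] .

end
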